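(* Let $(\mathcal{G},o)$ be a connected unimodular random rooted graph with all degrees at most $d$, and let $w_n(o)$ denote the number of length $n$ walks in $\mathcal{G}$ starting at $o$. Then the limit $\lim_{n\to\infty}\frac1n\log w_n(o)$ exists almost surely. Further, if $(\mathcal{G},o)$ is ergodic and $\eta\in\mathrm{Prob}(\mathcal{M}_d)$ is the distribution of $(\mathcal{G},o)$, define $A\in B(L^2(\mathcal{M}_d,\eta))$ by $$(Af)([(G,o)])=\sum_{w\sim o}f([(G,w)]),$$ the sum being over the neighbours $w$ of $o$ in $G$. Then $A$ is a self-adjoint operator and, almost surely, $\log\|A\|=\lim_{n\to\infty}\frac1n\log w_n(o)$.
   Context: $\mathcal{M}_d$ is the space of isomorphism classes $[(G,o)]$ of connected rooted graphs in which every vertex has degree at most $d$, a compact metric space with distance $\inf\{2^{-l}:(B_G(o,l),o)\cong(B_{G'}(o',l),o')\}$, where $B_G(o,l)$ is the $l$-ball around $o$. A random rooted graph $(\mathcal{G},o)$ is unimodular if it satisfies the mass transport principle: $\mathbb{E}\sum_{v\in V(\mathcal{G})}F(\mathcal{G},o,v)=\mathbb{E}\sum_{v\in V(\mathcal{G})}F(\mathcal{G},v,o)$ for every nonnegative Borel function $F$ of isomorphism classes of doubly rooted graphs. The re-rooting equivalence relation on $\mathcal{M}_d$ relates $[(G,o)]$ and $[(G',o')]$ when $G\cong G'$ as unrooted graphs; $(\mathcal{G},o)$ is ergodic if every measurable subset of $\mathcal{M}_d$ invariant under this relation has $\eta$-measure $0$ or $1$. $B(V)$ denotes the bounded linear operators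 on $V$, and $\log0=-\infty$. *)

theory Defs
  imports "HOL-Probability.Probability"
begin

section \<open>Rooted graphs up to isomorphism\<close>

text \<open>
  Graphs are simple and undirected.  A connected graph with bounded degrees is countable, so
  taking the vertex set to be an arbitrary set of natural numbers loses no isomorphism class.
\<close>

record graph =
  verts :: "nat set"
  edges :: "(nat \<times> nat) set"

definition simple_graph :: "graph \<Rightarrow> bool" where
  "simple_graph G \<longleftrightarrow> edges G \<subseteq> verts G \<times> verts G \<and> sym (edges G) \<and> irrefl (edges G)"

definition connected_graph :: "graph \<Rightarrow> bool" where
  "connected_graph G \<longleftrightarrow> (\<forall>u\<in>verts G. \<forall>v\<in>verts G. (u, v) \<in> (edges G)\<^sup>*)"

definition neighbours :: "graph \<Rightarrow> nat \<Rightarrow> nat set" where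
  "neighbours G v = edges G `` {v}"

definition degree_le :: "nat \<Rightarrow> graph \<Rightarrow> bool" where
  "degree_le d G \<longleftrightarrow> (\<forall>v\<in>verts G. finite (neighbours G v) \<and> card (neighbours G v) \<le> d)"

definition graph_isom :: "(nat \<Rightarrow> nat) \<Rightarrow> graph \<Rightarrow> graph \<Rightarrow> bool" where
  "graph_isom \<phi> G H \<longleftrightarrow> bij_betw \<phi> (verts G) (verts H) \<and>
     (\<forall>u\<in>verts G. \<forall>v\<in>verts G. (u, v) \<in> edges G \<longleftrightarrow> (\<phi> u, \<phi> v) \<in> edges H)"

type_synonym rgraph = "graph \<times> nat"
type_synonym brgraph = "graph \<times> nat \<times> nat"

fun rooted_isom :: "rgraph \<Rightarrow> rgraph \<Rightarrow> bool" where
  "rooted_isom (G, r) (H, s) \<longleftrightarrow> r \<in> verts G \<and> (\<exists>\<phi>. graph_isom \<phi> G H \<and> \<phi> r = s)"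

fun birooted_isom :: "brgraph \<Rightarrow> brgraph \<Rightarrow> bool" where
  "birooted_isom (G, r, v) (H, s, w) \<longleftrightarrow>
     r \<in> verts G \<and> v \<in> verts G \<and> (\<exists>\<phi>. graph_isom \<phi> G H \<and> \<phi> r = s \<and> \<phi> v = w)"

definition rooted_equiv :: "(rgraph \<times> rgraph) set" where
  "rooted_equiv = {(R, S). simple_graph (fst R) \<and> simple_graph (fst S) \<and> rooted_isom R S}"

definition birooted_equiv :: "(brgraph \<times> brgraph) set" where
  "birooted_equiv = {(R, S). simple_graph (fst R) \<and> simple_graph (fst S) \<and> birooted_isom R S}"

definition rclass :: "graph \<Rightarrow> nat \<Rightarrow> rgraph set" where
  "rclass G r = rooted_equiv `` {(G, r)}"

definition brclass :: "graph \<Rightarrow> nat \<Rightarrow> nat \<Rightarrow> brgraph set" where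
  "brclass G r v = birooted_equiv `` {(G, r, v)}"

definition Mspace :: "nat \<Rightarrow> rgraph set set" where
  "Mspace d = {rclass G r | G r.
     simple_graph G \<and> connected_graph G \<and> degree_le d G \<and> r \<in> verts G}"

definition BMspace :: "nat \<Rightarrow> brgraph set set" where
  "BMspace d = {brclass G r v | G r v.
     simple_graph G \<and> connected_graph G \<and> degree_le d G \<and> r \<in> verts G \<and> v \<in> verts G}"

definition ball_verts :: "graph \<Rightarrow> nat \<Rightarrow> nat \<Rightarrow> nat set" where
  "ball_verts G r l = {v \<in> verts G. \<exists>k\<le>l. (r, v) \<in> edges G ^^ k}"

definition graph_ball :: "graph \<Rightarrow> nat \<Rightarrow> nat \<Rightarrow> graph" where
  "graph_ball G r l =
     \<lparr>verts = ball_verts G r l, edges = edges G \<inter> (ball_verts G r l \<times> ball_verts G r l)\<rparr>"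

text \<open>
  On \<^term>\<open>Mspace d\<close> the element \<^term>\<open>1::real\<close> inserted below is redundant: balls of radius
  \<^term>\<open>0::nat\<close> are always isomorphic.  It only keeps the infimum meaningful for arguments outside
  the space, where \<^locale>\<open>Metric_space\<close> still demands nonnegativity.
\<close>

definition Mdist :: "rgraph set \<Rightarrow> rgraph set \<Rightarrow> real" where
  "Mdist x y = Inf (insert 1 {(1/2) ^ l | l. \<exists>G r H s. (G, r) \<in> x \<and> (H, s) \<in> y \<and>
     rooted_isom (graph_ball G r l, r) (graph_ball H s l, s)})"

text \<open>
  The analogous local metric for doubly rooted graphs.  Balls are centred at the first root, and
  only radii count for which both second roots lie in the balls and correspond to each other
  (membership is enforced by \<^const>\<open>birooted_isom\<close>); the distance is 1 if there is no such radius.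
\<close>

definition BMdist :: "brgraph set \<Rightarrow> brgraph set \<Rightarrow> real" where
  "BMdist x y = Inf (insert 1 {(1/2) ^ l | l. \<exists>G r v H s w. (G, r, v) \<in> x \<and> (H, s, w) \<in> y \<and>
     birooted_isom (graph_ball G r l, r, v) (graph_ball H s l, s, w)})"

definition metric_borel :: "'a set \<Rightarrow> ('a \<Rightarrow> 'a \<Rightarrow> real) \<Rightarrow> 'a measure" where
  "metric_borel S \<delta> = sigma S {U. openin (Metric_space.mtopology S \<delta>) U}"

definition Mborel :: "nat \<Rightarrow> rgraph set measure" where
  "Mborel d = metric_borel (Mspace d) Mdist"

definition BMborel :: "nat \<Rightarrow> brgraph set measure" where
  "BMborel d = metric_borel (BMspace d) BMdist"

text \<open>
  Functions of an isomorphism class are evaluated on a chosen representative; all functions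
  below are isomorphism invariant, so the choice does not matter.
\<close>

definition rep :: "rgraph set \<Rightarrow> rgraph" where
  "rep x = (SOME R. R \<in> x)"

definition rep_graph :: "rgraph set \<Rightarrow> graph" where
  "rep_graph x = fst (rep x)"

definition rep_root :: "rgraph set \<Rightarrow> nat" where
  "rep_root x = snd (rep x)"


section \<open>Unimodularity and ergodicity\<close>

definition unimodular :: "nat \<Rightarrow> 'p measure \<Rightarrow> ('p \<Rightarrow> rgraph set) \<Rightarrow> bool" where
  "unimodular d P X \<longleftrightarrow> (\<forall>F :: brgraph set \<Rightarrow> ennreal. F \<in> borel_measurable (BMborel d) \<longrightarrow>
     (\<integral>\<^sup>+\<omega>. (\<integral>\<^sup>+v. F (brclass (rep_graph (X \<omega>)) (rep_root (X \<omega>)) v)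
                 \<partial>count_space (verts (rep_graph (X \<omega>)))) \<partial>P) =
     (\<integral>\<^sup>+\<omega>. (\<integral>\<^sup>+v. F (brclass (rep_graph (X \<omega>)) v (rep_root (X \<omega>)))
                 \<partial>count_space (verts (rep_graph (X \<omega>)))) \<partial>P))"

definition rerooting :: "rgraph set \<Rightarrow> rgraph set \<Rightarrow> bool" where
  "rerooting x y \<longleftrightarrow> (\<exists>G r H s \<phi>. (G, r) \<in> x \<and> (H, s) \<in> y \<and> graph_isom \<phi> G H)"

definition ergodic :: "nat \<Rightarrow> rgraph set measure \<Rightarrow> bool" where
  "ergodic d \<eta> \<longleftrightarrow> (\<forall>S\<in>sets (Mborel d).
     (\<forall>x\<in>S. \<forall>y\<in>Mspace d. rerooting x y \<longrightarrow> y \<in> S) \<longrightarrow> measure \<eta> S = 0 \<or> measure \<eta> S = 1)"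


section \<open>Walks\<close>

definition walks :: "graph \<Rightarrow> nat \<Rightarrow> nat \<Rightarrow> nat list set" where
  "walks G r n = {p. length p = Suc n \<and> hd p = r \<and> set p \<subseteq> verts G \<and>
     successively (\<lambda>u v. (u, v) \<in> edges G) p}"

definition walk_count :: "nat \<Rightarrow> rgraph set \<Rightarrow> nat" where
  "walk_count n x = card (walks (rep_graph x) (rep_root x) n)"

text \<open>The convention \<open>log 0 = -\<infinity>\<close> is not that of \<^const>\<open>ln\<close> on the reals.\<close>

definition elog :: "real \<Rightarrow> ereal" where
  "elog t = (if t = 0 then - \<infinity> else ereal (ln t))"

definition walk_rate :: "rgraph set \<Rightarrow> nat \<Rightarrow> ereal" where
  "walk_rate x n = ereal (1 / real n) * elog (real (walk_count n x))"


section \<open>Operators on \<open>L\<^sup>2\<close>\<close>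

text \<open>
  Elements of the complex Hilbert space \<open>L\<^sup>2(M)\<close> are represented by square integrable functions,
  equality being equality almost everywhere.  An operator on \<open>L\<^sup>2(M)\<close> is thus a map on functions
  that respects almost everywhere equality.
\<close>

definition L2 :: "'a measure \<Rightarrow> ('a \<Rightarrow> complex) set" where
  "L2 M = {f \<in> borel_measurable M. integrable M (\<lambda>x. (cmod (f x))\<^sup>2)}"

definition L2_inner :: "'a measure \<Rightarrow> ('a \<Rightarrow> complex) \<Rightarrow> ('a \<Rightarrow> complex) \<Rightarrow> complex" where
  "L2_inner M f g = (\<integral>x. f x * cnj (g x) \<partial>M)"

definition L2_norm :: "'a measure \<Rightarrow> ('a \<Rightarrow> complex) \<Rightarrow> real" where
  "L2_norm M f = sqrt (\<integral>x. (cmod (f x))\<^sup>2 \<partial>M)"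

definition L2_bounded_operator ::
    "'a measure \<Rightarrow> (('a \<Rightarrow> complex) \<Rightarrow> ('a \<Rightarrow> complex)) \<Rightarrow> bool" where
  "L2_bounded_operator M T \<longleftrightarrow>
     (\<forall>f\<in>L2 M. T f \<in> L2 M) \<and>
     (\<forall>f\<in>L2 M. \<forall>g\<in>L2 M. (AE x in M. f x = g x) \<longrightarrow> (AE x in M. T f x = T g x)) \<and>
     (\<forall>f\<in>L2 M. \<forall>g\<in>L2 M. AE x in M. T (\<lambda>y. f y + g y) x = T f x + T g x) \<and>
     (\<forall>c. \<forall>f\<in>L2 M. AE x in M. T (\<lambda>y. c * f y) x = c * T f x) \<and>
     (\<exists>C. \<forall>f\<in>L2 M. L2_norm M (T f) \<le> C * L2_norm M f)"

definition L2_selfadjoint ::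
    "'a measure \<Rightarrow> (('a \<Rightarrow> complex) \<Rightarrow> ('a \<Rightarrow> complex)) \<Rightarrow> bool" where
  "L2_selfadjoint M T \<longleftrightarrow> (\<forall>f\<in>L2 M. \<forall>g\<in>L2 M. L2_inner M (T f) g = L2_inner M f (T g))"

text \<open>As for \<^const>\<open>onorm\<close>, the quotient is 0 for functions of norm 0.\<close>

definition L2_onorm :: "'a measure \<Rightarrow> (('a \<Rightarrow> complex) \<Rightarrow> ('a \<Rightarrow> complex)) \<Rightarrow> real" where
  "L2_onorm M T = (SUP f\<in>L2 M. L2_norm M (T f) / L2_norm M f)"

definition adjacency_op :: "(rgraph set \<Rightarrow> complex) \<Rightarrow> (rgraph set \<Rightarrow> complex)" where
  "adjacency_op f x =
     (\<Sum>w\<in>neighbours (rep_graph x) (rep_root x). f (rclass (rep_graph x) w))"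

end

theory Submission
  imports Defs "HOL-Real_Asymp.Real_Asymp"
begin

text \<open>
  Let \<open>A\<close> be the adjacency operator and \<open>w\<^bsub>n\<^esub> = A\<^sup>n 1\<close> the number of \<open>n\<close>-walks from the root.  Mass
  transport says that \<open>A\<close> is symmetric on nonnegative functions (\<open>unimodular_adj\<close>).  This makes it a
  bounded self-adjoint operator on \<open>L\<^sup>2\<close>, of norm \<open>\<rho>\<close>, say.

  The limit exists.  By the Cauchy-Schwarz inequality,
  \<open>w\<^bsub>n\<^esub>\<^sup>2 * w\<^bsub>j\<^esub> \<le> Z\<^bsub>n,j\<^esub> * w\<^bsub>2n+j\<^esub>\<close> with \<open>Z\<^bsub>n,j\<^esub> = w\<^bsub>j\<^esub> * A\<^sup>n (1 / w\<^bsub>n+j\<^esub>)\<close> (\<open>wcount_doubling\<close>), and by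
  symmetry the expectation of \<open>Z\<^bsub>n,j\<^esub>\<close> is at most that of \<open>(A\<^sup>n w\<^bsub>j\<^esub>) / w\<^bsub>n+j\<^esub> = 1\<close>.  Hence almost surely
  \<open>Z\<^bsub>n,j\<^esub>\<close> is bounded by a polynomial in \<open>n\<close> for \<open>j \<le> n\<close>.  So \<open>a\<^bsub>n\<^esub> = ln w\<^bsub>n\<^esub>\<close> satisfies
  \<open>a\<^bsub>2n\<^esub> \<ge> 2 a\<^bsub>n\<^esub>\<close> and \<open>a\<^bsub>2n+j\<^esub> \<ge> 2 a\<^bsub>n\<^esub> + a\<^bsub>j\<^esub>\<close> up to logarithmic errors; writing \<open>k\<close> in base two gives
  \<open>a\<^bsub>km\<^esub> \<ge> k a\<^bsub>m\<^esub>\<close> up to errors negligible for large \<open>m\<close>, and \<open>a\<^bsub>n\<^esub> / n\<close> converges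
  (\<open>growth_rate_converges\<close>).

  The limit is \<open>ln \<rho>\<close> in the ergodic case.  The expectation of \<open>w\<^bsub>n\<^esub>\<^sup>2\<close>, the squared norm of \<open>A\<^sup>n 1\<close>,
  is at most \<open>\<rho> ^ (2 * n)\<close>, which bounds the limit from above.  For the lower bound, the event that
  \<open>w\<^bsub>n\<^esub>\<close> is at most of order \<open>c ^ n\<close> is invariant under re-rooting.  If it has probability 1, then
  the bounded functions \<open>g\<close> supported where \<open>w\<^bsub>n\<^esub> \<le> C * c ^ n\<close> for all \<open>n\<close>, for some constant \<open>C\<close>, are
  dense; for them the squared norm of \<open>A\<^sup>n g\<close> is at most of order \<open>c ^ (2 * n)\<close>, and as these squared
  norms are log-convex in \<open>n\<close>, the norm of \<open>A g\<close> is at most \<open>c\<close> times that of \<open>g\<close>.  So \<open>\<rho> \<le> c\<close>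
  (\<open>onorm_le_growth\<close>).  For \<open>c < \<rho>\<close> the event therefore has probability 0.

  A preliminary part identifies the topology.  That the local distances are metrics rests on
  Koenig's lemma (\<open>ball_isoms_converge\<close>); after that, continuity and measurability only involve
  isomorphisms of balls.
\<close>

section \<open>Isomorphisms of balls\<close>

text \<open>
  An isomorphism of the \<open>l\<close>-balls around \<open>r\<close> and \<open>s\<close> taking centre to centre.  Outside the ball
  the values of \<open>\<phi>\<close> are irrelevant.
\<close>

definition ball_isom :: "(nat \<Rightarrow> nat) \<Rightarrow> graph \<Rightarrow> nat \<Rightarrow> graph \<Rightarrow> nat \<Rightarrow> nat \<Rightarrow> bool" where
  "ball_isom \<phi> G r H s l \<longleftrightarrow> graph_isom \<phi> (graph_ball G r l) (graph_ball H s l) \<and> \<phi> r = s"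

lemma ball_isom_iff:
  "ball_isom \<phi> G r H s l \<longleftrightarrow> bij_betw \<phi> (ball_verts G r l) (ball_verts H s l) \<and>
     (\<forall>u\<in>ball_verts G r l. \<forall>v\<in>ball_verts G r l. (u, v) \<in> edges G \<longleftrightarrow> (\<phi> u, \<phi> v) \<in> edges H) \<and> \<phi> r = s"
  unfolding ball_isom_def graph_isom_def graph_ball_def
  by (auto simp: bij_betw_apply)

lemma simple_graph_vertsD:
  assumes "simple_graph G" "(u, v) \<in> edges G" shows "u \<in> verts G" "v \<in> verts G"
  using assms by (auto simp: simple_graph_def)

lemma relpow_verts:
  assumes "simple_graph G" "(u, v) \<in> edges G ^^ k" "u \<in> verts G" shows "v \<in> verts G"
  using assms(2,3) by (induction k arbitrary: v) (auto dest: simple_graph_vertsD[OF assms(1)])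

lemma root_in_ball [simp]: "r \<in> ball_verts G r l \<longleftrightarrow> r \<in> verts G"
  by (auto simp: ball_verts_def intro!: exI[of _ 0])

lemma ball_verts_subset: "ball_verts G r l \<subseteq> verts G"
  by (auto simp: ball_verts_def)

lemma ball_verts_mono: "k \<le> l \<Longrightarrow> ball_verts G r k \<subseteq> ball_verts G r l"
  unfolding ball_verts_def using le_trans by blast

lemma ball_verts_step:
  assumes "simple_graph G" "u \<in> ball_verts G r k" "(u, v) \<in> edges G ^^ m" "k + m \<le> l"
  shows "v \<in> ball_verts G r l"
proof -
  obtain i where i: "i \<le> k" "(r, u) \<in> edges G ^^ i" and u: "u \<in> verts G"
    using assms(2) by (auto simp: ball_verts_def)
  have "(r, v) \<in> edges G ^^ (i + m)"
    unfolding relpow_add using i assms(3) by auto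
  moreover have "v \<in> verts G" using relpow_verts[OF assms(1,3) u] .
  moreover have "i + m \<le> l" using i assms(4) by simp
  ultimately show ?thesis by (auto simp: ball_verts_def)
qed

lemma ball_verts_trans:
  assumes "simple_graph G" "v \<in> ball_verts G r k" "k + m \<le> l"
  shows "ball_verts G v m \<subseteq> ball_verts G r l"
proof
  fix u assume "u \<in> ball_verts G v m"
  then obtain i where "i \<le> m" "(v, u) \<in> edges G ^^ i" by (auto simp: ball_verts_def)
  thus "u \<in> ball_verts G r l" using ball_verts_step[OF assms(1,2), of u i l] assms(3) by simp
qed

text \<open>
  Walks that start in the \<open>k\<close>-ball and have length at most \<open>l - k\<close> do not leave the \<open>l\<close>-ball, so an
  isomorphism of \<open>l\<close>-balls maps them to walks.
\<close>

lemma ball_isom_relpow: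
  assumes "simple_graph G" "ball_isom \<phi> G r H s l" "u \<in> ball_verts G r k"
    and "(u, v) \<in> edges G ^^ m" "k + m \<le> l"
  shows "(\<phi> u, \<phi> v) \<in> edges H ^^ m"
  using assms(4,5)
proof (induction m arbitrary: v)
  case (Suc m)
  then obtain y where y: "(u, y) \<in> edges G ^^ m" "(y, v) \<in> edges G" by auto
  have "y \<in> ball_verts G r l"
    using ball_verts_step[OF assms(1,3) y(1)] Suc.prems by simp
  moreover have "v \<in> ball_verts G r l"
    using ball_verts_step[OF assms(1,3) Suc.prems(1)] Suc.prems by simp
  ultimately have "(\<phi> y, \<phi> v) \<in> edges H" using assms(2) y(2) by (auto simp: ball_isom_iff)
  thus ?case using Suc.IH[OF y(1)] Suc.prems by auto
qed auto

lemma ball_isom_in_ball: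
  assumes "simple_graph G" "ball_isom \<phi> G r H s l" "u \<in> ball_verts G r k" "k \<le> l" "r \<in> verts G"
  shows "\<phi> u \<in> ball_verts H s k"
proof -
  obtain i where i: "i \<le> k" "(r, u) \<in> edges G ^^ i" using assms(3) by (auto simp: ball_verts_def)
  have "(\<phi> r, \<phi> u) \<in> edges H ^^ i"
    using ball_isom_relpow[OF assms(1,2), of r 0 u i] i assms(4,5) by simp
  moreover have "\<phi> u \<in> verts H"
    using assms(2,3) ball_verts_mono[OF assms(4), of G r] ball_verts_subset[of H s l]
    unfolding ball_isom_iff by (meson bij_betw_apply subsetD)
  ultimately show ?thesis using i assms(2) by (auto simp: ball_isom_iff ball_verts_def)
qed

lemma ball_isom_inv:
  assumes "ball_isom \<phi> G r H s l" "r \<in> verts G"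
  shows "ball_isom (inv_into (ball_verts G r l) \<phi>) H s G r l"
proof -
  let ?\<psi> = "inv_into (ball_verts G r l) \<phi>"
  have bij: "bij_betw \<phi> (ball_verts G r l) (ball_verts H s l)" using assms by (simp add: ball_isom_iff)
  have "?\<psi> s = r"
    using bij_betw_inv_into_left[OF bij, of r] assms by (auto simp: ball_isom_iff)
  moreover have "bij_betw ?\<psi> (ball_verts H s l) (ball_verts G r l)"
    by (rule bij_betw_inv_into[OF bij])
  moreover have "(u, v) \<in> edges H \<longleftrightarrow> (?\<psi> u, ?\<psi> v) \<in> edges G"
    if "u \<in> ball_verts H s l" "v \<in> ball_verts H s l" for u v
  proof -
    have "\<phi> (?\<psi> u) = u" "\<phi> (?\<psi> v) = v" "?\<psi> u \<in> ball_verts G r l" "?\<psi> v \<in> ball_verts G r l"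
      using that bij bij_betw_inv_into_right[OF bij] bij_betw_apply[OF bij_betw_inv_into[OF bij]] by auto
    thus ?thesis using assms(1) unfolding ball_isom_iff by metis
  qed
  ultimately show ?thesis by (simp add: ball_isom_iff)
qed

lemma ball_isom_compose:
  assumes "ball_isom \<phi> G r H s l" "ball_isom \<psi> H s K t l"
  shows "ball_isom (\<psi> \<circ> \<phi>) G r K t l"
  using assms bij_betw_trans[of \<phi> "ball_verts G r l" "ball_verts H s l" \<psi>]
  by (auto simp: ball_isom_iff bij_betw_apply)

text \<open>
  An isomorphism of balls restricts to an isomorphism between smaller balls, also around other
  centres, as long as the smaller ball lies inside the larger one.
\<close>

lemma ball_isom_recentre:
  assumes "simple_graph G" "simple_graph H" "ball_isom \<phi> G r H s l" "r \<in> verts G"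
    and "v \<in> ball_verts G r k" "k + m \<le> l"
  shows "ball_isom \<phi> G v H (\<phi> v) m"
proof -
  have sub: "ball_verts G v m \<subseteq> ball_verts G r l"
    using ball_verts_trans[OF assms(1,5,6)] .
  have bij: "bij_betw \<phi> (ball_verts G r l) (ball_verts H s l)" using assms by (simp add: ball_isom_iff)
  have fv: "\<phi> v \<in> ball_verts H s k"
    using ball_isom_in_ball[OF assms(1,3,5) _ assms(4)] assms(6) by simp
  let ?\<psi> = "inv_into (ball_verts G r l) \<phi>"
  have inv: "ball_isom ?\<psi> H s G r l" by (rule ball_isom_inv[OF assms(3,4)])
  have vl: "v \<in> ball_verts G r l" using assms(5,6) ball_verts_mono[of k l] by auto
  have left: "?\<psi> (\<phi> u) = u" if "u \<in> ball_verts G r l" for u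
    using bij_betw_inv_into_left[OF bij that] .
  have right: "\<phi> (?\<psi> u) = u" if "u \<in> ball_verts H s l" for u
    using bij_betw_inv_into_right[OF bij that] .
  have "\<phi> ` ball_verts G v m = ball_verts H (\<phi> v) m"
  proof (intro equalityI subsetI)
    fix y assume "y \<in> \<phi> ` ball_verts G v m"
    then obtain u i where u: "y = \<phi> u" "i \<le> m" "(v, u) \<in> edges G ^^ i" "u \<in> ball_verts G v m"
      by (auto simp: ball_verts_def)
    have "(\<phi> v, \<phi> u) \<in> edges H ^^ i"
      using ball_isom_relpow[OF assms(1,3,5) u(3)] u assms(6) by simp
    moreover have "\<phi> u \<in> verts H"
      using bij_betw_apply[OF bij] sub u(4) ball_verts_subset by blast
    ultimately show "y \<in> ball_verts H (\<phi> v) m" using u by (auto simp: ball_verts_def)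
  next
    fix y assume y: "y \<in> ball_verts H (\<phi> v) m"
    then obtain i where i: "i \<le> m" "(\<phi> v, y) \<in> edges H ^^ i" by (auto simp: ball_verts_def)
    have yl: "y \<in> ball_verts H s l" using ball_verts_trans[OF assms(2) fv assms(6)] y by auto
    have "(?\<psi> (\<phi> v), ?\<psi> y) \<in> edges G ^^ i"
      using ball_isom_relpow[OF assms(2) inv fv i(2)] i assms(6) by simp
    hence "(v, ?\<psi> y) \<in> edges G ^^ i" using left[OF vl] by simp
    moreover have "?\<psi> y \<in> verts G"
      using bij_betw_apply[OF bij_betw_inv_into[OF bij] yl] ball_verts_subset by blast
    ultimately have "?\<psi> y \<in> ball_verts G v m" using i by (auto simp: ball_verts_def)
    thus "y \<in> \<phi> ` ball_verts G v m" using right[OF yl] by force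
  qed
  moreover have "inj_on \<phi> (ball_verts G v m)"
    using bij sub by (meson bij_betw_imp_inj_on inj_on_subset)
  ultimately show ?thesis using assms(3) sub by (auto simp: ball_isom_iff bij_betw_def subset_eq)
qed

lemma ball_isom_restrict:
  assumes "simple_graph G" "simple_graph H" "ball_isom \<phi> G r H s l" "r \<in> verts G" "m \<le> l"
  shows "ball_isom \<phi> G r H s m"
  using ball_isom_recentre[OF assms(1-4), of r 0 m] assms by (auto simp: ball_isom_iff)

lemma graph_isom_relpow:
  assumes "simple_graph G" "graph_isom \<phi> G H" "u \<in> verts G" "(u, v) \<in> edges G ^^ m"
  shows "(\<phi> u, \<phi> v) \<in> edges H ^^ m"
  using assms(4)
proof (induction m arbitrary: v)
  case (Suc m)
  then obtain y where y: "(u, y) \<in> edges G ^^ m" "(y, v) \<in> edges G" by auto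
  thus ?case using Suc.IH[OF y(1)] assms(2) simple_graph_vertsD[OF assms(1) y(2)]
    by (auto simp: graph_isom_def)
qed auto

lemma graph_isom_inv:
  assumes "graph_isom \<phi> G H"
  shows "graph_isom (inv_into (verts G) \<phi>) H G"
proof -
  let ?\<psi> = "inv_into (verts G) \<phi>"
  have bij: "bij_betw \<phi> (verts G) (verts H)" using assms by (simp add: graph_isom_def)
  have "(u, v) \<in> edges H \<longleftrightarrow> (?\<psi> u, ?\<psi> v) \<in> edges G" if "u \<in> verts H" "v \<in> verts H" for u v
  proof -
    have "\<phi> (?\<psi> u) = u" "\<phi> (?\<psi> v) = v" "?\<psi> u \<in> verts G" "?\<psi> v \<in> verts G"
      using that bij bij_betw_inv_into_right[OF bij] bij_betw_apply[OF bij_betw_inv_into[OF bij]] by auto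
    thus ?thesis using assms unfolding graph_isom_def by metis
  qed
  thus ?thesis using bij_betw_inv_into[OF bij] by (simp add: graph_isom_def)
qed

lemma graph_isom_compose:
  assumes "graph_isom \<phi> G H" "graph_isom \<psi> H K"
  shows "graph_isom (\<psi> \<circ> \<phi>) G K"
  using assms bij_betw_trans[of \<phi> "verts G" "verts H" \<psi>]
  by (auto simp: graph_isom_def bij_betw_apply)

lemma graph_isom_ball_isom:
  assumes "simple_graph G" "simple_graph H" "graph_isom \<phi> G H" "r \<in> verts G"
  shows "ball_isom \<phi> G r H (\<phi> r) l"
proof -
  let ?\<psi> = "inv_into (verts G) \<phi>"
  have bij: "bij_betw \<phi> (verts G) (verts H)" using assms by (simp add: graph_isom_def)
  have inv: "graph_isom ?\<psi> H G" by (rule graph_isom_inv[OF assms(3)])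
  have "\<phi> ` ball_verts G r l = ball_verts H (\<phi> r) l"
  proof (intro equalityI subsetI)
    fix y assume "y \<in> \<phi> ` ball_verts G r l"
    thus "y \<in> ball_verts H (\<phi> r) l"
      using graph_isom_relpow[OF assms(1,3,4)] bij_betw_apply[OF bij] by (auto simp: ball_verts_def)
  next
    fix y assume "y \<in> ball_verts H (\<phi> r) l"
    then obtain i where i: "i \<le> l" "(\<phi> r, y) \<in> edges H ^^ i" and y: "y \<in> verts H"
      by (auto simp: ball_verts_def)
    have "(?\<psi> (\<phi> r), ?\<psi> y) \<in> edges G ^^ i"
      using graph_isom_relpow[OF assms(2) inv _ i(2)] bij_betw_apply[OF bij assms(4)] by auto
    hence "(r, ?\<psi> y) \<in> edges G ^^ i" using bij_betw_inv_into_left[OF bij assms(4)] by simp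
    hence "?\<psi> y \<in> ball_verts G r l"
      using i bij_betw_apply[OF bij_betw_inv_into[OF bij] y] by (auto simp: ball_verts_def)
    thus "y \<in> \<phi> ` ball_verts G r l" using bij_betw_inv_into_right[OF bij y] by force
  qed
  moreover have "inj_on \<phi> (ball_verts G r l)"
    using bij ball_verts_subset[of G r l] by (meson bij_betw_imp_inj_on inj_on_subset)
  ultimately show ?thesis using assms(3) ball_verts_subset[of G r l]
    by (auto simp: ball_isom_iff bij_betw_def graph_isom_def subset_eq)
qed

section \<open>Connected graphs of bounded degree\<close>

text \<open>
  The graphs whose rooted isomorphism classes are the points of the space.
\<close>

definition good_graph :: "nat \<Rightarrow> graph \<Rightarrow> bool" where
  "good_graph d G \<longleftrightarrow> simple_graph G \<and> connected_graph G \<and> degree_le d G"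

lemma good_graphD:
  assumes "good_graph d G"
  shows "simple_graph G" "connected_graph G" "degree_le d G"
  using assms by (auto simp: good_graph_def)

lemma neighbours_subset: "simple_graph G \<Longrightarrow> neighbours G v \<subseteq> verts G"
  by (auto simp: neighbours_def simple_graph_def)

lemma finite_neighbours: "good_graph d G \<Longrightarrow> v \<in> verts G \<Longrightarrow> finite (neighbours G v)"
  by (auto simp: good_graph_def degree_le_def)

lemma ball_verts_finite:
  assumes "good_graph d G" "r \<in> verts G"
  shows "finite (ball_verts G r l)"
proof -
  have "finite {v. (r, v) \<in> edges G ^^ k}" for k
  proof (induction k)
    case (Suc k)
    have "{v. (r, v) \<in> edges G ^^ Suc k} = (\<Union>y\<in>{v. (r, v) \<in> edges G ^^ k}. neighbours G y)"
      by (auto simp: neighbours_def)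
    moreover have "finite (neighbours G y)" if "(r, y) \<in> edges G ^^ k" for y
      using finite_neighbours[OF assms(1) relpow_verts[OF good_graphD(1)[OF assms(1)] that assms(2)]] .
    ultimately show ?case using Suc by simp
  qed auto
  moreover have "ball_verts G r l \<subseteq> (\<Union>k\<le>l. {v. (r, v) \<in> edges G ^^ k})"
    by (auto simp: ball_verts_def)
  ultimately show ?thesis by (meson finite_UN_I finite_atMost finite_subset)
qed

lemma ex_ball:
  assumes "good_graph d G" "r \<in> verts G" "v \<in> verts G"
  shows "\<exists>k. v \<in> ball_verts G r k"
proof -
  have "(r, v) \<in> (edges G)\<^sup>*" using assms by (auto simp: good_graph_def connected_graph_def)
  then obtain k where "(r, v) \<in> edges G ^^ k" by (auto simp: rtrancl_power)
  thus ?thesis using assms by (auto simp: ball_verts_def)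
qed

lemma graph_isom_good:
  assumes "good_graph d G" "simple_graph H" "graph_isom \<phi> G H"
  shows "good_graph d H"
proof -
  let ?\<psi> = "inv_into (verts G) \<phi>"
  have G: "simple_graph G" using assms by (simp add: good_graph_def)
  have bij: "bij_betw \<phi> (verts G) (verts H)" using assms by (simp add: graph_isom_def)
  have inv: "graph_isom ?\<psi> H G" by (rule graph_isom_inv[OF assms(3)])
  have right: "\<phi> (?\<psi> u) = u" "?\<psi> u \<in> verts G" if "u \<in> verts H" for u
    using bij_betw_inv_into_right[OF bij that] bij_betw_apply[OF bij_betw_inv_into[OF bij] that] by auto
  have "(u, v) \<in> (edges H)\<^sup>*" if uv: "u \<in> verts H" "v \<in> verts H" for u v
  proof -
    have "(?\<psi> u, ?\<psi> v) \<in> (edges G)\<^sup>*"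
      using assms(1) right(2) uv by (auto simp: good_graph_def connected_graph_def)
    then obtain k where "(?\<psi> u, ?\<psi> v) \<in> edges G ^^ k" by (auto simp: rtrancl_power)
    from graph_isom_relpow[OF G assms(3) right(2)[OF uv(1)] this] right uv
    show ?thesis by (auto simp: rtrancl_power)
  qed
  moreover have "finite (neighbours H v) \<and> card (neighbours H v) \<le> d" if v: "v \<in> verts H" for v
  proof -
    have fin: "finite (neighbours G (?\<psi> v))" "card (neighbours G (?\<psi> v)) \<le> d"
      using assms(1) right(2)[OF v] by (auto simp: good_graph_def degree_le_def)
    have "neighbours H v \<subseteq> \<phi> ` neighbours G (?\<psi> v)"
    proof
      fix w assume "w \<in> neighbours H v"
      hence e: "(v, w) \<in> edges H" by (simp add: neighbours_def)
      hence w: "w \<in> verts H" using simple_graph_vertsD[OF assms(2)] by auto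
      have "(?\<psi> v, ?\<psi> w) \<in> edges G" using inv e v w by (auto simp: graph_isom_def)
      thus "w \<in> \<phi> ` neighbours G (?\<psi> v)" using right(1)[OF w] by (force simp: neighbours_def)
    qed
    thus ?thesis using fin
      by (meson card_image_le card_mono finite_imageI finite_subset le_trans)
  qed
  ultimately show ?thesis using assms(2)
    by (auto simp: good_graph_def connected_graph_def degree_le_def)
qed

text \<open>
  Koenig's lemma: if all balls around two roots are isomorphic, compatible isomorphisms can be
  chosen.  The sequence of ball isomorphisms lies in a product of finite sets, which is compact,
  and a limit point is an isomorphism of the graphs.  As it takes each of its values from the sequence,
  any further vertex matched by all ball isomorphisms, such as a second root, is still matched.
\<close>

lemma ball_isoms_converge:
  assumes G: "good_graph d G" "r \<in> verts G" and H: "good_graph d H" "s \<in> verts H"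
    and iso: "\<And>l. ball_isom (\<phi> l) G r H s l"
  shows "\<exists>\<psi>. graph_isom \<psi> G H \<and> \<psi> r = s \<and> (\<forall>u\<in>verts G. \<exists>l. \<psi> u = \<phi> l u)"
proof -
  note sG = good_graphD(1)[OF G(1)] and sH = good_graphD(1)[OF H(1)]
  have "\<exists>k. \<forall>u\<in>verts G. u \<in> ball_verts G r (k u)"
    using ex_ball[OF G] by metis
  then obtain k where k: "\<And>u. u \<in> verts G \<Longrightarrow> u \<in> ball_verts G r (k u)" by blast
  define K where "K u = (if u \<in> verts G then insert 0 (ball_verts H s (k u)) else {0})" for u
  \<comment> \<open>the default value 0 is used until the ball is large enough to contain \<open>u\<close>\<close>
  define f where "f l u = (if u \<in> verts G \<and> k u \<le> l then \<phi> l u else 0)" for l u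
  have fin: "finite (K u)" for u
    using ball_verts_finite[OF H] by (simp add: K_def)
  have "f l u \<in> K u" for l u
    using ball_isom_in_ball[OF sG iso[of l] k, of u] G(2) by (auto simp: f_def K_def)
  hence fK: "f l \<in> (\<Pi>\<^sub>E u\<in>UNIV. K u)" for l by (auto simp: PiE_def)
  have "compact (\<Pi>\<^sub>E u\<in>UNIV. K u)"
    using compactin_PiE[of "\<lambda>_. euclidean" UNIV K] fin finite_imp_compact
    unfolding euclidean_product_topology compactin_euclidean_iff by blast
  hence "seq_compact (\<Pi>\<^sub>E u\<in>UNIV. K u)" by (rule compact_imp_seq_compact)
  then obtain \<psi> h where h: "strict_mono (h :: nat \<Rightarrow> nat)" "(f \<circ> h) \<longlonglongrightarrow> \<psi>"
    using fK unfolding seq_compact_def by metis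
  have ev: "eventually (\<lambda>n. f (h n) u = \<psi> u) sequentially" for u
  proof -
    have "(\<lambda>n. (f \<circ> h) n u) \<longlonglongrightarrow> \<psi> u" 
      using continuous_on_tendsto_compose[OF continuous_on_product_then_coordinatewise[OF continuous_on_id] h(2),
          of UNIV u] by (simp add: comp_def)
    thus ?thesis by (simp add: tendsto_discrete comp_def)
  qed
  have large: "eventually (\<lambda>n. m \<le> h n) sequentially" for m
    using eventually_ge_at_top[of m] by eventually_elim (meson h(1) le_trans seq_suble)
  have ev\<phi>: "eventually (\<lambda>n. \<phi> (h n) u = \<psi> u) sequentially" if "u \<in> verts G" for u
    using ev[of u] large[of "k u"] by eventually_elim (use that in \<open>simp add: f_def\<close>)
  have inB: "eventually (\<lambda>n. u \<in> ball_verts G r (h n)) sequentially" if "u \<in> verts G" for u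
    using large[of "k u"] by eventually_elim (use that k ball_verts_mono in blast)
  have edge: "((u, v) \<in> edges G \<longleftrightarrow> (\<psi> u, \<psi> v) \<in> edges H) \<and> (\<psi> u = \<psi> v \<longrightarrow> u = v) \<and> \<psi> u \<in> verts H"
    if uv: "u \<in> verts G" "v \<in> verts G" for u v
  proof -
    have "eventually (\<lambda>n. \<phi> (h n) u = \<psi> u \<and> \<phi> (h n) v = \<psi> v \<and>
      u \<in> ball_verts G r (h n) \<and> v \<in> ball_verts G r (h n)) sequentially"
      using ev\<phi>[OF uv(1)] ev\<phi>[OF uv(2)] inB[OF uv(1)] inB[OF uv(2)] by eventually_elim auto
    then obtain n where n: "\<phi> (h n) u = \<psi> u" "\<phi> (h n) v = \<psi> v"
      "u \<in> ball_verts G r (h n)" "v \<in> ball_verts G r (h n)"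
      by (auto simp: eventually_sequentially)
    have "bij_betw (\<phi> (h n)) (ball_verts G r (h n)) (ball_verts H s (h n))"
      using iso[of "h n"] by (simp add: ball_isom_iff)
    hence "inj_on (\<phi> (h n)) (ball_verts G r (h n))" "\<phi> (h n) u \<in> ball_verts H s (h n)"
      using n(3) by (auto simp: bij_betw_apply bij_betw_imp_inj_on)
    thus ?thesis using iso[of "h n"] n ball_verts_subset[of H s "h n"]
      by (auto simp: ball_isom_iff inj_on_def)
  qed
  have "\<psi> r = s"
  proof -
    obtain n where "\<phi> (h n) r = \<psi> r" using ev\<phi>[OF G(2)] by (auto simp: eventually_sequentially)
    thus ?thesis using iso[of "h n"] by (auto simp: ball_isom_iff)
  qed
  have surj: "\<exists>u\<in>verts G. \<psi> u = y" if y: "y \<in> verts H" for y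
  proof -
    obtain m where m: "y \<in> ball_verts H s m" using ex_ball[OF H y] by blast
    \<comment> \<open>the preimages of \<open>y\<close> lie in a fixed finite ball, on which late isomorphisms agree with \<open>\<psi>\<close>\<close>
    have "eventually (\<lambda>n. \<forall>u\<in>ball_verts G r m. \<phi> (h n) u = \<psi> u) sequentially"
      using ball_verts_finite[OF G] ev\<phi> ball_verts_subset[of G r m]
      by (intro eventually_ball_finite) auto
    with large[of m] have "eventually (\<lambda>n. m \<le> h n \<and> (\<forall>u\<in>ball_verts G r m. \<phi> (h n) u = \<psi> u)) sequentially"
      by eventually_elim auto
    then obtain n where n: "m \<le> h n" "\<And>u. u \<in> ball_verts G r m \<Longrightarrow> \<phi> (h n) u = \<psi> u"
      by (auto simp: eventually_sequentially)
    have "ball_isom (\<phi> (h n)) G r H s m" using ball_isom_restrict[OF sG sH iso G(2) n(1)] .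
    hence "y \<in> \<phi> (h n) ` ball_verts G r m" using m by (auto simp: ball_isom_iff bij_betw_def)
    thus ?thesis using n(2) ball_verts_subset by fastforce
  qed
  have "bij_betw \<psi> (verts G) (verts H)"
    unfolding bij_betw_def inj_on_def using edge surj by fast
  moreover have "\<exists>l. \<psi> u = \<phi> l u" if "u \<in> verts G" for u
    using ev\<phi>[OF that] unfolding eventually_sequentially by (metis order_refl)
  ultimately show ?thesis using edge \<open>\<psi> r = s\<close> by (auto simp: graph_isom_def intro!: exI[of _ \<psi>])
qed

section \<open>Ultrametrics given by levels of resemblance\<close>

text \<open>
  \<open>E l x y\<close> says that \<open>x\<close> and \<open>y\<close> resemble each other at level \<open>l\<close>, for instance that the
  \<open>l\<close>-balls around their roots are isomorphic; the distance is \<open>2 ^ -l\<close> for the largest such level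
  \<open>l\<close>, or 1 if there is none and 0 if there are arbitrarily large ones.
\<close>

definition level_dist :: "(nat \<Rightarrow> 'a \<Rightarrow> 'a \<Rightarrow> bool) \<Rightarrow> 'a \<Rightarrow> 'a \<Rightarrow> real" where
  "level_dist E x y = Inf (insert 1 {(1/2) ^ l | l. E l x y})"

lemma level_dist_bdd: "bdd_below (insert (1::real) {(1/2) ^ l | l. E l x y})"
  by (rule bdd_belowI[of _ 0]) auto

lemma level_dist_le: "E l x y \<Longrightarrow> level_dist E x y \<le> (1/2) ^ l"
  unfolding level_dist_def by (intro cInf_lower level_dist_bdd) auto

lemma level_dist_nonneg: "0 \<le> level_dist E x y"
  unfolding level_dist_def by (intro cInf_greatest) auto

lemma level_dist_lessD:
  assumes "level_dist E x y < e" "e \<le> 1"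
  obtains l where "E l x y" "(1/2) ^ l < e"
proof -
  have "\<exists>z\<in>insert 1 {(1/2) ^ l | l. E l x y}. z < e"
    using assms(1) unfolding level_dist_def by (intro cInf_lessD) auto
  thus ?thesis using that assms(2) by auto
qed

text \<open>
  The relation need not be decreasing in the level, nor reflexive at low levels: for doubly rooted
  graphs a level only counts once the second root lies in the ball.  The weak form of transitivity
  \<open>E_trans\<close> still yields the ultrametric inequality.  Symmetry is required off the carrier, because
  \<^locale>\<open>Metric_space\<close> requires it of its distance function.
\<close>

locale level_space =
  fixes S :: "'a set" and E :: "nat \<Rightarrow> 'a \<Rightarrow> 'a \<Rightarrow> bool"
  assumes E_sym: "E l x y \<Longrightarrow> E l y x"
    and E_refl: "x \<in> S \<Longrightarrow> \<exists>L. \<forall>l\<ge>L. E l x x"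
    and E_trans: "x \<in> S \<Longrightarrow> y \<in> S \<Longrightarrow> z \<in> S \<Longrightarrow> E l x y \<Longrightarrow> E l' y z \<Longrightarrow> l \<le> l' \<Longrightarrow> E l x z"
    and E_sep: "x \<in> S \<Longrightarrow> y \<in> S \<Longrightarrow> (\<And>L. \<exists>l\<ge>L. E l x y) \<Longrightarrow> x = y"
begin

lemma level_dist_zeroD:
  assumes "x \<in> S" "y \<in> S" "level_dist E x y = 0"
  shows "x = y"
proof (rule E_sep[OF assms(1,2)])
  fix L
  obtain l where "E l x y" "(1/2::real) ^ l < (1/2) ^ L"
    using level_dist_lessD[of E x y "(1/2) ^ L"] assms(3) by (auto simp: power_le_one)
  thus "\<exists>l\<ge>L. E l x y" by (auto intro!: exI[of _ l])
qed

lemma level_dist_self: "x \<in> S \<Longrightarrow> level_dist E x x = 0"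
proof (rule ccontr)
  assume x: "x \<in> S" and "level_dist E x x \<noteq> 0"
  hence "0 < level_dist E x x" using level_dist_nonneg[of E x x] by simp
  then obtain n where n: "(1/2) ^ n < level_dist E x x"
    using real_arch_pow_inv[of "level_dist E x x" "1/2"] by auto
  obtain L where "\<And>l. L \<le> l \<Longrightarrow> E l x x" using E_refl[OF x] by blast
  hence "level_dist E x x \<le> (1/2) ^ max L n" by (intro level_dist_le) simp
  also have "\<dots> \<le> (1/2) ^ n" by (intro power_decreasing) auto
  finally show False using n by simp
qed

lemma level_dist_triangle:
  assumes "x \<in> S" "y \<in> S" "z \<in> S"
  shows "level_dist E x z \<le> level_dist E x y + level_dist E y z"
proof -
  have le1: "level_dist E x z \<le> 1"
    unfolding level_dist_def by (intro cInf_lower level_dist_bdd) auto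
  have "level_dist E x z \<le> max (level_dist E x y) (level_dist E y z)"
  proof (rule ccontr)
    assume "\<not> ?thesis"
    hence less: "level_dist E x y < level_dist E x z" "level_dist E y z < level_dist E x z" by auto
    obtain l where l: "E l x y" "(1/2) ^ l < level_dist E x z"
      using level_dist_lessD[OF less(1) le1] .
    obtain l' where l': "E l' y z" "(1/2) ^ l' < level_dist E x z"
      using level_dist_lessD[OF less(2) le1] .
    have "E (min l l') x z"
    proof (cases "l \<le> l'")
      case True
      thus ?thesis using E_trans[OF assms l(1) l'(1)] by (simp add: min_def)
    next
      case False
      thus ?thesis using E_trans[OF assms(3,2,1) E_sym[OF l'(1)] E_sym[OF l(1)]] E_sym
        by (simp add: min_def)
    qed
    from level_dist_le[where E=E, OF this] l(2) l'(2) show False by (auto simp: min_def split: if_splits)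
  qed
  thus ?thesis using level_dist_nonneg[of E x y] level_dist_nonneg[of E y z] by linarith
qed

sublocale Metric_space S "level_dist E"
proof
  fix x y
  show "0 \<le> level_dist E x y" by (rule level_dist_nonneg)
  have "E l x y \<longleftrightarrow> E l y x" for l using E_sym by blast
  thus "level_dist E x y = level_dist E y x" unfolding level_dist_def by simp
qed (use level_dist_zeroD level_dist_self level_dist_triangle in auto)

text \<open>
  Openness can be tested with the levels alone, without mentioning distances.
\<close>

lemma openin_level:
  "openin mtopology U \<longleftrightarrow> U \<subseteq> S \<and> (\<forall>x\<in>U. \<exists>L. \<forall>y\<in>S. \<forall>l\<ge>L. E l x y \<longrightarrow> y \<in> U)"
proof (intro iffI conjI ballI; (elim conjE)?)
  fix x assume U: "openin mtopology U" and x: "x \<in> U"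
  hence US: "U \<subseteq> S" using openin_mtopology by blast
  obtain r where r: "r > 0" "mball x r \<subseteq> U" using U x unfolding openin_mtopology by blast
  obtain L where L: "(1/2) ^ L < r" using real_arch_pow_inv[OF r(1), of "1/2"] by auto
  have "y \<in> U" if y: "y \<in> S" "L \<le> l" "E l x y" for y l
  proof -
    have "level_dist E x y \<le> (1/2) ^ l" by (rule level_dist_le[where E=E, OF y(3)])
    also have "\<dots> \<le> (1/2) ^ L" using y(2) by (intro power_decreasing) auto
    finally have "y \<in> mball x r" using L x US y(1) by auto
    thus ?thesis using r(2) by blast
  qed
  thus "\<exists>L. \<forall>y\<in>S. \<forall>l\<ge>L. E l x y \<longrightarrow> y \<in> U" by blast
next
  assume US: "U \<subseteq> S" and U: "\<forall>x\<in>U. \<exists>L. \<forall>y\<in>S. \<forall>l\<ge>L. E l x y \<longrightarrow> y \<in> U"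
  show "openin mtopology U"
    unfolding openin_mtopology
  proof (intro conjI US allI impI)
    fix x assume x: "x \<in> U"
    then obtain L where L: "\<And>y l. y \<in> S \<Longrightarrow> L \<le> l \<Longrightarrow> E l x y \<Longrightarrow> y \<in> U" using U by blast
    have "mball x ((1/2) ^ L) \<subseteq> U"
    proof
      fix y assume "y \<in> mball x ((1/2) ^ L)"
      hence y: "y \<in> S" "level_dist E x y < (1/2) ^ L" by auto
      obtain l where l: "E l x y" "(1/2::real) ^ l < (1/2) ^ L"
        using level_dist_lessD[OF y(2)] by (auto simp: power_le_one)
      thus "y \<in> U" using L[OF y(1) _ l(1)] by auto
    qed
    thus "\<exists>r>0. mball x r \<subseteq> U" by (intro exI[of _ "(1/2) ^ L"]) auto
  qed
qed (use openin_mtopology in blast)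

lemma space_metric_borel: "space (metric_borel S (level_dist E)) = S"
  unfolding metric_borel_def by (rule space_measure_of) (auto simp: openin_level)

lemma sets_metric_borel:
  "sets (metric_borel S (level_dist E)) = sigma_sets S {U. openin mtopology U}"
  unfolding metric_borel_def by (rule sets_measure_of) (auto simp: openin_level)

end

section \<open>Isomorphism classes\<close>

lemma mem_rclass_iff:
  "(H, s) \<in> rclass G r \<longleftrightarrow>
     simple_graph G \<and> simple_graph H \<and> r \<in> verts G \<and> (\<exists>\<phi>. graph_isom \<phi> G H \<and> \<phi> r = s)"
  by (auto simp: rclass_def rooted_equiv_def)

lemma mem_brclass_iff:
  "(H, s, w) \<in> brclass G r v \<longleftrightarrow> simple_graph G \<and> simple_graph H \<and> r \<in> verts G \<and> v \<in> verts G \<and>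
     (\<exists>\<phi>. graph_isom \<phi> G H \<and> \<phi> r = s \<and> \<phi> v = w)"
  by (auto simp: brclass_def birooted_equiv_def)

lemma graph_isom_id: "graph_isom id G G"
  by (auto simp: graph_isom_def)

lemma graph_isom_verts: "graph_isom \<phi> G H \<Longrightarrow> v \<in> verts G \<Longrightarrow> \<phi> v \<in> verts H"
  by (auto simp: graph_isom_def bij_betw_apply)

lemma graph_isom_inv_left:
  "graph_isom \<phi> G H \<Longrightarrow> v \<in> verts G \<Longrightarrow> inv_into (verts G) \<phi> (\<phi> v) = v"
  by (auto simp: graph_isom_def bij_betw_def)

lemma rclass_isom:
  assumes "simple_graph G" "simple_graph H" "graph_isom \<phi> G H" "r \<in> verts G"
  shows "rclass H (\<phi> r) = rclass G r"
proof (intro equalityI subsetI; clarify)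
  fix K t
  let ?\<psi> = "inv_into (verts G) \<phi>"
  { assume "(K, t) \<in> rclass H (\<phi> r)"
    then obtain \<theta> where "graph_isom \<theta> H K" "\<theta> (\<phi> r) = t" "simple_graph K" by (auto simp: mem_rclass_iff)
    thus "(K, t) \<in> rclass G r"
      using assms graph_isom_compose[OF assms(3), of \<theta> K]
      by (auto simp: mem_rclass_iff intro!: exI[of _ "\<theta> \<circ> \<phi>"]) }
  { assume "(K, t) \<in> rclass G r"
    then obtain \<theta> where "graph_isom \<theta> G K" "\<theta> r = t" "simple_graph K" by (auto simp: mem_rclass_iff)
    thus "(K, t) \<in> rclass H (\<phi> r)"
      using assms graph_isom_compose[OF graph_isom_inv[OF assms(3)], of \<theta> K] graph_isom_verts[OF assms(3,4)]
        graph_isom_inv_left[OF assms(3,4)]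
      by (auto simp: mem_rclass_iff intro!: exI[of _ "\<theta> \<circ> ?\<psi>"]) }
qed

lemma brclass_isom:
  assumes "simple_graph G" "simple_graph H" "graph_isom \<phi> G H" "r \<in> verts G" "v \<in> verts G"
  shows "brclass H (\<phi> r) (\<phi> v) = brclass G r v"
proof (intro equalityI subsetI; clarify)
  fix K t u
  let ?\<psi> = "inv_into (verts G) \<phi>"
  { assume "(K, t, u) \<in> brclass H (\<phi> r) (\<phi> v)"
    then obtain \<theta> where "graph_isom \<theta> H K" "\<theta> (\<phi> r) = t" "\<theta> (\<phi> v) = u" "simple_graph K"
      by (auto simp: mem_brclass_iff)
    thus "(K, t, u) \<in> brclass G r v"
      using assms graph_isom_compose[OF assms(3), of \<theta> K]
      by (auto simp: mem_brclass_iff intro!: exI[of _ "\<theta> \<circ> \<phi>"]) }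
  { assume "(K, t, u) \<in> brclass G r v"
    then obtain \<theta> where "graph_isom \<theta> G K" "\<theta> r = t" "\<theta> v = u" "simple_graph K"
      by (auto simp: mem_brclass_iff)
    thus "(K, t, u) \<in> brclass H (\<phi> r) (\<phi> v)"
      using assms graph_isom_compose[OF graph_isom_inv[OF assms(3)], of \<theta> K]
        graph_isom_verts[OF assms(3,4)] graph_isom_verts[OF assms(3,5)]
        graph_isom_inv_left[OF assms(3,4)] graph_isom_inv_left[OF assms(3,5)]
      by (auto simp: mem_brclass_iff intro!: exI[of _ "\<theta> \<circ> ?\<psi>"]) }
qed

lemma rclass_self: "simple_graph G \<Longrightarrow> r \<in> verts G \<Longrightarrow> (G, r) \<in> rclass G r"
  using graph_isom_id[of G] by (auto simp: mem_rclass_iff intro!: exI[of _ id])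

lemma brclass_self:
  "simple_graph G \<Longrightarrow> r \<in> verts G \<Longrightarrow> v \<in> verts G \<Longrightarrow> (G, r, v) \<in> brclass G r v"
  using graph_isom_id[of G] by (auto simp: mem_brclass_iff intro!: exI[of _ id])

lemma Mspace_iff:
  "x \<in> Mspace d \<longleftrightarrow> (\<exists>G r. good_graph d G \<and> r \<in> verts G \<and> x = rclass G r)"
  by (auto simp: Mspace_def good_graph_def)

lemma BMspace_iff:
  "x \<in> BMspace d \<longleftrightarrow> (\<exists>G r v. good_graph d G \<and> r \<in> verts G \<and> v \<in> verts G \<and> x = brclass G r v)"
  unfolding BMspace_def good_graph_def by blast

lemma Mspace_memD:
  assumes "x \<in> Mspace d" "(H, s) \<in> x"
  shows "good_graph d H" "s \<in> verts H" "x = rclass H s"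
proof -
  obtain G r where G: "good_graph d G" "r \<in> verts G" "x = rclass G r"
    using assms by (auto simp: Mspace_iff)
  obtain \<phi> where \<phi>: "graph_isom \<phi> G H" "\<phi> r = s" "simple_graph H"
    using assms(2) G by (auto simp: mem_rclass_iff)
  show "good_graph d H" using graph_isom_good[OF G(1) \<phi>(3,1)] .
  show "s \<in> verts H" using graph_isom_verts[OF \<phi>(1) G(2)] \<phi> by simp
  show "x = rclass H s" using rclass_isom[OF good_graphD(1)[OF G(1)] \<phi>(3,1) G(2)] \<phi> G by simp
qed

lemma rep_in: "x \<in> Mspace d \<Longrightarrow> (rep_graph x, rep_root x) \<in> x"
proof -
  assume "x \<in> Mspace d"
  then obtain R where "R \<in> x" using rclass_self good_graphD(1) by (fastforce simp: Mspace_iff)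
  hence "rep x \<in> x" unfolding rep_def by (rule someI)
  thus ?thesis by (simp add: rep_graph_def rep_root_def)
qed

lemma
  assumes "x \<in> Mspace d"
  shows rep_good: "good_graph d (rep_graph x)"
    and rep_root_verts: "rep_root x \<in> verts (rep_graph x)"
    and rclass_rep: "rclass (rep_graph x) (rep_root x) = x"
  using Mspace_memD[OF assms rep_in[OF assms]] by simp_all

section \<open>The local metrics\<close>

text \<open>
  The levels of resemblance that define the two metrics of the problem.
\<close>

definition Mrel :: "nat \<Rightarrow> rgraph set \<Rightarrow> rgraph set \<Rightarrow> bool" where
  "Mrel l x y \<longleftrightarrow> (\<exists>G r H s. (G, r) \<in> x \<and> (H, s) \<in> y \<and>
     rooted_isom (graph_ball G r l, r) (graph_ball H s l, s))"

definition BMrel :: "nat \<Rightarrow> brgraph set \<Rightarrow> brgraph set \<Rightarrow> bool" where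
  "BMrel l x y \<longleftrightarrow> (\<exists>G r v H s w. (G, r, v) \<in> x \<and> (H, s, w) \<in> y \<and>
     birooted_isom (graph_ball G r l, r, v) (graph_ball H s l, s, w))"

lemma Mdist_level: "Mdist = level_dist Mrel"
  by (simp add: fun_eq_iff Mdist_def level_dist_def Mrel_def)

lemma BMdist_level: "BMdist = level_dist BMrel"
  by (simp add: fun_eq_iff BMdist_def level_dist_def BMrel_def)

lemma rooted_isom_ball_iff:
  "rooted_isom (graph_ball G r l, r) (graph_ball H s l, s) \<longleftrightarrow>
     r \<in> verts G \<and> (\<exists>\<phi>. ball_isom \<phi> G r H s l)"
  by (auto simp: ball_isom_def) (auto simp: graph_ball_def)

lemma birooted_isom_ball_iff:
  "birooted_isom (graph_ball G r l, r, v) (graph_ball H s l, s, w) \<longleftrightarrow>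
     r \<in> verts G \<and> v \<in> ball_verts G r l \<and> (\<exists>\<phi>. ball_isom \<phi> G r H s l \<and> \<phi> v = w)"
  by (auto simp: ball_isom_def) (auto simp: graph_ball_def)

lemma ball_isom_root:
  assumes "ball_isom \<phi> G r H s l" "r \<in> verts G" shows "s \<in> verts H"
proof -
  have bij: "bij_betw \<phi> (ball_verts G r l) (ball_verts H s l)" and s: "\<phi> r = s"
    using assms by (auto simp: ball_isom_iff)
  have "r \<in> ball_verts G r l" using assms(2) by simp
  from bij_betw_apply[OF bij this] show ?thesis unfolding s by simp
qed

lemma Mrel_sym: "Mrel l x y \<Longrightarrow> Mrel l y x"
  unfolding Mrel_def rooted_isom_ball_iff using ball_isom_inv ball_isom_root by blast

lemma BMrel_sym:
  assumes "BMrel l x y" shows "BMrel l y x"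
proof -
  obtain G r v H s w \<phi> where *: "(G, r, v) \<in> x" "(H, s, w) \<in> y" "r \<in> verts G" "v \<in> ball_verts G r l"
    and \<phi>: "ball_isom \<phi> G r H s l" "\<phi> v = w"
    using assms unfolding BMrel_def birooted_isom_ball_iff by blast
  have bij: "bij_betw \<phi> (ball_verts G r l) (ball_verts H s l)" using \<phi> by (auto simp: ball_isom_iff)
  have "w \<in> ball_verts H s l" "inv_into (ball_verts G r l) \<phi> w = v"
    using bij_betw_apply[OF bij *(4)] bij_betw_inv_into_left[OF bij *(4)] \<phi>(2) by auto
  thus ?thesis
    unfolding BMrel_def birooted_isom_ball_iff
    using * ball_isom_inv[OF \<phi>(1) *(3)] ball_isom_root[OF \<phi>(1) *(3)] by blast
qed

text \<open>
  Resemblance of two classes can be tested on any representatives.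
\<close>

lemma Mrel_rclass_iff:
  assumes "simple_graph G" "r \<in> verts G" "simple_graph H" "s \<in> verts H"
  shows "Mrel l (rclass G r) (rclass H s) \<longleftrightarrow> (\<exists>\<phi>. ball_isom \<phi> G r H s l)"
proof
  assume "Mrel l (rclass G r) (rclass H s)"
  then obtain G' r' H' s' \<phi> where *: "(G', r') \<in> rclass G r" "(H', s') \<in> rclass H s" "r' \<in> verts G'"
    "ball_isom \<phi> G' r' H' s' l"
    unfolding Mrel_def rooted_isom_ball_iff by blast
  obtain \<alpha> where \<alpha>: "graph_isom \<alpha> G G'" "\<alpha> r = r'" "simple_graph G'" using *(1) by (auto simp: mem_rclass_iff)
  obtain \<beta> where \<beta>: "graph_isom \<beta> H H'" "\<beta> s = s'" "simple_graph H'" using *(2) by (auto simp: mem_rclass_iff)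
  have "ball_isom \<alpha> G r G' r' l" using graph_isom_ball_isom[OF assms(1) \<alpha>(3,1) assms(2)] \<alpha>(2) by simp
  moreover have "ball_isom (inv_into (ball_verts H s l) \<beta>) H' s' H s l"
    using ball_isom_inv[OF _ assms(4)] graph_isom_ball_isom[OF assms(3) \<beta>(3,1) assms(4)] \<beta>(2) by metis
  ultimately show "\<exists>\<phi>. ball_isom \<phi> G r H s l" using *(4) ball_isom_compose by blast
next
  assume "\<exists>\<phi>. ball_isom \<phi> G r H s l"
  thus "Mrel l (rclass G r) (rclass H s)"
    using assms rclass_self unfolding Mrel_def rooted_isom_ball_iff by blast
qed

lemma BMrel_brclass_iff:
  assumes "simple_graph G" "r \<in> verts G" "v \<in> verts G" "simple_graph H" "s \<in> verts H" "w \<in> verts H"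
  shows "BMrel l (brclass G r v) (brclass H s w) \<longleftrightarrow>
    v \<in> ball_verts G r l \<and> (\<exists>\<phi>. ball_isom \<phi> G r H s l \<and> \<phi> v = w)"
proof
  assume "BMrel l (brclass G r v) (brclass H s w)"
  then obtain G' r' v' H' s' w' \<phi> where *: "(G', r', v') \<in> brclass G r v" "(H', s', w') \<in> brclass H s w"
    "r' \<in> verts G'" "v' \<in> ball_verts G' r' l" and \<phi>: "ball_isom \<phi> G' r' H' s' l" "\<phi> v' = w'"
    unfolding BMrel_def birooted_isom_ball_iff by blast
  obtain \<alpha> where \<alpha>: "graph_isom \<alpha> G G'" "\<alpha> r = r'" "\<alpha> v = v'" "simple_graph G'"
    using *(1) by (auto simp: mem_brclass_iff)
  obtain \<beta> where \<beta>: "graph_isom \<beta> H H'" "\<beta> s = s'" "\<beta> w = w'" "simple_graph H'"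
    using *(2) by (auto simp: mem_brclass_iff)
  have a: "ball_isom \<alpha> G r G' r' l" using graph_isom_ball_isom[OF assms(1) \<alpha>(4,1) assms(2)] \<alpha>(2) by simp
  have b0: "ball_isom \<beta> H s H' s' l" using graph_isom_ball_isom[OF assms(4) \<beta>(4,1) assms(5)] \<beta>(2) by simp
  let ?\<beta> = "inv_into (ball_verts H s l) \<beta>" and ?\<alpha> = "inv_into (ball_verts G r l) \<alpha>"
  have b: "ball_isom ?\<beta> H' s' H s l" using ball_isom_inv[OF b0 assms(5)] .
  have ai: "ball_isom ?\<alpha> G' r' G r l" using ball_isom_inv[OF a assms(2)] .
  have v: "v \<in> ball_verts G r l"
  proof -
    have "inv_into (verts G) \<alpha> v' \<in> ball_verts G r l"
      using graph_isom_ball_isom[OF \<alpha>(4) assms(1) graph_isom_inv[OF \<alpha>(1)] *(3), of l]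
        graph_isom_inv_left[OF \<alpha>(1) assms(2)] \<alpha>(2) *(4) by (auto simp: ball_isom_iff bij_betw_apply)
    thus ?thesis using graph_isom_inv_left[OF \<alpha>(1) assms(3)] \<alpha>(3) by simp
  qed
  have "w \<in> ball_verts H s l"
  proof -
    have "w' \<in> ball_verts H' s' l" using \<phi> *(4) by (auto simp: ball_isom_iff bij_betw_apply)
    moreover have "s' \<in> verts H'" using graph_isom_verts[OF \<beta>(1) assms(5)] \<beta>(2) by simp
    ultimately have "inv_into (verts H) \<beta> w' \<in> ball_verts H s l"
      using graph_isom_ball_isom[OF \<beta>(4) assms(4) graph_isom_inv[OF \<beta>(1)], of s' l]
        graph_isom_inv_left[OF \<beta>(1) assms(5)] \<beta>(2) by (auto simp: ball_isom_iff bij_betw_apply)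
    thus ?thesis using graph_isom_inv_left[OF \<beta>(1) assms(6)] \<beta>(3) by simp
  qed
  hence "?\<beta> w' = w" using b0 bij_betw_inv_into_left[of \<beta> "ball_verts H s l"] \<beta>(3)
    by (auto simp: ball_isom_iff)
  moreover have "ball_isom (?\<beta> \<circ> (\<phi> \<circ> \<alpha>)) G r H s l"
    using ball_isom_compose[OF ball_isom_compose[OF a \<phi>(1)] b] .
  ultimately show "v \<in> ball_verts G r l \<and> (\<exists>\<phi>. ball_isom \<phi> G r H s l \<and> \<phi> v = w)"
    using v \<phi>(2) \<alpha>(3) by (auto intro!: exI[of _ "?\<beta> \<circ> (\<phi> \<circ> \<alpha>)"])
next
  assume "v \<in> ball_verts G r l \<and> (\<exists>\<phi>. ball_isom \<phi> G r H s l \<and> \<phi> v = w)"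
  thus "BMrel l (brclass G r v) (brclass H s w)"
    using assms brclass_self unfolding BMrel_def birooted_isom_ball_iff by blast
qed

lemma ball_isom_id: "ball_isom id G r G r l"
  by (auto simp: ball_isom_iff)

lemma level_space_M: "level_space (Mspace d) Mrel"
proof
  fix x y l assume "Mrel l x y" thus "Mrel l y x" by (rule Mrel_sym)
next
  fix x assume "x \<in> Mspace d"
  then obtain G r where "good_graph d G" "r \<in> verts G" "x = rclass G r" by (auto simp: Mspace_iff)
  thus "\<exists>L. \<forall>l\<ge>L. Mrel l x x" using Mrel_rclass_iff[of G r G r] good_graphD(1) ball_isom_id by blast
next
  fix x y z l l' assume xyz: "x \<in> Mspace d" "y \<in> Mspace d" "z \<in> Mspace d" "Mrel l x y" "Mrel l' y z" "l \<le> l'"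
  obtain G r where G: "simple_graph G" "r \<in> verts G" "x = rclass G r" using xyz(1) good_graphD(1) by (auto simp: Mspace_iff)
  obtain H s where H: "simple_graph H" "s \<in> verts H" "y = rclass H s" using xyz(2) good_graphD(1) by (auto simp: Mspace_iff)
  obtain K t where K: "simple_graph K" "t \<in> verts K" "z = rclass K t" using xyz(3) good_graphD(1) by (auto simp: Mspace_iff)
  obtain \<phi> where \<phi>: "ball_isom \<phi> G r H s l" using xyz(4) G H Mrel_rclass_iff by auto
  obtain \<psi> where \<psi>: "ball_isom \<psi> H s K t l'" using xyz(5) K H Mrel_rclass_iff by auto
  have "ball_isom \<psi> H s K t l" using ball_isom_restrict[OF H(1) K(1) \<psi> H(2) xyz(6)] .
  thus "Mrel l x z" using ball_isom_compose[OF \<phi>] G K Mrel_rclass_iff by auto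
next
  fix x y assume xy: "x \<in> Mspace d" "y \<in> Mspace d" "\<And>L. \<exists>l\<ge>L. Mrel l x y"
  obtain G r where G: "good_graph d G" "r \<in> verts G" "x = rclass G r" using xy(1) by (auto simp: Mspace_iff)
  obtain H s where H: "good_graph d H" "s \<in> verts H" "y = rclass H s" using xy(2) by (auto simp: Mspace_iff)
  note sG = good_graphD(1)[OF G(1)] and sH = good_graphD(1)[OF H(1)]
  have "\<exists>\<phi>. ball_isom \<phi> G r H s L" for L
    using xy(3)[of L] G H Mrel_rclass_iff[OF sG G(2) sH H(2)] ball_isom_restrict[OF sG sH _ G(2)] by blast
  then obtain \<phi> where "\<And>L. ball_isom (\<phi> L) G r H s L" by metis
  from ball_isoms_converge[OF G(1,2) H(1,2) this] obtain \<psi> where "graph_isom \<psi> G H" "\<psi> r = s" by blast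
  thus "x = y" using rclass_isom[OF sG sH _ G(2)] G H by metis
qed

lemma level_space_BM: "level_space (BMspace d) BMrel"
proof
  fix x y l assume "BMrel l x y" thus "BMrel l y x" by (rule BMrel_sym)
next
  fix x assume "x \<in> BMspace d"
  then obtain G r v where G: "good_graph d G" "r \<in> verts G" "v \<in> verts G" "x = brclass G r v"
    by (auto simp: BMspace_iff)
  obtain k where k: "v \<in> ball_verts G r k" using ex_ball[OF G(1-3)] by blast
  have "BMrel l x x" if "k \<le> l" for l
    using ball_verts_mono[OF that, of G r] k G ball_isom_id[of G r l] good_graphD(1)[OF G(1)]
    by (auto simp: BMrel_brclass_iff intro!: exI[of _ id])
  thus "\<exists>L. \<forall>l\<ge>L. BMrel l x x" by blast
next
  fix x y z l l'
  assume xyz: "x \<in> BMspace d" "y \<in> BMspace d" "z \<in> BMspace d" "BMrel l x y" "BMrel l' y z" "l \<le> l'"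
  obtain G r v where G: "good_graph d G" "r \<in> verts G" "v \<in> verts G" "x = brclass G r v"
    using xyz(1) by (auto simp: BMspace_iff)
  obtain H s w where H: "good_graph d H" "s \<in> verts H" "w \<in> verts H" "y = brclass H s w"
    using xyz(2) by (auto simp: BMspace_iff)
  obtain K t u where K: "good_graph d K" "t \<in> verts K" "u \<in> verts K" "z = brclass K t u"
    using xyz(3) by (auto simp: BMspace_iff)
  note sG = good_graphD(1)[OF G(1)] and sH = good_graphD(1)[OF H(1)] and sK = good_graphD(1)[OF K(1)]
  obtain \<phi> where \<phi>: "v \<in> ball_verts G r l" "ball_isom \<phi> G r H s l" "\<phi> v = w"
    using xyz(4) G H BMrel_brclass_iff[OF sG G(2,3) sH H(2,3)] by auto
  obtain \<psi> where \<psi>: "ball_isom \<psi> H s K t l'" "\<psi> w = u"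
    using xyz(5) H K BMrel_brclass_iff[OF sH H(2,3) sK K(2,3)] by auto
  have "ball_isom \<psi> H s K t l" using ball_isom_restrict[OF sH sK \<psi>(1) H(2) xyz(6)] .
  from ball_isom_compose[OF \<phi>(2) this] show "BMrel l x z"
    using \<phi> \<psi>(2) G K BMrel_brclass_iff[OF sG G(2,3) sK K(2,3)] by (auto intro!: exI[of _ "\<psi> \<circ> \<phi>"])
next
  fix x y assume xy: "x \<in> BMspace d" "y \<in> BMspace d" "\<And>L. \<exists>l\<ge>L. BMrel l x y"
  obtain G r v where G: "good_graph d G" "r \<in> verts G" "v \<in> verts G" "x = brclass G r v"
    using xy(1) by (auto simp: BMspace_iff)
  obtain H s w where H: "good_graph d H" "s \<in> verts H" "w \<in> verts H" "y = brclass H s w"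
    using xy(2) by (auto simp: BMspace_iff)
  note sG = good_graphD(1)[OF G(1)] and sH = good_graphD(1)[OF H(1)]
  have "\<exists>\<phi>. ball_isom \<phi> G r H s L \<and> \<phi> v = w" for L
    using xy(3)[of L] G H BMrel_brclass_iff[OF sG G(2,3) sH H(2,3)] ball_isom_restrict[OF sG sH _ G(2)]
    by blast
  then obtain \<phi> where \<phi>: "\<And>L. ball_isom (\<phi> L) G r H s L" "\<And>L. \<phi> L v = w" by metis
  from ball_isoms_converge[OF G(1,2) H(1,2) \<phi>(1)] obtain \<psi>
    where "graph_isom \<psi> G H" "\<psi> r = s" "\<forall>u\<in>verts G. \<exists>l. \<psi> u = \<phi> l u" by blast
  hence "graph_isom \<psi> G H" "\<psi> r = s" "\<psi> v = w" using \<phi>(2) G(3) by auto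
  thus "x = y" using brclass_isom[OF sG sH _ G(2,3)] G H by metis
qed

interpretation M: level_space "Mspace d" Mrel for d by (rule level_space_M)
interpretation BM: level_space "BMspace d" BMrel for d by (rule level_space_BM)

abbreviation open_M :: "nat \<Rightarrow> rgraph set set \<Rightarrow> bool" where
  "open_M d \<equiv> openin (Metric_space.mtopology (Mspace d) (level_dist Mrel))"

abbreviation open_BM :: "nat \<Rightarrow> brgraph set set \<Rightarrow> bool" where
  "open_BM d \<equiv> openin (Metric_space.mtopology (BMspace d) (level_dist BMrel))"

lemma space_Mborel [simp]: "space (Mborel d) = Mspace d"
  using M.space_metric_borel by (simp add: Mborel_def Mdist_level)

lemma space_BMborel [simp]: "space (BMborel d) = BMspace d"
  using BM.space_metric_borel by (simp add: BMborel_def BMdist_level)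

lemma sets_Mborel: "sets (Mborel d) = sigma_sets (Mspace d) {U. open_M d U}"
  using M.sets_metric_borel by (simp add: Mborel_def Mdist_level)

lemma sets_BMborel: "sets (BMborel d) = sigma_sets (BMspace d) {U. open_BM d U}"
  using BM.sets_metric_borel by (simp add: BMborel_def BMdist_level)

section \<open>The adjacency operator\<close>

text \<open>
  Polymorphic version of the adjacency operator: it is needed for real and complex functions, and
  for extended nonnegative ones, where the mass transport principle lives.
\<close>

definition adj :: "(rgraph set \<Rightarrow> 'a) \<Rightarrow> rgraph set \<Rightarrow> 'a::comm_monoid_add" where
  "adj f x = (\<Sum>w\<in>neighbours (rep_graph x) (rep_root x). f (rclass (rep_graph x) w))"

lemma adjacency_op_eq_adj: "adjacency_op = adj"
  by (simp add: fun_eq_iff adjacency_op_def adj_def)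

lemma bij_betw_neighbours:
  assumes "simple_graph G" "simple_graph H" "graph_isom \<phi> G H" "r \<in> verts G"
  shows "bij_betw \<phi> (neighbours G r) (neighbours H (\<phi> r))"
proof -
  have bij: "bij_betw \<phi> (verts G) (verts H)" using assms by (simp add: graph_isom_def)
  have "\<phi> ` neighbours G r = neighbours H (\<phi> r)"
  proof (intro equalityI subsetI)
    fix w assume "w \<in> \<phi> ` neighbours G r"
    thus "w \<in> neighbours H (\<phi> r)"
      using assms neighbours_subset[OF assms(1), of r] by (auto simp: neighbours_def graph_isom_def)
  next
    fix w assume w: "w \<in> neighbours H (\<phi> r)"
    hence "w \<in> verts H" using neighbours_subset[OF assms(2)] by auto
    then obtain v where "v \<in> verts G" "w = \<phi> v" using bij by (auto simp: bij_betw_def)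
    thus "w \<in> \<phi> ` neighbours G r" using w assms by (auto simp: neighbours_def graph_isom_def)
  qed
  thus ?thesis using bij neighbours_subset[OF assms(1), of r]
    unfolding bij_betw_def by (blast intro: inj_on_subset)
qed

text \<open>
  The value does not depend on the representative chosen in the definition.
\<close>

lemma adj_rclass:
  assumes "good_graph d G" "r \<in> verts G"
  shows "adj f (rclass G r) = (\<Sum>w\<in>neighbours G r. f (rclass G w))"
proof -
  note sG = good_graphD(1)[OF assms(1)]
  let ?x = "rclass G r"
  have x: "?x \<in> Mspace d" using assms by (auto simp: Mspace_iff)
  obtain \<phi> where \<phi>: "graph_isom \<phi> G (rep_graph ?x)" "\<phi> r = rep_root ?x" "simple_graph (rep_graph ?x)"
    using rep_in[OF x] by (auto simp: mem_rclass_iff)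
  have "adj f ?x = (\<Sum>w\<in>neighbours G r. f (rclass (rep_graph ?x) (\<phi> w)))"
    unfolding adj_def \<phi>(2)[symmetric]
    by (rule sum.reindex_bij_betw[symmetric, OF bij_betw_neighbours[OF sG \<phi>(3,1) assms(2)]])
  also have "\<dots> = (\<Sum>w\<in>neighbours G r. f (rclass G w))"
    using rclass_isom[OF sG \<phi>(3,1)] neighbours_subset[OF sG, of r] by (intro sum.cong) auto
  finally show ?thesis .
qed

lemma neighbour_in_Mspace:
  "good_graph d G \<Longrightarrow> w \<in> neighbours G r \<Longrightarrow> rclass G w \<in> Mspace d"
  using neighbours_subset[of G r] good_graphD(1) by (auto simp: Mspace_iff)

lemma rep_neighbour_in_Mspace:
  "x \<in> Mspace d \<Longrightarrow> w \<in> neighbours (rep_graph x) (rep_root x) \<Longrightarrow> rclass (rep_graph x) w \<in> Mspace d"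
  by (rule neighbour_in_Mspace[OF rep_good])

lemma finite_rep_neighbours: "x \<in> Mspace d \<Longrightarrow> finite (neighbours (rep_graph x) (rep_root x))"
  by (rule finite_neighbours[OF rep_good rep_root_verts])

lemma card_rep_neighbours: "x \<in> Mspace d \<Longrightarrow> card (neighbours (rep_graph x) (rep_root x)) \<le> d"
  using rep_good[of x d] rep_root_verts[of x d] by (auto simp: good_graph_def degree_le_def)

lemma adj_cong:
  assumes "x \<in> Mspace d" "\<And>y. y \<in> Mspace d \<Longrightarrow> f y = g y"
  shows "adj f x = adj g x"
  unfolding adj_def using rep_neighbour_in_Mspace[OF assms(1)] assms(2) by (intro sum.cong) auto

lemma adj_add: "adj (\<lambda>x. f x + g x) x = adj f x + adj g x"
  by (simp add: adj_def sum.distrib)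

lemma adj_diff: "adj (\<lambda>x. f x - g x :: 'a::ab_group_add) x = adj f x - adj g x"
  by (simp add: adj_def sum_subtractf)

lemma adj_cmult: "adj (\<lambda>x. c * f x) x = c * (adj f x :: 'a::semiring_0)"
  by (simp add: adj_def sum_distrib_left)

lemma adj_ennreal:
  assumes "x \<in> Mspace d" "\<And>y. y \<in> Mspace d \<Longrightarrow> 0 \<le> f y"
  shows "adj (\<lambda>y. ennreal (f y)) x = ennreal (adj f x)"
  unfolding adj_def using rep_neighbour_in_Mspace[OF assms(1)] assms(2) by (intro sum_ennreal) auto

lemma adj_mono:
  fixes f g :: "rgraph set \<Rightarrow> 'a::ordered_comm_monoid_add"
  assumes "x \<in> Mspace d" "\<And>y. y \<in> Mspace d \<Longrightarrow> f y \<le> g y"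
  shows "adj f x \<le> adj g x"
  unfolding adj_def using rep_neighbour_in_Mspace[OF assms(1)] assms(2) by (intro sum_mono) auto

lemma adj_nonneg:
  fixes f :: "rgraph set \<Rightarrow> 'a::ordered_comm_monoid_add"
  assumes "x \<in> Mspace d" "\<And>y. y \<in> Mspace d \<Longrightarrow> 0 \<le> f y"
  shows "0 \<le> adj f x"
  unfolding adj_def using rep_neighbour_in_Mspace[OF assms(1)] assms(2) by (intro sum_nonneg) auto

subsection \<open>Measurability\<close>

lemma adj_indicator:
  assumes "x \<in> Mspace d"
  shows "adj (indicator S) x =
    real (card {w \<in> neighbours (rep_graph x) (rep_root x). rclass (rep_graph x) w \<in> S})"
  unfolding adj_def using finite_rep_neighbours[OF assms]
  by (simp add: indicator_def sum.If_cases Int_def conj_commute)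

text \<open>
  If the root has at least \<open>k\<close> neighbours with class in an open set, then so has the root of every
  nearby graph: the number of such neighbours is lower semicontinuous.
\<close>

lemma open_card_neighbours:
  assumes S: "open_M d S"
  shows "open_M d {x \<in> Mspace d.
    k \<le> card {w \<in> neighbours (rep_graph x) (rep_root x). rclass (rep_graph x) w \<in> S}}"
  (is "open_M d {x \<in> _. k \<le> card (?N x)}")
  unfolding M.openin_level
proof (intro conjI ballI)
  fix x assume "x \<in> {x \<in> Mspace d. k \<le> card (?N x)}"
  hence x: "x \<in> Mspace d" "k \<le> card (?N x)" by auto
  let ?G = "rep_graph x" and ?r = "rep_root x"
  note G = rep_good[OF x(1)] and r = rep_root_verts[OF x(1)]
  note sG = good_graphD(1)[OF G]
  have finN: "finite (?N x)" using finite_rep_neighbours[OF x(1)] by simp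
  have "\<forall>w\<in>?N x. \<exists>L. \<forall>y\<in>Mspace d. \<forall>l\<ge>L. Mrel l (rclass ?G w) y \<longrightarrow> y \<in> S"
    using S unfolding M.openin_level by blast
  from bchoice[OF this] obtain L where L: "\<And>w y l. w \<in> ?N x \<Longrightarrow> y \<in> Mspace d \<Longrightarrow> L w \<le> l \<Longrightarrow>
      Mrel l (rclass ?G w) y \<Longrightarrow> y \<in> S" by blast
  \<comment> \<open>one more than the levels needed, as balls around neighbours have radius smaller by 1\<close>
  define K where "K = Suc (Max (insert 0 (L ` ?N x)))"
  have LK: "Suc (L w) \<le> K" if "w \<in> ?N x" for w
  proof -
    have "L w \<le> Max (insert 0 (L ` ?N x))" using that finN by (intro Max_ge) auto
    thus ?thesis by (simp add: K_def)
  qed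
  have "y \<in> {x \<in> Mspace d. k \<le> card (?N x)}" if y: "y \<in> Mspace d" "K \<le> l" "Mrel l x y" for y l
  proof -
    let ?H = "rep_graph y" and ?s = "rep_root y"
    note H = rep_good[OF y(1)] and s = rep_root_verts[OF y(1)]
    note sH = good_graphD(1)[OF H]
    obtain \<phi> where \<phi>: "ball_isom \<phi> ?G ?r ?H ?s l"
      using y(3) Mrel_rclass_iff[OF sG r sH s] unfolding rclass_rep[OF x(1)] rclass_rep[OF y(1)] by auto
    have K1: "1 \<le> l" using y(2) by (simp add: K_def)
    have inb: "w \<in> ball_verts ?G ?r 1" if "w \<in> neighbours ?G ?r" for w
      using that neighbours_subset[OF sG] by (auto simp: ball_verts_def neighbours_def intro!: exI[of _ 1])
    have "\<phi> ` ?N x \<subseteq> ?N y"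
    proof
      fix v assume "v \<in> \<phi> ` ?N x"
      then obtain w where w: "w \<in> ?N x" "v = \<phi> w" by auto
      have wl: "w \<in> ball_verts ?G ?r l" using inb w(1) ball_verts_mono[OF K1] by blast
      have edge: "v \<in> neighbours ?H ?s"
        using w wl \<phi> r by (auto simp: ball_isom_iff neighbours_def)
      have "ball_isom \<phi> ?G w ?H v (l - 1)"
        using ball_isom_recentre[OF sG sH \<phi> r, of w 1 "l - 1"] inb w K1 by auto
      moreover have "w \<in> verts ?G" "v \<in> verts ?H"
        using w(1) edge neighbours_subset[OF sG] neighbours_subset[OF sH] by auto
      ultimately have "Mrel (l - 1) (rclass ?G w) (rclass ?H v)"
        using Mrel_rclass_iff[OF sG _ sH] by auto
      moreover have "L w \<le> l - 1" using LK[OF w(1)] y(2) by simp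
      ultimately show "v \<in> ?N y"
        using L[OF w(1) neighbour_in_Mspace[OF H edge]] edge by auto
    qed
    moreover have inj: "inj_on \<phi> (?N x)"
    proof -
      have "?N x \<subseteq> ball_verts ?G ?r l" using inb ball_verts_mono[OF K1] by blast
      thus ?thesis using \<phi> by (meson ball_isom_iff bij_betw_imp_inj_on inj_on_subset)
    qed
    moreover have "finite (?N y)" using finite_rep_neighbours[OF y(1)] by simp
    ultimately have "card (?N x) \<le> card (?N y)" by (intro card_inj_on_le[OF inj])
    thus ?thesis using x y by auto
  qed
  thus "\<exists>L. \<forall>y\<in>Mspace d. \<forall>l\<ge>L. Mrel l x y \<longrightarrow> y \<in> {x \<in> Mspace d. k \<le> card (?N x)}" by blast
qed auto

lemma open_in_Mborel: "open_M d U \<Longrightarrow> U \<in> sets (Mborel d)"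
  unfolding sets_Mborel by (rule sigma_sets.Basic) simp

lemma open_M_space: "open_M d (Mspace d)"
  by (auto simp: M.openin_level)

text \<open>
  The sets \<open>S\<close> for which the number of neighbours in \<open>S\<close> is measurable form a Dynkin system, which
  contains the intersection-stable family of open sets.
\<close>

lemma measurable_adj_indicator:
  assumes "S \<in> sets (Mborel d)"
  shows "(\<lambda>x. adj (indicator S) x :: real) \<in> borel_measurable (Mborel d)"
proof -
  have basic: "(\<lambda>x. adj (indicator S) x :: real) \<in> borel_measurable (Mborel d)" if S: "open_M d S" for S
  proof -
    let ?N = "\<lambda>x. card {w \<in> neighbours (rep_graph x) (rep_root x). rclass (rep_graph x) w \<in> S}"
    have "?N \<in> measurable (Mborel d) (count_space UNIV)"
    proof (subst measurable_count_space_eq2_countable, intro conjI ballI)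
      fix k
      have "?N -` {k} \<inter> space (Mborel d) = {x \<in> Mspace d. k \<le> ?N x} - {x \<in> Mspace d. Suc k \<le> ?N x}"
        by auto
      thus "?N -` {k} \<inter> space (Mborel d) \<in> sets (Mborel d)"
        using open_in_Mborel[OF open_card_neighbours[OF S, of k]]
          open_in_Mborel[OF open_card_neighbours[OF S, of "Suc k"]] by auto
    qed auto
    hence "(\<lambda>x. real (?N x)) \<in> borel_measurable (Mborel d)" by simp
    thus ?thesis by (subst measurable_cong[OF adj_indicator]) auto
  qed
  have "Int_stable {U. open_M d U}" by (auto simp: Int_stable_def)
  moreover have "{U. open_M d U} \<subseteq> Pow (Mspace d)" by (auto simp: M.openin_level)
  moreover have "S \<in> sigma_sets (Mspace d) {U. open_M d U}" using assms by (simp add: sets_Mborel)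
  ultimately show ?thesis
  proof (induction rule: sigma_sets_induct_disjoint)
    case (basic A) thus ?case using \<open>\<And>S. open_M d S \<Longrightarrow> _\<close> by blast
  next
    case empty
    show ?case by (simp add: adj_def)
  next
    case (compl A)
    have "adj (indicator (Mspace d - A)) x = (adj (indicator (Mspace d)) x - adj (indicator A) x :: real)"
      if "x \<in> Mspace d" for x
    proof -
      have "adj (indicator (Mspace d - A)) x = adj (\<lambda>x. indicator (Mspace d) x - indicator A x :: real) x"
        by (rule adj_cong[OF that]) (auto simp: indicator_def)
      thus ?thesis by (simp add: adj_diff)
    qed
    thus ?case using compl basic[OF open_M_space]
      by (subst measurable_cong[where g="\<lambda>x. adj (indicator (Mspace d)) x - adj (indicator A) x"]) auto
  next
    case (union A)
    have "(\<lambda>i. adj (indicator (A i)) x :: real) sums adj (indicator (\<Union>i. A i)) x" for x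
      unfolding adj_def using union.hyps(1)
      by (intro sums_sum indicator_sums) (auto simp: disjoint_family_on_def)
    hence "adj (indicator (\<Union>i. A i)) x = (\<Sum>i. adj (indicator (A i)) x :: real)" for x
      by (simp add: sums_iff)
    thus ?case using union.IH by simp
  qed
qed

lemma measurable_adj_ennreal:
  fixes f :: "rgraph set \<Rightarrow> ennreal"
  assumes "f \<in> borel_measurable (Mborel d)"
  shows "adj f \<in> borel_measurable (Mborel d)"
  using assms
proof (induction rule: borel_measurable_induct)
  case (cong f g)
  have "adj f x = adj g x" if "x \<in> Mspace d" for x using adj_cong[OF that] cong.hyps(3) by auto
  thus ?case using cong.IH by (subst measurable_cong[where g="adj g"]) auto
next
  case (set A)
  have "adj (indicator A) x = ennreal (adj (indicator A) x)" if "x \<in> Mspace d" for x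
    using adj_ennreal[OF that, of "indicator A"] by (simp add: ennreal_indicator)
  thus ?case using measurable_adj_indicator[OF set]
    by (subst measurable_cong[where g="\<lambda>x. ennreal (adj (indicator A) x)"]) auto
next
  case (mult u c)
  thus ?case by (simp add: adj_cmult[abs_def])
next
  case (add u v)
  thus ?case by (simp add: adj_add[abs_def])
next
  case (seq U)
  have "adj (SUP i. U i) x = (SUP i. adj (U i) x)" for x
    unfolding adj_def Sup_apply image_image using seq.hyps(3)
    by (intro ennreal_SUP_sum[symmetric]) (auto simp: incseq_def le_fun_def)
  moreover have "(\<lambda>x. SUP i. adj (U i) x) \<in> borel_measurable (Mborel d)" using seq.IH by measurable
  ultimately show ?case by (subst measurable_cong) auto
qed

lemma measurable_adj_nonneg:
  fixes f :: "rgraph set \<Rightarrow> real"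
  assumes "f \<in> borel_measurable (Mborel d)" "\<And>x. x \<in> Mspace d \<Longrightarrow> 0 \<le> f x"
  shows "adj f \<in> borel_measurable (Mborel d)"
proof -
  have "adj f x = enn2real (adj (\<lambda>y. ennreal (f y)) x)" if "x \<in> Mspace d" for x
    using adj_ennreal[OF that assms(2)] adj_nonneg[OF that assms(2)] by simp
  moreover have "adj (\<lambda>y. ennreal (f y)) \<in> borel_measurable (Mborel d)"
    using assms(1) by (intro measurable_adj_ennreal) simp
  ultimately show ?thesis
    by (subst measurable_cong[where g="\<lambda>x. enn2real (adj (\<lambda>y. ennreal (f y)) x)"]) auto
qed

lemma measurable_adj_real:
  fixes f :: "rgraph set \<Rightarrow> real"
  assumes "f \<in> borel_measurable (Mborel d)"
  shows "adj f \<in> borel_measurable (Mborel d)"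
proof -
  have eq: "adj f = (\<lambda>x. adj (\<lambda>y. max 0 (f y)) x - adj (\<lambda>y. max 0 (- f y)) x)"
    unfolding adj_diff[symmetric] by (intro ext arg_cong[where f="\<lambda>g. adj g _"]) auto
  have "adj (\<lambda>y. max 0 (f y)) \<in> borel_measurable (Mborel d)" "adj (\<lambda>y. max 0 (- f y)) \<in> borel_measurable (Mborel d)"
    using assms by (auto intro!: measurable_adj_nonneg)
  thus ?thesis by (subst eq) (rule borel_measurable_diff)
qed

lemma adj_Re: "Re (adj f x) = adj (\<lambda>y. Re (f y)) x"
  and adj_Im: "Im (adj f x) = adj (\<lambda>y. Im (f y)) x"
  by (simp_all add: adj_def)

lemma measurable_adj_complex:
  fixes f :: "rgraph set \<Rightarrow> complex"
  assumes "f \<in> borel_measurable (Mborel d)"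
  shows "adj f \<in> borel_measurable (Mborel d)"
  using assms unfolding borel_measurable_complex_iff adj_Re adj_Im
  by (auto intro!: measurable_adj_real)

section \<open>The mass transport principle\<close>

text \<open>
  A representative of a class of doubly rooted graphs, the classes obtained by forgetting one of
  the two roots, and adjacency of the roots.
\<close>

definition birep :: "brgraph set \<Rightarrow> brgraph" where
  "birep z = (SOME t. t \<in> z)"

definition root1 :: "brgraph set \<Rightarrow> rgraph set" where
  "root1 z = (case birep z of (G, r, v) \<Rightarrow> rclass G r)"

definition root2 :: "brgraph set \<Rightarrow> rgraph set" where
  "root2 z = (case birep z of (G, r, v) \<Rightarrow> rclass G v)"

definition adjacent_roots :: "brgraph set \<Rightarrow> bool" where
  "adjacent_roots z = (case birep z of (G, r, v) \<Rightarrow> (r, v) \<in> edges G)"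

lemma birep_brclass:
  assumes "simple_graph G" "r \<in> verts G" "v \<in> verts G"
  obtains H \<phi> where "birep (brclass G r v) = (H, \<phi> r, \<phi> v)" "graph_isom \<phi> G H" "simple_graph H"
proof -
  have "birep (brclass G r v) \<in> brclass G r v"
    unfolding birep_def using brclass_self[OF assms] by (rule someI)
  moreover obtain H s w where "birep (brclass G r v) = (H, s, w)" by (cases "birep (brclass G r v)")
  ultimately show ?thesis using that by (auto simp: mem_brclass_iff)
qed

lemma root1_brclass:
  assumes "simple_graph G" "r \<in> verts G" "v \<in> verts G"
  shows "root1 (brclass G r v) = rclass G r"
  using birep_brclass[OF assms] rclass_isom[OF assms(1) _ _ assms(2)] by (metis case_prod_conv root1_def)

lemma root2_brclass:
  assumes "simple_graph G" "r \<in> verts G" "v \<in> verts G"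
  shows "root2 (brclass G r v) = rclass G v"
  using birep_brclass[OF assms] rclass_isom[OF assms(1) _ _ assms(3)] by (metis case_prod_conv root2_def)

lemma adjacent_roots_brclass:
  assumes "simple_graph G" "r \<in> verts G" "v \<in> verts G"
  shows "adjacent_roots (brclass G r v) \<longleftrightarrow> (r, v) \<in> edges G"
  using birep_brclass[OF assms] assms(2,3) by (metis case_prod_conv adjacent_roots_def graph_isom_def)

lemma open_in_BMborel: "open_BM d U \<Longrightarrow> U \<in> sets (BMborel d)"
  unfolding sets_BMborel by (rule sigma_sets.Basic) simp

lemma measurable_root1: "root1 \<in> measurable (BMborel d) (Mborel d)"
proof (rule measurable_sigma_sets[OF sets_Mborel])
  show "{U. open_M d U} \<subseteq> Pow (Mspace d)" by (auto simp: M.openin_level)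
  show "root1 \<in> space (BMborel d) \<rightarrow> Mspace d"
  proof
    fix z assume "z \<in> space (BMborel d)"
    then obtain G r v where "good_graph d G" "r \<in> verts G" "v \<in> verts G" "z = brclass G r v"
      by (auto simp: BMspace_iff)
    thus "root1 z \<in> Mspace d" using root1_brclass good_graphD(1) by (auto simp: Mspace_iff)
  qed
  fix U assume U: "U \<in> {U. open_M d U}"
  have "open_BM d (root1 -` U \<inter> BMspace d)"
    unfolding BM.openin_level
  proof (intro conjI ballI)
    fix z assume z: "z \<in> root1 -` U \<inter> BMspace d"
    then obtain G r v where G: "good_graph d G" "r \<in> verts G" "v \<in> verts G" "z = brclass G r v"
      by (auto simp: BMspace_iff)
    note sG = good_graphD(1)[OF G(1)]
    have "rclass G r \<in> U" using z G root1_brclass[OF sG G(2,3)] by simp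
    then obtain L where L: "\<And>y l. y \<in> Mspace d \<Longrightarrow> L \<le> l \<Longrightarrow> Mrel l (rclass G r) y \<Longrightarrow> y \<in> U"
      using U unfolding M.openin_level by blast
    have "z' \<in> root1 -` U \<inter> BMspace d" if z': "z' \<in> BMspace d" "L \<le> l" "BMrel l z z'" for z' l
    proof -
      obtain H s w where H: "good_graph d H" "s \<in> verts H" "w \<in> verts H" "z' = brclass H s w"
        using z'(1) by (auto simp: BMspace_iff)
      note sH = good_graphD(1)[OF H(1)]
      have "Mrel l (rclass G r) (rclass H s)"
        using z'(3) BMrel_brclass_iff[OF sG G(2,3) sH H(2,3)] Mrel_rclass_iff[OF sG G(2) sH H(2)] G H by auto
      hence "rclass H s \<in> U" using L[OF _ z'(2)] H by (auto simp: Mspace_iff)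
      thus ?thesis using z'(1) root1_brclass[OF sH H(2,3)] H by simp
    qed
    thus "\<exists>L. \<forall>y\<in>BMspace d. \<forall>l\<ge>L. BMrel l z y \<longrightarrow> y \<in> root1 -` U \<inter> BMspace d" by blast
  qed auto
  thus "root1 -` U \<inter> space (BMborel d) \<in> sets (BMborel d)" using open_in_BMborel by simp
qed

text \<open>
  If the second root has distance at most \<open>k\<close> from the first, then the \<open>l\<close>-ball around the first root
  contains the \<open>(l - k)\<close>-ball around the second, so forgetting the first root is continuous.
\<close>

lemma measurable_root2: "root2 \<in> measurable (BMborel d) (Mborel d)"
proof (rule measurable_sigma_sets[OF sets_Mborel])
  show "{U. open_M d U} \<subseteq> Pow (Mspace d)" by (auto simp: M.openin_level)
  show "root2 \<in> space (BMborel d) \<rightarrow> Mspace d"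
  proof
    fix z assume "z \<in> space (BMborel d)"
    then obtain G r v where "good_graph d G" "r \<in> verts G" "v \<in> verts G" "z = brclass G r v"
      by (auto simp: BMspace_iff)
    thus "root2 z \<in> Mspace d" using root2_brclass good_graphD(1) by (auto simp: Mspace_iff)
  qed
  fix U assume U: "U \<in> {U. open_M d U}"
  have "open_BM d (root2 -` U \<inter> BMspace d)"
    unfolding BM.openin_level
  proof (intro conjI ballI)
    fix z assume z: "z \<in> root2 -` U \<inter> BMspace d"
    then obtain G r v where G: "good_graph d G" "r \<in> verts G" "v \<in> verts G" "z = brclass G r v"
      by (auto simp: BMspace_iff)
    note sG = good_graphD(1)[OF G(1)]
    have "rclass G v \<in> U" using z G root2_brclass[OF sG G(2,3)] by simp
    then obtain L where L: "\<And>y l. y \<in> Mspace d \<Longrightarrow> L \<le> l \<Longrightarrow> Mrel l (rclass G v) y \<Longrightarrow> y \<in> U"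
      using U unfolding M.openin_level by blast
    obtain k where k: "v \<in> ball_verts G r k" using ex_ball[OF G(1-3)] by blast
    have "z' \<in> root2 -` U \<inter> BMspace d" if z': "z' \<in> BMspace d" "L + k \<le> l" "BMrel l z z'" for z' l
    proof -
      obtain H s w where H: "good_graph d H" "s \<in> verts H" "w \<in> verts H" "z' = brclass H s w"
        using z'(1) by (auto simp: BMspace_iff)
      note sH = good_graphD(1)[OF H(1)]
      obtain \<phi> where \<phi>: "ball_isom \<phi> G r H s l" "\<phi> v = w"
        using z'(3) BMrel_brclass_iff[OF sG G(2,3) sH H(2,3)] G H by auto
      have "ball_isom \<phi> G v H w (l - k)"
        using ball_isom_recentre[OF sG sH \<phi>(1) G(2) k, of "l - k"] z'(2) \<phi>(2) by simp
      hence "Mrel (l - k) (rclass G v) (rclass H w)"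
        using Mrel_rclass_iff[OF sG G(3) sH H(3)] by auto
      moreover have "rclass H w \<in> Mspace d" using H by (auto simp: Mspace_iff)
      moreover have "L \<le> l - k" using z'(2) by simp
      ultimately have "rclass H w \<in> U" using L by blast
      thus ?thesis using z'(1) root2_brclass[OF sH H(2,3)] H by simp
    qed
    thus "\<exists>L. \<forall>y\<in>BMspace d. \<forall>l\<ge>L. BMrel l z y \<longrightarrow> y \<in> root2 -` U \<inter> BMspace d" by blast
  qed auto
  thus "root2 -` U \<inter> space (BMborel d) \<in> sets (BMborel d)" using open_in_BMborel by simp
qed

lemma measurable_adjacent_roots: "{z \<in> BMspace d. adjacent_roots z} \<in> sets (BMborel d)"
proof (rule open_in_BMborel, unfold BM.openin_level, intro conjI ballI)
  fix z assume "z \<in> {z \<in> BMspace d. adjacent_roots z}"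
  then obtain G r v where G: "good_graph d G" "r \<in> verts G" "v \<in> verts G" "z = brclass G r v"
    and adj: "adjacent_roots z" by (auto simp: BMspace_iff)
  note sG = good_graphD(1)[OF G(1)]
  have "z' \<in> {z \<in> BMspace d. adjacent_roots z}" if z': "z' \<in> BMspace d" "BMrel l z z'" for z' l
  proof -
    obtain H s w where H: "good_graph d H" "s \<in> verts H" "w \<in> verts H" "z' = brclass H s w"
      using z'(1) by (auto simp: BMspace_iff)
    note sH = good_graphD(1)[OF H(1)]
    obtain \<phi> where \<phi>: "ball_isom \<phi> G r H s l" "\<phi> v = w" "v \<in> ball_verts G r l"
      using z'(2) BMrel_brclass_iff[OF sG G(2,3) sH H(2,3)] G H by auto
    have "(s, w) \<in> edges H"
      using \<phi> adj G adjacent_roots_brclass[OF sG G(2,3)] by (auto simp: ball_isom_iff)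
    thus ?thesis using z'(1) adjacent_roots_brclass[OF sH H(2,3)] H by simp
  qed
  thus "\<exists>L. \<forall>y\<in>BMspace d. \<forall>l\<ge>L. BMrel l z y \<longrightarrow> y \<in> {z \<in> BMspace d. adjacent_roots z}" by blast
qed auto

text \<open>
  Mass transport applied to the function that sends mass \<open>f [(G, r)] * g [(G, v)]\<close> from \<open>r\<close> to each
  neighbour \<open>v\<close>: the adjacency operator is symmetric for the law of a unimodular random graph.  This
  is the only consequence of unimodularity used below.
\<close>

lemma unimodular_adj:
  fixes f g :: "rgraph set \<Rightarrow> ennreal"
  assumes uni: "unimodular d P X" and X: "X \<in> measurable P (Mborel d)"
    and f: "f \<in> borel_measurable (Mborel d)" and g: "g \<in> borel_measurable (Mborel d)"
  shows "(\<integral>\<^sup>+\<omega>. f (X \<omega>) * adj g (X \<omega>) \<partial>P) = (\<integral>\<^sup>+\<omega>. adj f (X \<omega>) * g (X \<omega>) \<partial>P)"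
proof -
  define F where "F z = indicator {z \<in> BMspace d. adjacent_roots z} z * (f (root1 z) * g (root2 z))" for z
  have "F \<in> borel_measurable (BMborel d)"
    unfolding F_def using measurable_compose[OF measurable_root1 f] measurable_compose[OF measurable_root2 g]
      measurable_adjacent_roots by measurable
  hence "(\<integral>\<^sup>+\<omega>. (\<integral>\<^sup>+v. F (brclass (rep_graph (X \<omega>)) (rep_root (X \<omega>)) v)
                 \<partial>count_space (verts (rep_graph (X \<omega>)))) \<partial>P) =
     (\<integral>\<^sup>+\<omega>. (\<integral>\<^sup>+v. F (brclass (rep_graph (X \<omega>)) v (rep_root (X \<omega>)))
                 \<partial>count_space (verts (rep_graph (X \<omega>)))) \<partial>P)"
    using uni by (simp add: unimodular_def)
  moreover have "(\<integral>\<^sup>+v. F (brclass (rep_graph x) (rep_root x) v) \<partial>count_space (verts (rep_graph x))) = f x * adj g x"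
    and "(\<integral>\<^sup>+v. F (brclass (rep_graph x) v (rep_root x)) \<partial>count_space (verts (rep_graph x))) = adj f x * g x"
    if x: "x \<in> Mspace d" for x
  proof -
    let ?G = "rep_graph x" and ?r = "rep_root x"
    note G = rep_good[OF x] and r = rep_root_verts[OF x]
    note sG = good_graphD(1)[OF G]
    have F: "F (brclass ?G u v) = (if (u, v) \<in> edges ?G then f (rclass ?G u) * g (rclass ?G v) else 0)"
      if "u \<in> verts ?G" "v \<in> verts ?G" for u v
    proof -
      have "brclass ?G u v \<in> BMspace d" using that G by (auto simp: BMspace_iff)
      thus ?thesis unfolding F_def
        using root1_brclass[OF sG that] root2_brclass[OF sG that] adjacent_roots_brclass[OF sG that]
        by (simp add: indicator_def)
    qed
    have nb: "neighbours ?G ?r \<subseteq> verts ?G" using neighbours_subset[OF sG] .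
    have "(\<integral>\<^sup>+v. F (brclass ?G ?r v) \<partial>count_space (verts ?G)) = (\<Sum>v\<in>neighbours ?G ?r. F (brclass ?G ?r v))"
      using F[OF r] by (intro nn_integral_count_space' finite_neighbours[OF G r] nb) (auto simp: neighbours_def)
    also have "\<dots> = (\<Sum>v\<in>neighbours ?G ?r. f x * g (rclass ?G v))"
      using F[OF r] nb rclass_rep[OF x] by (intro sum.cong) (auto simp: neighbours_def)
    finally show "(\<integral>\<^sup>+v. F (brclass ?G ?r v) \<partial>count_space (verts ?G)) = f x * adj g x"
      by (simp add: adj_def sum_distrib_left)
    have sym: "(u, ?r) \<in> edges ?G \<longleftrightarrow> (?r, u) \<in> edges ?G" for u
      using sG by (auto simp: simple_graph_def sym_def)
    have "(\<integral>\<^sup>+v. F (brclass ?G v ?r) \<partial>count_space (verts ?G)) = (\<Sum>v\<in>neighbours ?G ?r. F (brclass ?G v ?r))"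
      using F[OF _ r] by (intro nn_integral_count_space' finite_neighbours[OF G r] nb) (auto simp: neighbours_def sym)
    also have "\<dots> = (\<Sum>v\<in>neighbours ?G ?r. f (rclass ?G v) * g x)"
      using F[OF _ r] nb rclass_rep[OF x] by (intro sum.cong) (auto simp: neighbours_def sym)
    finally show "(\<integral>\<^sup>+v. F (brclass ?G v ?r) \<partial>count_space (verts ?G)) = adj f x * g x"
      by (simp add: adj_def sum_distrib_right)
  qed
  moreover have "X \<omega> \<in> Mspace d" if "\<omega> \<in> space P" for \<omega>
    using measurable_space[OF X that] by simp
  ultimately show ?thesis by (simp cong: nn_integral_cong_simp)
qed

section \<open>Counting walks\<close>

lemma walks_0: "r \<in> verts G \<Longrightarrow> walks G r 0 = {[r]}"
  by (auto simp: walks_def length_Suc_conv)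

lemma walks_Suc:
  assumes "simple_graph G" "r \<in> verts G"
  shows "walks G r (Suc n) = (\<Union>w\<in>neighbours G r. (#) r ` walks G w n)"
proof (intro equalityI subsetI)
  fix p assume p: "p \<in> walks G r (Suc n)"
  then obtain a b q where pq: "p = a # b # q" by (auto simp: walks_def length_Suc_conv)
  hence "b \<in> neighbours G r" "b # q \<in> walks G b n" "a = r"
    using p by (auto simp: walks_def neighbours_def)
  thus "p \<in> (\<Union>w\<in>neighbours G r. (#) r ` walks G w n)" using pq by blast
next
  fix p assume "p \<in> (\<Union>w\<in>neighbours G r. (#) r ` walks G w n)"
  then obtain w q where wq: "(r, w) \<in> edges G" "q \<in> walks G w n" "p = r # q"
    by (auto simp: neighbours_def)
  then obtain q' where "q = w # q'" by (cases q) (auto simp: walks_def)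
  thus "p \<in> walks G r (Suc n)" using wq assms(2) by (auto simp: walks_def)
qed

lemma card_walks:
  assumes "good_graph d G" "r \<in> verts G"
  shows "finite (walks G r n) \<and> real (card (walks G r n)) = (adj ^^ n) (\<lambda>_. 1) (rclass G r)"
  using assms(2)
proof (induction n arbitrary: r)
  case 0
  thus ?case by (simp add: walks_0)
next
  case (Suc n)
  have nb: "w \<in> verts G" if "w \<in> neighbours G r" for w
    using neighbours_subset[OF good_graphD(1)[OF assms(1)]] that by auto
  have fin: "finite (neighbours G r)" using finite_neighbours[OF assms(1) Suc.prems] .
  have eq: "walks G r (Suc n) = (\<Union>w\<in>neighbours G r. (#) r ` walks G w n)"
    using walks_Suc[OF good_graphD(1)[OF assms(1)] Suc.prems] .
  have "card (walks G r (Suc n)) = (\<Sum>w\<in>neighbours G r. card ((#) r ` walks G w n))"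
    unfolding eq using fin Suc.IH[OF nb] by (intro card_UN_disjoint) (auto simp: walks_def)
  also have "\<dots> = (\<Sum>w\<in>neighbours G r. card (walks G w n))" by (simp add: card_image)
  finally have "real (card (walks G r (Suc n))) = adj ((adj ^^ n) (\<lambda>_. 1)) (rclass G r)"
    using Suc.IH[OF nb] by (simp add: adj_rclass[OF assms(1) Suc.prems])
  moreover have "finite (walks G r (Suc n))" unfolding eq using fin Suc.IH[OF nb] by auto
  ultimately show ?case by simp
qed

lemma walk_count_eq:
  assumes "x \<in> Mspace d"
  shows "real (walk_count n x) = (adj ^^ n) (\<lambda>_. 1) x"
  using card_walks[OF rep_good[OF assms] rep_root_verts[OF assms]] rclass_rep[OF assms]
  by (simp add: walk_count_def)

section \<open>Sequences with a doubling property\<close>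

lemma superadditive_multiples:
  fixes b :: "nat \<Rightarrow> real"
  assumes double: "\<And>n. 1 \<le> n \<Longrightarrow> 2 * b n \<le> b (2 * n)"
    and triple: "\<And>n j. 1 \<le> j \<Longrightarrow> j \<le> n \<Longrightarrow> 2 * b n + b j \<le> b (2 * n + j)"
    and "1 \<le> m" "1 \<le> k"
  shows "real k * b m \<le> b (k * m)"
  using \<open>1 \<le> k\<close>
proof (induction k rule: less_induct)
  case (less k)
  define q where "q = k div 2"
  show ?case
  proof (cases "k = 1")
    case False
    hence q: "1 \<le> q" "q < k" using less.prems by (auto simp: q_def)
    have IH: "real q * b m \<le> b (q * m)" using less.IH[OF q(2,1)] .
    have qm: "1 \<le> q * m" using q(1) assms(3) by (cases "q * m") auto
    show ?thesis
    proof (cases "even k")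
      case True
      hence k: "k = 2 * q" by (simp add: q_def)
      have "real k * b m = 2 * (real q * b m)" by (simp add: k)
      also have "\<dots> \<le> b (2 * (q * m))" using IH double[OF qm] by linarith
      finally show ?thesis by (simp add: k mult.assoc)
    next
      case False
      hence k: "k = 2 * q + 1" by (simp add: q_def)
      have "m \<le> q * m" using q(1) by simp
      have "real k * b m = 2 * (real q * b m) + b m" by (simp add: k algebra_simps)
      also have "\<dots> \<le> b (2 * (q * m) + m)" using IH triple[OF assms(3) \<open>m \<le> q * m\<close>] by linarith
      finally show ?thesis by (simp add: k algebra_simps)
    qed
  qed simp
qed

text \<open>
  The growth argument.  Up to a logarithmic correction, \<open>ln (w n)\<close> satisfies
  \<open>a (2 n) \<ge> 2 a n\<close> and \<open>a (2 n + j) \<ge> 2 a n + a j\<close>; expanding \<open>k\<close> in base two gives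
  \<open>a (k m) \<ge> k a m\<close>, so that \<open>a n / n\<close> is asymptotically at least each of its values.
\<close>

lemma growth_rate_converges:
  fixes w :: "nat \<Rightarrow> real"
  assumes ge1: "\<And>n. 1 \<le> w n" and mono: "\<And>n. w n \<le> w (Suc n)"
    and D: "1 \<le> D" "\<And>n. w n \<le> D ^ n"
    and C: "\<And>n j. j \<le> n \<Longrightarrow> (w n)\<^sup>2 * w j \<le> C * (real n + 1) ^ 3 * w (2 * n + j)"
  shows "\<exists>L. (\<lambda>n. ln (w n) / real n) \<longlonglongrightarrow> L"
proof -
  define a where "a n = ln (w n)" for n
  define c where "c = ln C"
  define E where "E = c + 3 * ln 2"
  \<comment> \<open>\<open>2 * h n - h (2 * n)\<close> and, for \<open>j \<le> n\<close>, \<open>2 * h n + h j - h (2 * n + j)\<close> are at least the error term\<close>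
  define h where "h n = E + 3 * ln (real n + 1)" for n
  define b where "b n = a n - h n" for n
  have wpos: "0 < w n" for n using ge1[of n] by linarith
  have a0: "0 \<le> a n" for n using ge1[of n] by (simp add: a_def)
  have "w 0 = 1" using ge1[of 0] D(2)[of 0] by simp
  hence C1: "1 \<le> C" using C[of 0 0] by simp
  have c0: "0 \<le> c" using C1 by (simp add: c_def)
  have E0: "0 \<le> E" using c0 by (simp add: E_def)
  have a_step: "2 * a n + a j \<le> c + 3 * ln (real n + 1) + a (2 * n + j)" if "j \<le> n" for n j
  proof -
    have "ln ((w n)\<^sup>2 * w j) \<le> ln (C * (real n + 1) ^ 3 * w (2 * n + j))"
      using C[OF that] wpos[of n] wpos[of j] by (intro ln_mono) auto
    moreover have "ln ((w n)\<^sup>2 * w j) = 2 * a n + a j"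
      using wpos[of n] wpos[of j] by (simp add: ln_mult_pos ln_realpow a_def)
    moreover have "ln (C * (real n + 1) ^ 3 * w (2 * n + j)) = c + 3 * ln (real n + 1) + a (2 * n + j)"
    proof -
      have "C * (real n + 1) ^ 3 > 0" "(real n + 1) ^ 3 > 0" using C1 by auto
      thus ?thesis using C1 wpos[of "2*n+j"] by (simp add: ln_mult_pos ln_realpow a_def c_def)
    qed
    ultimately show ?thesis by linarith
  qed
  have ln1: "ln (2 * real n + 1) \<le> ln 2 + ln (real n + 1)" for n
  proof -
    have "ln (2 * real n + 1) \<le> ln (2 * (real n + 1))" by (intro ln_mono) auto
    also have "\<dots> = ln 2 + ln (real n + 1)" by (intro ln_mult_pos) auto
    finally show ?thesis .
  qed
  have ln2: "ln (2 * real n + real j + 1) \<le> ln 2 + ln (real n + 1) + ln (real j + 1)" for n j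
  proof -
    have "ln (2 * real n + real j + 1) \<le> ln (2 * (real n + 1) * (real j + 1))"
      by (intro ln_mono) (auto simp: algebra_simps)
    also have "\<dots> = ln (2 * (real n + 1)) + ln (real j + 1)" by (rule ln_mult_pos) auto
    also have "ln (2 * (real n + 1)) = ln 2 + ln (real n + 1)" by (rule ln_mult_pos) auto
    finally show ?thesis .
  qed
  have double: "2 * b n \<le> b (2 * n)" for n
    using a_step[of 0 n] a0[of 0] ln1[of n] unfolding b_def h_def E_def by simp
  have triple: "2 * b n + b j \<le> b (2 * n + j)" if "j \<le> n" for n j
  proof -
    have "h (2 * n + j) = E + 3 * ln (2 * real n + real j + 1)" by (simp add: h_def)
    moreover have "ln (2 * real n + real j + 1) \<le> 2 * ln 2 + ln (real n + 1) + ln (real j + 1)"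
      using ln2[of n j] by (rule order_trans) simp
    ultimately show ?thesis
      using a_step[OF that] c0 unfolding b_def h_def[of n] h_def[of j] E_def
      by (simp add: algebra_simps)
  qed
  have amono: "a m \<le> a n" if "m \<le> n" for m n
    using lift_Suc_mono_le[of w, OF mono that] wpos[of m] by (simp add: a_def ln_mono)
  have h0: "0 \<le> h n" for n using E0 by (simp add: h_def)
  have lower: "b m / real m - \<bar>b m\<bar> / real n \<le> a n / real n" if m: "1 \<le> m" and n: "m \<le> n" for m n
  proof (cases "0 \<le> b m")
    case True
    define q where "q = n div m"
    have q: "1 \<le> q" "q * m \<le> n" "n < (q + 1) * m"
      using m n by (auto simp: q_def div_greater_zero_iff Suc_le_eq dividend_less_div_times)
    have "real q * b m \<le> b (q * m)" using superadditive_multiples[OF double triple m q(1)] by blast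
    also have "\<dots> \<le> a (q * m)" using h0[of "q * m"] by (simp add: b_def)
    also have "\<dots> \<le> a n" using amono[OF q(2)] .
    finally have qa: "real q * b m \<le> a n" .
    have "real n \<le> (real q + 1) * real m"
      using q(3) by (metis less_imp_le of_nat_1 of_nat_add of_nat_le_iff of_nat_mult)
    hence "real n * b m \<le> (real q + 1) * real m * b m" using True by (rule mult_right_mono)
    hence "real n * b m - real m * b m \<le> real m * (real q * b m)" by (simp add: algebra_simps)
    also have "\<dots> \<le> real m * a n" using qa by (intro mult_left_mono) auto
    finally have "(real n * b m - real m * b m) / (real m * real n) \<le> real m * a n / (real m * real n)"
      by (rule divide_right_mono) simp
    moreover have "(real n * b m - real m * b m) / (real m * real n) = b m / real m - b m / real n"
      using m n by (simp add: diff_divide_distrib)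
    ultimately show ?thesis using m True by simp
  next
    case False
    have "b m / real m - \<bar>b m\<bar> / real n \<le> 0"
      using False m n by (auto simp: divide_nonpos_pos intro: order_trans[of _ "b m / real m"])
    also have "0 \<le> a n / real n" using a0 by simp
    finally show ?thesis .
  qed
  define L where "L = (SUP m\<in>{1..}. b m / real m)"
  have alnD: "a n \<le> real n * ln D" for n
  proof -
    have "a n \<le> ln (D ^ n)" unfolding a_def using D(2) wpos by (intro ln_mono) auto
    thus ?thesis using D(1) by (simp add: ln_realpow)
  qed
  have bdd: "bdd_above ((\<lambda>m. b m / real m) ` {1..})"
  proof (rule bdd_aboveI2)
    fix m :: nat assume "m \<in> {1..}"
    moreover have "b m \<le> real m * ln D" using alnD[of m] h0[of m] by (simp add: b_def)
    ultimately show "b m / real m \<le> ln D" by (simp add: field_simps)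
  qed
  have "(\<lambda>n. a n / real n) \<longlonglongrightarrow> L"
  proof (rule order_tendstoI)
    fix u assume "u < L"
    then obtain m where m: "1 \<le> m" "u < b m / real m"
      unfolding L_def using less_cSUP_iff[OF _ bdd] by auto
    have "(\<lambda>n. b m / real m - \<bar>b m\<bar> / real n) \<longlonglongrightarrow> b m / real m - 0"
      by (intro tendsto_intros tendsto_divide_0[OF tendsto_const] filterlim_real_sequentially 
          filterlim_at_top_imp_at_infinity)
    hence "eventually (\<lambda>n. u < b m / real m - \<bar>b m\<bar> / real n) sequentially"
      using m(2) by (intro order_tendstoD(1)) auto
    with eventually_ge_at_top[of m] show "eventually (\<lambda>n. u < a n / real n) sequentially"
      by eventually_elim (use lower[OF m(1)] in force)
  next
    fix u assume "L < u"
    have "(\<lambda>n. h n / real n) \<longlonglongrightarrow> 0" unfolding h_def by real_asymp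
    from tendsto_add[OF tendsto_const[of L] this]
    have "eventually (\<lambda>n. L + h n / real n < u) sequentially"
      using \<open>L < u\<close> by (intro order_tendstoD(2)[of _ "L + 0"]) auto
    with eventually_ge_at_top[of 1] show "eventually (\<lambda>n. a n / real n < u) sequentially"
    proof eventually_elim
      case (elim n)
      have "b n / real n \<le> L" unfolding L_def using elim by (intro cSUP_upper bdd) auto
      moreover have "a n / real n = b n / real n + h n / real n"
        by (simp add: b_def diff_divide_distrib)
      ultimately show ?case using elim by linarith
    qed
  qed
  thus ?thesis unfolding a_def by blast
qed

text \<open>
  Identification of a growth rate that is known to exist: an upper bound of order \<open>\<rho> ^ n\<close> up to
  polynomial factors, and unboundedness of \<open>w n / c ^ n\<close> along a sequence of \<open>c\<close> increasing to \<open>\<rho>\<close>.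
\<close>

lemma growth_rate_eq:
  fixes w :: "nat \<Rightarrow> real"
  assumes ge1: "\<And>n. 1 \<le> w n" and lim: "(\<lambda>n. ln (w n) / real n) \<longlonglongrightarrow> L" and "0 < \<rho>"
    and upper: "\<And>n. (w n)\<^sup>2 \<le> C * (real n + 1) ^ 2 * \<rho> ^ (2 * n)"
    and lower: "\<And>k C. \<exists>n. C * (\<rho> * (1 - 1 / (real k + 2))) ^ n < w n"
  shows "L = ln \<rho>"
proof (rule antisym)
  have wpos: "0 < w n" for n using ge1[of n] by linarith
  have C0: "0 < C"
  proof -
    have "0 < (w 0)\<^sup>2" using wpos[of 0] by (intro zero_less_power)
    also have "\<dots> \<le> C" using upper[of 0] by simp
    finally show ?thesis .
  qed
  have "(\<lambda>n. (ln C / 2 + ln (real n + 1)) / real n) \<longlonglongrightarrow> 0" by real_asymp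
  from tendsto_add[OF this tendsto_const[of "ln \<rho>"]]
  have lim': "(\<lambda>n. (ln C / 2 + ln (real n + 1)) / real n + ln \<rho>) \<longlonglongrightarrow> ln \<rho>" by simp
  have le: "ln (w n) / real n \<le> (ln C / 2 + ln (real n + 1)) / real n + ln \<rho>" if "1 \<le> n" for n
  proof -
    have "ln ((w n)\<^sup>2) \<le> ln (C * (real n + 1) ^ 2 * \<rho> ^ (2 * n))"
      using upper[of n] wpos[of n] by (intro ln_mono) auto
    also have "\<dots> = ln C + 2 * ln (real n + 1) + 2 * real n * ln \<rho>"
    proof -
      have "C * (real n + 1) ^ 2 > 0" "(real n + 1) ^ 2 > 0" using C0 by auto
      thus ?thesis using C0 \<open>0 < \<rho>\<close> by (simp add: ln_mult_pos ln_realpow)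
    qed
    finally have "ln (w n) \<le> ln C / 2 + ln (real n + 1) + real n * ln \<rho>"
      using wpos[of n] by (simp add: ln_realpow)
    thus ?thesis using that by (simp add: field_simps)
  qed
  show "L \<le> ln \<rho>" using LIMSEQ_le[OF lim lim'] le by blast
next
  have wpos: "0 < w n" for n using ge1[of n] by linarith
  show "ln \<rho> \<le> L"
  proof (rule ccontr)
    assume "\<not> ln \<rho> \<le> L"
    moreover have "(\<lambda>k. 1 - 1 / (real k + 2)) \<longlonglongrightarrow> 1 - 0" by real_asymp
    hence "(\<lambda>k. ln (\<rho> * (1 - 1 / (real k + 2)))) \<longlonglongrightarrow> ln (\<rho> * (1 - 0))"
      using \<open>0 < \<rho>\<close> by (intro tendsto_ln tendsto_mult tendsto_const) auto
    ultimately have "eventually (\<lambda>k. L < ln (\<rho> * (1 - 1 / (real k + 2)))) sequentially"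
      by (intro order_tendstoD(1)) auto
    then obtain k where k: "L < ln (\<rho> * (1 - 1 / (real k + 2)))" by (auto simp: eventually_sequentially)
    define \<mu> where "\<mu> = \<rho> * (1 - 1 / (real k + 2))"
    have \<mu>: "0 < \<mu>" unfolding \<mu>_def using \<open>0 < \<rho>\<close> by (intro mult_pos_pos) (auto simp: field_simps)
    have "eventually (\<lambda>n. ln (w n) / real n < ln \<mu>) sequentially"
      using order_tendstoD(2)[OF lim] k by (simp add: \<mu>_def)
    then obtain N where N: "\<And>n. N \<le> n \<Longrightarrow> ln (w n) / real n < ln \<mu>" by (auto simp: eventually_sequentially)
    have big: "w n \<le> 1 * \<mu> ^ n" if "N \<le> n" "1 \<le> n" for n
    proof -
      have "ln (w n) \<le> ln (\<mu> ^ n)" using N[OF that(1)] that(2) \<mu> by (simp add: ln_realpow field_simps)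
      thus ?thesis using wpos[of n] \<mu> by simp
    qed
    define C where "C = 1 + (\<Sum>i\<in>{..N}. w i / \<mu> ^ i)"
    have "w n \<le> C * \<mu> ^ n" for n
    proof (cases "n \<le> N")
      case True
      have "w n / \<mu> ^ n \<le> (\<Sum>i\<in>{..N}. w i / \<mu> ^ i)"
        using True \<mu> wpos by (intro member_le_sum) (auto intro!: divide_nonneg_pos simp: less_imp_le)
      hence "w n / \<mu> ^ n \<le> C" by (simp add: C_def)
      thus ?thesis using \<mu> by (simp add: field_simps)
    next
      case False
      have "1 \<le> C" unfolding C_def using \<mu> wpos
        by (auto intro!: sum_nonneg divide_nonneg_pos simp: less_imp_le)
      hence "1 * \<mu> ^ n \<le> C * \<mu> ^ n" using \<mu> by (intro mult_right_mono) auto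
      thus ?thesis using big[of n] False by linarith
    qed
    thus False using lower[of C k] by (auto simp: \<mu>_def not_less[symmetric])
  qed
qed

section \<open>Almost sure bounds from bounds on expectations\<close>

text \<open>
  The series of \<open>u n / ((n + 1)\<^sup>2 c n)\<close> has finite expectation, hence converges almost surely, and each
  term is bounded by its sum.
\<close>

lemma AE_quadratic_bound:
  fixes u :: "nat \<Rightarrow> 'a \<Rightarrow> ennreal"
  assumes u: "\<And>n. u n \<in> borel_measurable M" and c: "\<And>n. 0 < c n"
    and int: "\<And>n. (\<integral>\<^sup>+x. u n x \<partial>M) \<le> ennreal (c n)"
  shows "AE x in M. \<exists>C::real. \<forall>n. u n x \<le> ennreal (C * (real n + 1) ^ 2 * c n)"
proof -
  define v where "v n = inverse ((real n + 1) ^ 2 * c n)" for n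
  have v: "0 < v n" for n using c[of n] by (simp add: v_def)
  have sums: "summable (\<lambda>n. inverse ((real n + 1) ^ 2))"
  proof -
    have "inverse ((real n + 1) ^ 2) = 1 / real ((n + 1)\<^sup>2)" for n
      by (simp add: inverse_eq_divide add.commute)
    thus ?thesis using sums_summable[OF inverse_squares_sums] by simp
  qed
  have m: "(\<lambda>x. ennreal (v n) * u n x) \<in> borel_measurable M" for n using u[of n] by simp
  have "(\<integral>\<^sup>+x. (\<Sum>n. ennreal (v n) * u n x) \<partial>M) = (\<Sum>n. \<integral>\<^sup>+x. ennreal (v n) * u n x \<partial>M)"
    by (intro nn_integral_suminf m)
  also have "\<dots> = (\<Sum>n. ennreal (v n) * (\<integral>\<^sup>+x. u n x \<partial>M))"
    by (intro suminf_cong nn_integral_cmult u)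
  also have "\<dots> \<le> (\<Sum>n. ennreal (inverse ((real n + 1) ^ 2)))"
  proof (intro suminf_le)
    fix n
    have "ennreal (v n) * (\<integral>\<^sup>+x. u n x \<partial>M) \<le> ennreal (v n) * ennreal (c n)"
      using int by (intro mult_left_mono) auto
    also have "\<dots> = ennreal (inverse ((real n + 1) ^ 2))"
    proof -
      have "v n * c n = inverse ((real n + 1) ^ 2)" using c[of n] by (simp add: v_def)
      thus ?thesis using v[of n] c[of n] by (subst ennreal_mult[symmetric]) auto
    qed
    finally show "ennreal (v n) * (\<integral>\<^sup>+x. u n x \<partial>M) \<le> ennreal (inverse ((real n + 1) ^ 2))" .
  qed (rule summableI)+
  finally have "(\<integral>\<^sup>+x. (\<Sum>n. ennreal (v n) * u n x) \<partial>M) \<le> (\<Sum>n. ennreal (inverse ((real n + 1) ^ 2)))" .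
  moreover have "(\<Sum>n. ennreal (inverse ((real n + 1) ^ 2))) \<noteq> top"
    by (rule ennreal_suminf_neq_top[OF sums]) simp
  ultimately have "(\<integral>\<^sup>+x. (\<Sum>n. ennreal (v n) * u n x) \<partial>M) \<noteq> \<infinity>"
    by (metis infinity_ennreal_def neq_top_trans)
  hence "AE x in M. (\<Sum>n. ennreal (v n) * u n x) \<noteq> \<infinity>"
    by (intro nn_integral_PInf_AE borel_measurable_suminf_order m)
  thus ?thesis
  proof eventually_elim
    case (elim x)
    define S where "S = enn2real (\<Sum>n. ennreal (v n) * u n x)"
    have S: "(\<Sum>n. ennreal (v n) * u n x) = ennreal S" "0 \<le> S"
      using elim by (auto simp: S_def less_top)
    have "u n x \<le> ennreal (S * (real n + 1) ^ 2 * c n)" for n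
    proof -
      have "ennreal (v n) * u n x \<le> ennreal S"
        using sum_le_suminf[of "\<lambda>n. ennreal (v n) * u n x" "{n}"] S(1) by simp
      hence "ennreal (1 / v n) * (ennreal (v n) * u n x) \<le> ennreal (1 / v n) * ennreal S"
        by (intro mult_left_mono) auto
      moreover have "ennreal (1 / v n) * (ennreal (v n) * u n x) = u n x"
      proof -
        have "ennreal (1 / v n) * ennreal (v n) = ennreal (1 / v n * v n)"
          using v[of n] by (intro ennreal_mult[symmetric]) auto
        also have "1 / v n * v n = 1" using v[of n] by simp
        finally show ?thesis by (simp add: mult.assoc[symmetric])
      qed
      moreover have "ennreal (1 / v n) * ennreal S = ennreal (S * (real n + 1) ^ 2 * c n)"
      proof -
        have "1 / v n * S = S * (real n + 1) ^ 2 * c n" by (simp add: v_def divide_inverse)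
        thus ?thesis using v[of n] S(2) by (subst ennreal_mult[symmetric]) auto
      qed
      ultimately show ?thesis by simp
    qed
    thus ?case by blast
  qed
qed

section \<open>Powers of the adjacency operator\<close>

text \<open>
  The nonnegative measurable functions on the space, a class preserved by the adjacency operator.
  Nothing is required outside the space, where the operator is not controlled.
\<close>

definition nonneg_meas :: "nat \<Rightarrow> (rgraph set \<Rightarrow> real) \<Rightarrow> bool" where
  "nonneg_meas d f \<longleftrightarrow> f \<in> borel_measurable (Mborel d) \<and> (\<forall>x\<in>Mspace d. 0 \<le> f x)"

lemma nonneg_meas_adj: "nonneg_meas d f \<Longrightarrow> nonneg_meas d (adj f)"
  unfolding nonneg_meas_def using measurable_adj_nonneg[of f d] adj_nonneg[of _ d f] by blast

lemma nonneg_meas_adj_pow: "nonneg_meas d f \<Longrightarrow> nonneg_meas d ((adj ^^ n) f)"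
  by (induction n) (simp_all add: nonneg_meas_adj)

lemma nonneg_meas_const: "0 \<le> c \<Longrightarrow> nonneg_meas d (\<lambda>_. c)"
  by (simp add: nonneg_meas_def)

lemma nonneg_meas_mult: "nonneg_meas d f \<Longrightarrow> nonneg_meas d g \<Longrightarrow> nonneg_meas d (\<lambda>x. f x * g x)"
  by (auto simp: nonneg_meas_def)

lemma nonneg_measD:
  assumes "nonneg_meas d f"
  shows "f \<in> borel_measurable (Mborel d)" "x \<in> Mspace d \<Longrightarrow> 0 \<le> f x"
  using assms by (auto simp: nonneg_meas_def)

lemma adj_pow_cmult: "(adj ^^ n) (\<lambda>x. c * f x :: real) = (\<lambda>x. c * (adj ^^ n) f x)"
  by (induction n) (simp_all add: adj_cmult[abs_def])

lemma adj_pow_mono: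
  fixes f g :: "rgraph set \<Rightarrow> real"
  assumes "\<And>y. y \<in> Mspace d \<Longrightarrow> f y \<le> g y" "x \<in> Mspace d"
  shows "(adj ^^ n) f x \<le> (adj ^^ n) g x"
  using assms(2) by (induction n arbitrary: x) (auto intro: assms(1) adj_mono)

lemma adj_le_degree:
  fixes f :: "rgraph set \<Rightarrow> real"
  assumes "x \<in> Mspace d" "\<And>y. y \<in> Mspace d \<Longrightarrow> f y \<le> K" "0 \<le> K"
  shows "adj f x \<le> real d * K"
proof -
  have "adj f x \<le> real (card (neighbours (rep_graph x) (rep_root x))) * K"
    unfolding adj_def using rep_neighbour_in_Mspace[OF assms(1)] assms(2) by (intro sum_bounded_above) auto
  also have "\<dots> \<le> real d * K" using card_rep_neighbours[OF assms(1)] assms(3) by (intro mult_right_mono) auto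
  finally show ?thesis .
qed

lemma adj_pow_le:
  fixes f :: "rgraph set \<Rightarrow> real"
  assumes "\<And>y. y \<in> Mspace d \<Longrightarrow> f y \<le> K" "0 \<le> K" "x \<in> Mspace d"
  shows "(adj ^^ n) f x \<le> real d ^ n * K"
  using assms(3)
proof (induction n arbitrary: x)
  case (Suc n)
  thus ?case using adj_le_degree[of x d "(adj ^^ n) f" "real d ^ n * K"] assms(2) by (simp add: mult.assoc)
qed (use assms in auto)

lemma adj_square_le:
  fixes f :: "rgraph set \<Rightarrow> real"
  assumes "x \<in> Mspace d"
  shows "(adj f x)\<^sup>2 \<le> real d * adj (\<lambda>y. (f y)\<^sup>2) x"
proof -
  have "(adj f x)\<^sup>2 \<le> adj (\<lambda>y. (f y)\<^sup>2) x * real (card (neighbours (rep_graph x) (rep_root x)))"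
    unfolding adj_def by (rule sum_squared_le_sum_of_squares)
  also have "\<dots> \<le> adj (\<lambda>y. (f y)\<^sup>2) x * real d"
    using card_rep_neighbours[OF assms] adj_nonneg[OF assms, of "\<lambda>y. (f y)\<^sup>2"] by (intro mult_left_mono) auto
  finally show ?thesis by (simp add: mult.commute)
qed

lemma norm_adj_le: "cmod (adj f x) \<le> adj (\<lambda>y. cmod (f y)) x"
  unfolding adj_def by (rule norm_sum)

lemma of_real_adj: "complex_of_real (adj f x) = adj (\<lambda>y. of_real (f y)) x"
  by (simp add: adj_def)

lemma adj_Cauchy_Schwarz:
  fixes f g h :: "rgraph set \<Rightarrow> real"
  assumes "x \<in> Mspace d"
    and "\<And>y. y \<in> Mspace d \<Longrightarrow> 0 \<le> f y" "\<And>y. y \<in> Mspace d \<Longrightarrow> 0 \<le> g y" "\<And>y. y \<in> Mspace d \<Longrightarrow> 0 \<le> h y"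
    and "\<And>y. y \<in> Mspace d \<Longrightarrow> (f y)\<^sup>2 \<le> g y * h y"
  shows "(adj f x)\<^sup>2 \<le> adj g x * adj h x"
proof -
  let ?N = "neighbours (rep_graph x) (rep_root x)" and ?c = "rclass (rep_graph x)"
  have M: "?c w \<in> Mspace d" if "w \<in> ?N" for w using rep_neighbour_in_Mspace[OF assms(1) that] .
  have "f (?c w) \<le> sqrt (g (?c w)) * sqrt (h (?c w))" if "w \<in> ?N" for w
    using assms(5)[OF M[OF that]] by (simp add: real_sqrt_mult[symmetric] real_le_rsqrt)
  hence "adj f x \<le> (\<Sum>w\<in>?N. sqrt (g (?c w)) * sqrt (h (?c w)))"
    unfolding adj_def by (rule sum_mono)
  hence "(adj f x)\<^sup>2 \<le> (\<Sum>w\<in>?N. sqrt (g (?c w)) * sqrt (h (?c w)))\<^sup>2"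
    using adj_nonneg[OF assms(1,2)] by (intro power_mono) auto
  also have "\<dots> \<le> (\<Sum>w\<in>?N. (sqrt (g (?c w)))\<^sup>2) * (\<Sum>w\<in>?N. (sqrt (h (?c w)))\<^sup>2)"
    by (rule Cauchy_Schwarz_ineq_sum)
  also have "\<dots> = adj g x * adj h x"
    unfolding adj_def using assms(3,4) M by (intro arg_cong2[where f="(*)"] sum.cong) auto
  finally show ?thesis .
qed

lemma adj_pow_nonneg:
  fixes f :: "rgraph set \<Rightarrow> real"
  assumes "\<And>y. y \<in> Mspace d \<Longrightarrow> 0 \<le> f y" "x \<in> Mspace d"
  shows "0 \<le> (adj ^^ n) f x"
  using assms(2) by (induction n arbitrary: x) (auto intro: assms(1) adj_nonneg)

lemma adj_pow_Cauchy_Schwarz: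
  fixes f g h :: "rgraph set \<Rightarrow> real"
  assumes "\<And>y. y \<in> Mspace d \<Longrightarrow> 0 \<le> f y" "\<And>y. y \<in> Mspace d \<Longrightarrow> 0 \<le> g y" "\<And>y. y \<in> Mspace d \<Longrightarrow> 0 \<le> h y"
    and "\<And>y. y \<in> Mspace d \<Longrightarrow> (f y)\<^sup>2 \<le> g y * h y" and "x \<in> Mspace d"
  shows "((adj ^^ n) f x)\<^sup>2 \<le> (adj ^^ n) g x * (adj ^^ n) h x"
  using assms(5)
proof (induction n arbitrary: x)
  case (Suc n)
  have "(adj ((adj ^^ n) f) x)\<^sup>2 \<le> adj ((adj ^^ n) g) x * adj ((adj ^^ n) h) x"
    using assms(1-3) by (intro adj_Cauchy_Schwarz[OF Suc.prems] adj_pow_nonneg Suc.IH) auto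
  thus ?case by simp
qed (use assms in auto)

section \<open>The doubling inequality for walk counts\<close>

text \<open>
  The number of walks of length \<open>n\<close>, as a power of the adjacency operator applied to the constant 1;
  on the space it agrees with \<^const>\<open>walk_count\<close> by \<open>walk_count_eq\<close>.
\<close>

definition wcount :: "nat \<Rightarrow> rgraph set \<Rightarrow> real" where
  "wcount n = (adj ^^ n) (\<lambda>_. 1)"

lemma wcount_0 [simp]: "wcount 0 x = 1" by (simp add: wcount_def)
lemma wcount_Suc: "wcount (Suc n) = adj (wcount n)" by (simp add: wcount_def)
lemma adj_pow_wcount: "(adj ^^ n) (wcount k) = wcount (n + k)" by (simp add: wcount_def funpow_add)
lemma nonneg_meas_wcount: "nonneg_meas d (wcount n)"
  unfolding wcount_def by (intro nonneg_meas_adj_pow nonneg_meas_const) simp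
lemma wcount_nonneg: "x \<in> Mspace d \<Longrightarrow> 0 \<le> wcount n x"
  using nonneg_meas_wcount by (auto simp: nonneg_meas_def)
lemma wcount_le: "x \<in> Mspace d \<Longrightarrow> wcount n x \<le> real d ^ n"
  using adj_pow_le[of d "\<lambda>_. 1" 1 x n] by (simp add: wcount_def)

text \<open>
  The root has a neighbour.  In the connected graphs considered here the only exception is the
  graph with a single vertex.
\<close>

definition nonisolated :: "rgraph set \<Rightarrow> bool" where
  "nonisolated x \<longleftrightarrow> neighbours (rep_graph x) (rep_root x) \<noteq> {}"

lemma adj_isolated: "\<not> nonisolated x \<Longrightarrow> adj f x = 0"
  by (simp add: adj_def nonisolated_def)

lemma nonisolated_iff: "x \<in> Mspace d \<Longrightarrow> nonisolated x \<longleftrightarrow> 1 \<le> wcount 1 x"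
  using finite_rep_neighbours[of x d]
  by (simp add: wcount_def adj_def nonisolated_def Suc_le_eq card_gt_0_iff)

lemma nonisolated_neighbour:
  assumes x: "x \<in> Mspace d" and w: "w \<in> neighbours (rep_graph x) (rep_root x)"
  shows "nonisolated (rclass (rep_graph x) w)"
proof -
  let ?G = "rep_graph x"
  note G = rep_good[OF x]
  note sG = good_graphD(1)[OF G]
  have wv: "w \<in> verts ?G" using w neighbours_subset[OF sG] by auto
  have "rep_root x \<in> neighbours ?G w" using w sG by (auto simp: neighbours_def simple_graph_def sym_def)
  hence "1 \<le> card (neighbours ?G w)"
    using finite_neighbours[OF G wv] by (auto simp: Suc_le_eq card_gt_0_iff)
  hence "1 \<le> wcount 1 (rclass ?G w)" by (simp add: wcount_def adj_rclass[OF G wv])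
  thus ?thesis using nonisolated_iff[OF neighbour_in_Mspace[OF G w]] by simp
qed

lemma wcount_ge_1:
  assumes "x \<in> Mspace d" "nonisolated x"
  shows "1 \<le> wcount n x"
  using assms
proof (induction n arbitrary: x)
  case (Suc n)
  let ?N = "neighbours (rep_graph x) (rep_root x)"
  have "wcount 1 x \<le> wcount (Suc n) x"
    unfolding wcount_Suc One_nat_def adj_def
    using rep_neighbour_in_Mspace[OF Suc.prems(1)] nonisolated_neighbour[OF Suc.prems(1)] Suc.IH
    by (intro sum_mono) auto
  thus ?case using nonisolated_iff[OF Suc.prems(1)] Suc.prems(2) by linarith
qed auto

lemma wcount_mono:
  assumes "x \<in> Mspace d" "nonisolated x"
  shows "wcount n x \<le> wcount (Suc n) x"
  using assms
proof (induction n arbitrary: x)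
  case 0
  thus ?case using wcount_ge_1[of x d "Suc 0"] by simp
next
  case (Suc n)
  have "adj (wcount n) x \<le> adj (wcount (Suc n)) x"
    unfolding adj_def[of "wcount n"] adj_def[of "wcount (Suc n)"]
    using rep_neighbour_in_Mspace[OF Suc.prems(1)] nonisolated_neighbour[OF Suc.prems(1)] Suc.IH
    by (intro sum_mono) auto
  thus ?case unfolding wcount_Suc[of n] wcount_Suc[of "Suc n"] .
qed

lemma wcount_isolated: "\<not> nonisolated x \<Longrightarrow> wcount (Suc n) x = 0"
  by (simp add: wcount_Suc adj_isolated)

text \<open>
  The error factor of the doubling inequality below.  With \<open>1 / 0 = 0\<close> the definition makes sense for
  isolated roots as well.
\<close>

definition defect :: "nat \<Rightarrow> nat \<Rightarrow> rgraph set \<Rightarrow> real" where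
  "defect n j x = wcount j x * (adj ^^ n) (\<lambda>y. 1 / wcount (n + j) y) x"

lemma nonneg_meas_inverse_wcount: "nonneg_meas d (\<lambda>y. 1 / wcount k y)"
  using nonneg_meas_wcount[of d k] by (auto simp: nonneg_meas_def)

lemma nonneg_meas_defect: "nonneg_meas d (defect n j)"
  unfolding defect_def[abs_def]
  by (intro nonneg_meas_mult nonneg_meas_wcount nonneg_meas_adj_pow nonneg_meas_inverse_wcount)

text \<open>
  Write \<open>A\<close> for the adjacency operator and \<open>w\<close> for the walk counts.  Cauchy-Schwarz for the \<open>n\<close>-walks
  from the root gives \<open>(A\<^sup>n 1)\<^sup>2 \<le> A\<^sup>n w\<^bsub>n+j\<^esub> * A\<^sup>n (1 / w\<^bsub>n+j\<^esub>)\<close>, and \<open>A\<^sup>n w\<^bsub>n+j\<^esub> = w\<^bsub>2n+j\<^esub>\<close>.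
\<close>

lemma wcount_doubling:
  assumes x: "x \<in> Mspace d" "nonisolated x"
  shows "(wcount n x)\<^sup>2 * wcount j x \<le> defect n j x * wcount (2 * n + j) x"
proof -
  \<comment> \<open>\<open>f\<close> replaces the constant 1, for which \<open>f\<^sup>2 \<le> w * (1 / w)\<close> would fail where \<open>w = 0\<close>\<close>
  define f where "f y = (if wcount (n + j) y = 0 then 0 else 1 :: real)" for y
  have f: "(adj ^^ n) f x = wcount n x" if "x \<in> Mspace d" "nonisolated x" for n x
    using that
  proof (induction n arbitrary: x)
    case 0
    have "1 \<le> wcount (n + j) x" for n using wcount_ge_1[OF 0] .
    thus ?case by (metis f_def funpow_0 not_one_le_zero wcount_0)
  next
    case (Suc n)
    have "adj ((adj ^^ n) f) x = adj (wcount n) x"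
      unfolding adj_def[of "(adj ^^ n) f"] adj_def[of "wcount n"]
      using rep_neighbour_in_Mspace[OF Suc.prems(1)] nonisolated_neighbour[OF Suc.prems(1)] Suc.IH
      by (intro sum.cong) auto
    thus ?case by (simp add: wcount_Suc)
  qed
  have "((adj ^^ n) f x)\<^sup>2 \<le> (adj ^^ n) (wcount (n + j)) x * (adj ^^ n) (\<lambda>y. 1 / wcount (n + j) y) x"
    using x(1) by (intro adj_pow_Cauchy_Schwarz[where d=d]) (auto simp: f_def wcount_nonneg)
  hence "(wcount n x)\<^sup>2 \<le> wcount (2 * n + j) x * (adj ^^ n) (\<lambda>y. 1 / wcount (n + j) y) x"
    using f[OF x] by (simp add: adj_pow_wcount mult_2 add.assoc)
  hence "(wcount n x)\<^sup>2 * wcount j x \<le>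
      wcount (2 * n + j) x * (adj ^^ n) (\<lambda>y. 1 / wcount (n + j) y) x * wcount j x"
    using wcount_nonneg[OF x(1)] by (rule mult_right_mono)
  thus ?thesis by (simp add: defect_def mult.commute mult.left_commute)
qed

section \<open>Reversible laws\<close>

text \<open>
  A probability law on rooted graphs for which the adjacency operator is symmetric.
\<close>

locale reversible_law = prob_space \<eta> for \<eta> :: "rgraph set measure" +
  fixes d :: nat
  assumes sets_eq: "sets \<eta> = sets (Mborel d)"
    and transport: "\<And>f g :: rgraph set \<Rightarrow> ennreal. f \<in> borel_measurable (Mborel d) \<Longrightarrow>
      g \<in> borel_measurable (Mborel d) \<Longrightarrow>
      (\<integral>\<^sup>+x. f x * adj g x \<partial>\<eta>) = (\<integral>\<^sup>+x. adj f x * g x \<partial>\<eta>)"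
begin

lemma space_eq: "space \<eta> = Mspace d"
  using sets_eq_imp_space_eq[OF sets_eq] by simp

lemma borel_eq: "borel_measurable \<eta> = borel_measurable (Mborel d)"
  by (rule measurable_cong_sets[OF sets_eq]) simp

lemma AE_Mspace: "AE x in \<eta>. x \<in> Mspace d"
  using AE_space[of \<eta>] unfolding space_eq .

lemma transport_nonneg:
  assumes f: "nonneg_meas d f" and g: "nonneg_meas d g"
  shows "(\<integral>\<^sup>+x. ennreal (f x * adj g x) \<partial>\<eta>) = (\<integral>\<^sup>+x. ennreal (adj f x * g x) \<partial>\<eta>)"
proof -
  have "(\<integral>\<^sup>+x. ennreal (f x * adj g x) \<partial>\<eta>) = (\<integral>\<^sup>+x. ennreal (f x) * adj (\<lambda>y. ennreal (g y)) x \<partial>\<eta>)"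
    using nonneg_measD(2)[OF f] nonneg_measD(2)[OF g] nonneg_measD(2)[OF nonneg_meas_adj[OF g]]
    by (intro nn_integral_cong) (simp add: space_eq adj_ennreal ennreal_mult)
  also have "\<dots> = (\<integral>\<^sup>+x. adj (\<lambda>y. ennreal (f y)) x * ennreal (g x) \<partial>\<eta>)"
    using nonneg_measD(1)[OF f] nonneg_measD(1)[OF g] by (intro transport) auto
  also have "\<dots> = (\<integral>\<^sup>+x. ennreal (adj f x * g x) \<partial>\<eta>)"
    using nonneg_measD(2)[OF f] nonneg_measD(2)[OF g] nonneg_measD(2)[OF nonneg_meas_adj[OF f]]
    by (intro nn_integral_cong) (simp add: space_eq adj_ennreal ennreal_mult)
  finally show ?thesis .
qed

lemma transport_pow:
  assumes f: "nonneg_meas d f" and g: "nonneg_meas d g"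
  shows "(\<integral>\<^sup>+x. ennreal (f x * (adj ^^ n) g x) \<partial>\<eta>) = (\<integral>\<^sup>+x. ennreal ((adj ^^ n) f x * g x) \<partial>\<eta>)"
  using f
proof (induction n arbitrary: f)
  case (Suc n)
  have "(\<integral>\<^sup>+x. ennreal (f x * (adj ^^ Suc n) g x) \<partial>\<eta>) = (\<integral>\<^sup>+x. ennreal (adj f x * (adj ^^ n) g x) \<partial>\<eta>)"
    using transport_nonneg[OF Suc.prems nonneg_meas_adj_pow[OF g, of n]] by simp
  also have "\<dots> = (\<integral>\<^sup>+x. ennreal ((adj ^^ n) (adj f) x * g x) \<partial>\<eta>)"
    using Suc.IH[OF nonneg_meas_adj[OF Suc.prems]] .
  finally show ?case by (simp add: funpow_swap1)
qed simp

lemma integral_nonneg_meas: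
  assumes "nonneg_meas d f"
  shows "integral\<^sup>L \<eta> f = enn2real (\<integral>\<^sup>+x. ennreal (f x) \<partial>\<eta>)"
  using assms AE_Mspace unfolding nonneg_meas_def borel_eq[symmetric]
  by (intro integral_eq_nn_integral) (auto elim: eventually_mono)

lemma transport_pow_integral:
  assumes f: "nonneg_meas d f" and g: "nonneg_meas d g"
  shows "(\<integral>x. f x * (adj ^^ n) g x \<partial>\<eta>) = (\<integral>x. (adj ^^ n) f x * g x \<partial>\<eta>)"
  using transport_pow[OF assms, of n]
  by (simp add: integral_nonneg_meas nonneg_meas_mult nonneg_meas_adj_pow f g)

lemma integrable_bounded:
  assumes "nonneg_meas d f" "\<And>x. x \<in> Mspace d \<Longrightarrow> f x \<le> K"
  shows "integrable \<eta> f"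
proof (rule integrable_const_bound[of _ K])
  show "AE x in \<eta>. norm (f x) \<le> K"
    using AE_Mspace by eventually_elim (use assms in \<open>auto simp: nonneg_meas_def\<close>)
  show "f \<in> borel_measurable \<eta>" using assms(1) by (simp add: borel_eq nonneg_meas_def)
qed

text \<open>
  By symmetry the expectation of \<open>w\<^bsub>j\<^esub> * A\<^sup>n (1 / w\<^bsub>n+j\<^esub>)\<close> is that of \<open>A\<^sup>n w\<^bsub>j\<^esub> / w\<^bsub>n+j\<^esub>\<close>, which is 1 or 0.
\<close>

lemma nn_integral_defect_le: "(\<integral>\<^sup>+x. ennreal (defect n j x) \<partial>\<eta>) \<le> 1"
proof -
  have "(\<integral>\<^sup>+x. ennreal (defect n j x) \<partial>\<eta>) = (\<integral>\<^sup>+x. ennreal (wcount (n + j) x * (1 / wcount (n + j) x)) \<partial>\<eta>)"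
    unfolding defect_def
    using transport_pow[OF nonneg_meas_wcount[of d j] nonneg_meas_inverse_wcount[of d "n + j"], of n]
    by (simp add: adj_pow_wcount)
  also have "\<dots> \<le> (\<integral>\<^sup>+x. 1 \<partial>\<eta>)" by (intro nn_integral_mono) auto
  also have "\<dots> = 1" by (simp add: emeasure_space_1)
  finally show ?thesis .
qed

lemma AE_defect_bound:
  "AE x in \<eta>. \<exists>C. \<forall>n j. j \<le> n \<longrightarrow> defect n j x \<le> C * (real n + 1) ^ 3"
proof -
  define u where "u n x = (\<Sum>j\<le>n. ennreal (defect n j x))" for n x
  have m: "(\<lambda>x. ennreal (defect n j x)) \<in> borel_measurable \<eta>" for n j
    using nonneg_measD(1)[OF nonneg_meas_defect, of n j d] by (simp add: borel_eq)
  have "AE x in \<eta>. \<exists>C::real. \<forall>n. u n x \<le> ennreal (C * (real n + 1) ^ 2 * (real n + 1))"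
  proof (rule AE_quadratic_bound)
    fix n
    show "u n \<in> borel_measurable \<eta>" unfolding u_def[abs_def] by (intro borel_measurable_sum m)
    have "(\<integral>\<^sup>+x. u n x \<partial>\<eta>) = (\<Sum>j\<le>n. \<integral>\<^sup>+x. ennreal (defect n j x) \<partial>\<eta>)"
      unfolding u_def by (intro nn_integral_sum m)
    also have "\<dots> \<le> (\<Sum>j\<le>n. 1)" by (intro sum_mono nn_integral_defect_le)
    also have "\<dots> = ennreal (real n + 1)" by (simp add: ennreal_of_nat_eq_real_of_nat add.commute)
    finally show "(\<integral>\<^sup>+x. u n x \<partial>\<eta>) \<le> ennreal (real n + 1)" .
  qed auto
  with AE_Mspace show ?thesis
  proof eventually_elim
    case (elim x)
    then obtain C :: real where C: "\<And>n. u n x \<le> ennreal (C * (real n + 1) ^ 2 * (real n + 1))" by blast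
    have "defect n j x \<le> max C 0 * (real n + 1) ^ 3" if "j \<le> n" for n j
    proof -
      have "ennreal (defect n j x) \<le> u n x"
        unfolding u_def using that by (intro member_le_sum) auto
      also have "\<dots> \<le> ennreal (C * (real n + 1) ^ 2 * (real n + 1))" by (rule C)
      also have "\<dots> \<le> ennreal (max C 0 * (real n + 1) ^ 3)"
        by (intro ennreal_leI) (auto simp: power2_eq_square power3_eq_cube mult.assoc intro!: mult_right_mono)
      finally show ?thesis by (subst (asm) ennreal_le_iff) auto
    qed
    thus ?case by blast
  qed
qed

lemma AE_growth_rate:
  "AE x in \<eta>. nonisolated x \<longrightarrow> (\<exists>L. (\<lambda>n. ln (wcount n x) / real n) \<longlonglongrightarrow> L)"
  using AE_defect_bound AE_Mspace
proof eventually_elim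
  case (elim x)
  then obtain C where C: "\<And>n j. j \<le> n \<Longrightarrow> defect n j x \<le> C * (real n + 1) ^ 3" by blast
  note x = \<open>x \<in> Mspace d\<close>
  show ?case
  proof
    assume ni: "nonisolated x"
    show "\<exists>L. (\<lambda>n. ln (wcount n x) / real n) \<longlonglongrightarrow> L"
    proof (rule growth_rate_converges)
      show "1 \<le> wcount n x" "wcount n x \<le> wcount (Suc n) x" for n
        using wcount_ge_1[OF x ni] wcount_mono[OF x ni] by auto
      have "1 \<le> wcount 1 x" using wcount_ge_1[OF x ni] .
      also have "\<dots> \<le> real d" using wcount_le[OF x, of 1] by simp
      finally show "1 \<le> real d" .
      show "wcount n x \<le> real d ^ n" for n using wcount_le[OF x] .
      fix n j :: nat assume "j \<le> n"
      have "(wcount n x)\<^sup>2 * wcount j x \<le> defect n j x * wcount (2 * n + j) x"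
        by (rule wcount_doubling[OF x ni])
      also have "\<dots> \<le> C * (real n + 1) ^ 3 * wcount (2 * n + j) x"
        using C[OF \<open>j \<le> n\<close>] wcount_nonneg[OF x] by (intro mult_right_mono) auto
      finally show "(wcount n x)\<^sup>2 * wcount j x \<le> C * (real n + 1) ^ 3 * wcount (2 * n + j) x" .
    qed
  qed
qed


section \<open>The adjacency operator on square integrable functions\<close>

text \<open>
  Real square integrable functions.
\<close>

definition sqint :: "(rgraph set \<Rightarrow> real) \<Rightarrow> bool" where
  "sqint f \<longleftrightarrow> f \<in> borel_measurable (Mborel d) \<and> integrable \<eta> (\<lambda>x. (f x)\<^sup>2)"

lemma sqintD:
  assumes "sqint f"
  shows "f \<in> borel_measurable (Mborel d)" "integrable \<eta> (\<lambda>x. (f x)\<^sup>2)"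
  using assms by (auto simp: sqint_def)

lemma sqint_mult_integrable:
  assumes "sqint f" "sqint g"
  shows "integrable \<eta> (\<lambda>x. f x * g x)"
proof (rule Bochner_Integration.integrable_bound)
  show "integrable \<eta> (\<lambda>x. (f x)\<^sup>2 + (g x)\<^sup>2)" using assms by (auto simp: sqint_def)
  show "(\<lambda>x. f x * g x) \<in> borel_measurable \<eta>" using assms by (auto simp: sqint_def borel_eq)
  have "\<bar>a * b\<bar> \<le> a\<^sup>2 + b\<^sup>2" for a b :: real
  proof -
    have "0 \<le> (\<bar>a\<bar> - \<bar>b\<bar>)\<^sup>2" by simp
    hence "2 * (\<bar>a\<bar> * \<bar>b\<bar>) \<le> a\<^sup>2 + b\<^sup>2" by (simp add: power2_diff)
    moreover have "0 \<le> \<bar>a\<bar> * \<bar>b\<bar>" by simp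
    ultimately show ?thesis unfolding abs_mult by linarith
  qed
  thus "AE x in \<eta>. norm (f x * g x) \<le> norm ((f x)\<^sup>2 + (g x)\<^sup>2)" by auto
qed

lemma sqint_bounded:
  assumes "nonneg_meas d f" "\<And>x. x \<in> Mspace d \<Longrightarrow> f x \<le> K"
  shows "sqint f"
proof -
  have "integrable \<eta> (\<lambda>x. (f x)\<^sup>2)"
  proof (rule integrable_bounded)
    show "nonneg_meas d (\<lambda>x. (f x)\<^sup>2)" using assms(1) by (auto simp: nonneg_meas_def)
    show "(f x)\<^sup>2 \<le> K\<^sup>2" if "x \<in> Mspace d" for x
      using assms(2)[OF that] nonneg_measD(2)[OF assms(1) that] by (intro power_mono) auto
  qed
  thus ?thesis using nonneg_measD(1)[OF assms(1)] by (simp add: sqint_def)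
qed

lemma nn_integral_adj_square_le:
  fixes f :: "rgraph set \<Rightarrow> real"
  assumes f: "f \<in> borel_measurable (Mborel d)"
  shows "(\<integral>\<^sup>+x. ennreal ((adj f x)\<^sup>2) \<partial>\<eta>) \<le> ennreal ((real d)\<^sup>2) * (\<integral>\<^sup>+x. ennreal ((f x)\<^sup>2) \<partial>\<eta>)"
proof -
  have f2: "nonneg_meas d (\<lambda>x. (f x)\<^sup>2)" using f by (simp add: nonneg_meas_def)
  have "(\<integral>\<^sup>+x. ennreal ((adj f x)\<^sup>2) \<partial>\<eta>) \<le> (\<integral>\<^sup>+x. ennreal (real d * adj (\<lambda>y. (f y)\<^sup>2) x) \<partial>\<eta>)"
    by (intro nn_integral_mono ennreal_leI adj_square_le) (simp add: space_eq)
  also have "\<dots> = (\<integral>\<^sup>+x. ennreal (adj (\<lambda>_. real d) x * (f x)\<^sup>2) \<partial>\<eta>)"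
    by (rule transport_nonneg[OF nonneg_meas_const f2]) simp
  also have "\<dots> \<le> (\<integral>\<^sup>+x. ennreal ((real d)\<^sup>2) * ennreal ((f x)\<^sup>2) \<partial>\<eta>)"
  proof (rule nn_integral_mono)
    fix x assume "x \<in> space \<eta>"
    hence "adj (\<lambda>_. real d) x * (f x)\<^sup>2 \<le> (real d)\<^sup>2 * (f x)\<^sup>2"
      using adj_le_degree[of x d "\<lambda>_. real d" "real d"]
      by (intro mult_right_mono) (auto simp: space_eq power2_eq_square)
    thus "ennreal (adj (\<lambda>_. real d) x * (f x)\<^sup>2) \<le> ennreal ((real d)\<^sup>2) * ennreal ((f x)\<^sup>2)"
      by (simp add: ennreal_mult[symmetric] ennreal_leI)
  qed
  also have "\<dots> = ennreal ((real d)\<^sup>2) * (\<integral>\<^sup>+x. ennreal ((f x)\<^sup>2) \<partial>\<eta>)"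
    using f by (intro nn_integral_cmult) (simp add: borel_eq)
  finally show ?thesis .
qed

lemma sqint_adj:
  assumes "sqint f" shows "sqint (adj f)"
  unfolding sqint_def
proof
  note f = sqintD(1)[OF assms]
  show m: "adj f \<in> borel_measurable (Mborel d)" by (rule measurable_adj_real[OF f])
  show "integrable \<eta> (\<lambda>x. (adj f x)\<^sup>2)"
  proof (rule integrableI_nonneg)
    show "(\<lambda>x. (adj f x)\<^sup>2) \<in> borel_measurable \<eta>" using m by (simp add: borel_eq)
    have "(\<integral>\<^sup>+x. ennreal ((f x)\<^sup>2) \<partial>\<eta>) = ennreal (\<integral>x. (f x)\<^sup>2 \<partial>\<eta>)"
      using sqintD(2)[OF assms] by (intro nn_integral_eq_integral) auto
    thus "(\<integral>\<^sup>+x. ennreal ((adj f x)\<^sup>2) \<partial>\<eta>) < \<infinity>"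
      using nn_integral_adj_square_le[OF f] by (simp add: ennreal_mult[symmetric] order_le_less_trans)
  qed auto
qed

lemma integral_adj_square_le:
  assumes "sqint f"
  shows "(\<integral>x. (adj f x)\<^sup>2 \<partial>\<eta>) \<le> (real d)\<^sup>2 * (\<integral>x. (f x)\<^sup>2 \<partial>\<eta>)"
proof -
  have "ennreal (\<integral>x. (adj f x)\<^sup>2 \<partial>\<eta>) = (\<integral>\<^sup>+x. ennreal ((adj f x)\<^sup>2) \<partial>\<eta>)"
    using sqintD(2)[OF sqint_adj[OF assms]] by (intro nn_integral_eq_integral[symmetric]) auto
  also have "\<dots> \<le> ennreal ((real d)\<^sup>2) * (\<integral>\<^sup>+x. ennreal ((f x)\<^sup>2) \<partial>\<eta>)"
    by (rule nn_integral_adj_square_le[OF sqintD(1)[OF assms]])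
  also have "(\<integral>\<^sup>+x. ennreal ((f x)\<^sup>2) \<partial>\<eta>) = ennreal (\<integral>x. (f x)\<^sup>2 \<partial>\<eta>)"
    using sqintD(2)[OF assms] by (intro nn_integral_eq_integral) auto
  finally show ?thesis by (simp add: ennreal_mult[symmetric])
qed

text \<open>
  An almost sure property of the rooted graph also holds almost surely at all neighbours of the
  root.
\<close>

lemma AE_neighbours:
  assumes P: "AE x in \<eta>. P x" and m: "{x \<in> Mspace d. \<not> P x} \<in> sets (Mborel d)"
  shows "AE x in \<eta>. \<forall>w\<in>neighbours (rep_graph x) (rep_root x). P (rclass (rep_graph x) w)"
proof -
  let ?N = "{x \<in> Mspace d. \<not> P x}"
  have ind: "nonneg_meas d (indicator ?N)" using m by (simp add: nonneg_meas_def)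
  have "(\<integral>\<^sup>+x. ennreal (1 * adj (indicator ?N) x) \<partial>\<eta>) = (\<integral>\<^sup>+x. ennreal (adj (\<lambda>_. 1) x * indicator ?N x) \<partial>\<eta>)"
    by (rule transport_nonneg[OF nonneg_meas_const ind]) simp
  also have "\<dots> = (\<integral>\<^sup>+x. 0 \<partial>\<eta>)"
    using P by (intro nn_integral_cong_AE) (auto elim!: eventually_mono simp: indicator_def)
  finally have "(\<integral>\<^sup>+x. ennreal (adj (indicator ?N) x) \<partial>\<eta>) = 0" by simp
  moreover have "(\<lambda>x. ennreal (adj (indicator ?N) x)) \<in> borel_measurable \<eta>"
    using nonneg_measD(1)[OF nonneg_meas_adj[OF ind]] by (simp add: borel_eq)
  ultimately have "AE x in \<eta>. ennreal (adj (indicator ?N) x) = 0" by (simp add: nn_integral_0_iff_AE)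
  with AE_Mspace show ?thesis
  proof eventually_elim
    case (elim x)
    let ?G = "rep_graph x"
    have "adj (indicator ?N) x = (0::real)"
      using elim adj_nonneg[of x d "indicator ?N :: _ \<Rightarrow> real"] by (simp add: ennreal_eq_0_iff)
    hence "\<forall>w\<in>neighbours ?G (rep_root x). indicator ?N (rclass ?G w) = (0::real)"
      unfolding adj_def using finite_rep_neighbours[of x d] elim by (subst (asm) sum_nonneg_eq_0_iff) auto
    thus ?case using rep_neighbour_in_Mspace[of x d] elim by (auto simp: indicator_def split: if_splits)
  qed
qed

lemma AE_adj_cong:
  fixes f g :: "rgraph set \<Rightarrow> complex"
  assumes "AE x in \<eta>. f x = g x" "f \<in> borel_measurable (Mborel d)" "g \<in> borel_measurable (Mborel d)"
  shows "AE x in \<eta>. adj f x = adj g x"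
proof -
  have "{x \<in> space (Mborel d). f x \<noteq> g x} \<in> sets (Mborel d)" using assms(2,3) by measurable
  hence "AE x in \<eta>. \<forall>w\<in>neighbours (rep_graph x) (rep_root x). f (rclass (rep_graph x) w) = g (rclass (rep_graph x) w)"
    using assms(1) by (intro AE_neighbours) auto
  thus ?thesis by eventually_elim (auto simp: adj_def)
qed

subsection \<open>Self-adjointness\<close>

lemma selfadjoint_nonneg:
  assumes "nonneg_meas d f" "nonneg_meas d g"
  shows "(\<integral>x. adj f x * g x \<partial>\<eta>) = (\<integral>x. f x * adj g x \<partial>\<eta>)"
  using transport_pow_integral[OF assms, of 1] by simp

lemma sqint_parts:
  assumes "sqint f"
  shows "sqint (\<lambda>x. max 0 (f x))" "sqint (\<lambda>x. max 0 (- f x))"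
proof -
  have "integrable \<eta> (\<lambda>x. (max 0 (f x))\<^sup>2)" "integrable \<eta> (\<lambda>x. (max 0 (- f x))\<^sup>2)"
    by (rule Bochner_Integration.integrable_bound[OF sqintD(2)[OF assms]];
        use sqintD(1)[OF assms] in \<open>auto simp: borel_eq max_def\<close>)+
  thus "sqint (\<lambda>x. max 0 (f x))" "sqint (\<lambda>x. max 0 (- f x))"
    using sqintD(1)[OF assms] by (auto simp: sqint_def)
qed

text \<open>
  Self-adjointness is extended from nonnegative to real functions by splitting both arguments into
  positive and negative parts, and then to complex functions by real and imaginary parts.
\<close>

lemma selfadjoint_diff:
  assumes f: "sqint f1" "sqint f2" and g: "sqint g"
    and eq: "(\<integral>x. adj f1 x * g x \<partial>\<eta>) = (\<integral>x. f1 x * adj g x \<partial>\<eta>)"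
      "(\<integral>x. adj f2 x * g x \<partial>\<eta>) = (\<integral>x. f2 x * adj g x \<partial>\<eta>)"
  shows "(\<integral>x. adj (\<lambda>y. f1 y - f2 y) x * g x \<partial>\<eta>) = (\<integral>x. (f1 x - f2 x) * adj g x \<partial>\<eta>)"
  using sqint_mult_integrable[OF f(1) sqint_adj[OF g]] sqint_mult_integrable[OF f(2) sqint_adj[OF g]]
    sqint_mult_integrable[OF sqint_adj[OF f(1)] g] sqint_mult_integrable[OF sqint_adj[OF f(2)] g] eq
  by (simp add: adj_diff left_diff_distrib)

lemma selfadjoint_real:
  assumes f: "sqint f" and g: "sqint g"
  shows "(\<integral>x. adj f x * g x \<partial>\<eta>) = (\<integral>x. f x * adj g x \<partial>\<eta>)"
proof -
  have parts: "max 0 (a::real) - max 0 (- a) = a" for a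
    by (auto simp: max_def)
  have nn: "nonneg_meas d (\<lambda>x. max 0 (h x))" "nonneg_meas d (\<lambda>x. max 0 (- h x))" if "sqint h" for h
    using sqintD(1)[OF that] by (auto simp: nonneg_meas_def)
  have half: "(\<integral>x. adj f x * h x \<partial>\<eta>) = (\<integral>x. f x * adj h x \<partial>\<eta>)" if "sqint h" "nonneg_meas d h" for h
    using selfadjoint_diff[OF sqint_parts[OF f] that(1) selfadjoint_nonneg[OF nn(1)[OF f] that(2)]
        selfadjoint_nonneg[OF nn(2)[OF f] that(2)]] unfolding parts .
  have half': "(\<integral>x. adj h x * f x \<partial>\<eta>) = (\<integral>x. h x * adj f x \<partial>\<eta>)" if "sqint h" "nonneg_meas d h" for h
    using half[OF that] by (simp add: mult.commute)
  have "(\<integral>x. adj g x * f x \<partial>\<eta>) = (\<integral>x. g x * adj f x \<partial>\<eta>)"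
    using selfadjoint_diff[OF sqint_parts[OF g] f half'[OF sqint_parts(1)[OF g] nn(1)[OF g]]
        half'[OF sqint_parts(2)[OF g] nn(2)[OF g]]] unfolding parts .
  thus ?thesis by (simp add: mult.commute)
qed

lemma L2_iff: "f \<in> L2 \<eta> \<longleftrightarrow> f \<in> borel_measurable (Mborel d) \<and> sqint (\<lambda>x. cmod (f x))"
  by (auto simp: L2_def sqint_def borel_eq)

lemma sqint_mono:
  assumes "sqint g" "f \<in> borel_measurable (Mborel d)" "\<And>x. \<bar>f x\<bar> \<le> \<bar>g x\<bar>"
  shows "sqint f"
proof -
  have "integrable \<eta> (\<lambda>x. (f x)\<^sup>2)"
  proof (rule Bochner_Integration.integrable_bound[OF sqintD(2)[OF assms(1)]])
    show "(\<lambda>x. (f x)\<^sup>2) \<in> borel_measurable \<eta>" using assms(2) by (simp add: borel_eq)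
    show "AE x in \<eta>. norm ((f x)\<^sup>2) \<le> norm ((g x)\<^sup>2)" using assms(3) by (simp add: abs_le_square_iff)
  qed
  thus ?thesis using assms(2) by (simp add: sqint_def)
qed

lemma sqint_Re_Im:
  assumes "f \<in> L2 \<eta>"
  shows "sqint (\<lambda>x. Re (f x))" "sqint (\<lambda>x. Im (f x))"
  using assms unfolding L2_iff
  by (auto intro!: sqint_mono[of "\<lambda>x. cmod (f x)"] simp: abs_Re_le_cmod abs_Im_le_cmod)

lemma L2_adj:
  assumes "f \<in> L2 \<eta>"
  shows "adj f \<in> L2 \<eta>"
proof -
  have f: "f \<in> borel_measurable (Mborel d)" "sqint (\<lambda>x. cmod (f x))" using assms by (auto simp: L2_iff)
  have m: "adj f \<in> borel_measurable (Mborel d)" by (rule measurable_adj_complex[OF f(1)])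
  have "sqint (\<lambda>x. cmod (adj f x))"
    using sqint_adj[OF f(2)]
  proof (rule sqint_mono)
    show "\<bar>cmod (adj f x)\<bar> \<le> \<bar>adj (\<lambda>y. cmod (f y)) x\<bar>" for x 
      by (rule order_trans[OF _ abs_ge_self]) (simp add: norm_adj_le)
  qed (use m in simp)
  thus ?thesis using m by (simp add: L2_iff)
qed

lemma L2_mult_integrable:
  assumes "f \<in> L2 \<eta>" "g \<in> L2 \<eta>"
  shows "integrable \<eta> (\<lambda>x. f x * cnj (g x))"
proof (rule Bochner_Integration.integrable_bound)
  show "integrable \<eta> (\<lambda>x. cmod (f x) * cmod (g x))"
    using assms by (intro sqint_mult_integrable) (auto simp: L2_iff)
  show "(\<lambda>x. f x * cnj (g x)) \<in> borel_measurable \<eta>"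
    using assms by (auto simp: L2_iff borel_eq borel_measurable_complex_iff intro!: borel_measurable_times borel_measurable_diff)
qed (simp add: norm_mult)

theorem adj_selfadjoint: "L2_selfadjoint \<eta> adj"
  unfolding L2_selfadjoint_def L2_inner_def
proof (intro ballI complex_eqI)
  fix f g assume f: "f \<in> L2 \<eta>" and g: "g \<in> L2 \<eta>"
  note F = sqint_Re_Im[OF f] and G = sqint_Re_Im[OF g]
  note int = sqint_mult_integrable
  note AF = sqint_adj[OF F(1)] sqint_adj[OF F(2)] and AG = sqint_adj[OF G(1)] sqint_adj[OF G(2)]
  note eq = selfadjoint_real[OF F(1) G(1)] selfadjoint_real[OF F(1) G(2)]
    selfadjoint_real[OF F(2) G(1)] selfadjoint_real[OF F(2) G(2)]
  show "Re (\<integral>x. adj f x * cnj (g x) \<partial>\<eta>) = Re (\<integral>x. f x * cnj (adj g x) \<partial>\<eta>)"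
    using int[OF AF(1) G(1)] int[OF AF(2) G(2)] int[OF F(1) AG(1)] int[OF F(2) AG(2)] eq
    by (simp add: integral_Re[symmetric] L2_mult_integrable L2_adj f g adj_Re adj_Im)
  show "Im (\<integral>x. adj f x * cnj (g x) \<partial>\<eta>) = Im (\<integral>x. f x * cnj (adj g x) \<partial>\<eta>)"
    using int[OF AF(1) G(2)] int[OF AF(2) G(1)] int[OF F(1) AG(2)] int[OF F(2) AG(1)] eq
    by (simp add: integral_Im[symmetric] L2_mult_integrable L2_adj f g adj_Re adj_Im)
qed

subsection \<open>The operator norm\<close>

lemma L2_norm_adj_square_le:
  assumes f: "f \<in> L2 \<eta>"
  shows "(\<integral>x. (cmod (adj f x))\<^sup>2 \<partial>\<eta>) \<le> (\<integral>x. (adj (\<lambda>y. cmod (f y)) x)\<^sup>2 \<partial>\<eta>)"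
  using L2_adj[OF f] f norm_adj_le[of f]
  by (intro integral_mono) (auto simp: L2_iff sqint_def intro!: sqintD(2)[OF sqint_adj] power_mono)

lemma L2_norm_adj_le_degree:
  assumes f: "f \<in> L2 \<eta>"
  shows "L2_norm \<eta> (adj f) \<le> real d * L2_norm \<eta> f"
proof -
  have "(\<integral>x. (cmod (adj f x))\<^sup>2 \<partial>\<eta>) \<le> (real d)\<^sup>2 * (\<integral>x. (cmod (f x))\<^sup>2 \<partial>\<eta>)"
    using L2_norm_adj_square_le[OF f] integral_adj_square_le[of "\<lambda>x. cmod (f x)"] f by (auto simp: L2_iff)
  hence "sqrt (\<integral>x. (cmod (adj f x))\<^sup>2 \<partial>\<eta>) \<le> sqrt ((real d)\<^sup>2 * (\<integral>x. (cmod (f x))\<^sup>2 \<partial>\<eta>))" by simp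
  thus ?thesis by (simp add: L2_norm_def real_sqrt_mult)
qed

theorem adj_bounded_operator: "L2_bounded_operator \<eta> adj"
  unfolding L2_bounded_operator_def
proof (intro conjI ballI allI impI)
  show "\<exists>C. \<forall>f\<in>L2 \<eta>. L2_norm \<eta> (adj f) \<le> C * L2_norm \<eta> f" using L2_norm_adj_le_degree by blast
  fix f g assume "f \<in> L2 \<eta>" "g \<in> L2 \<eta>" "AE x in \<eta>. f x = g x"
  thus "AE x in \<eta>. adj f x = adj g x" by (intro AE_adj_cong) (auto simp: L2_iff)
qed (simp_all add: L2_adj adj_add adj_cmult)

text \<open>The operator norm of the adjacency operator.\<close>

definition \<rho> :: real where "\<rho> = L2_onorm \<eta> adj"

lemma L2_norm_nonneg: "0 \<le> L2_norm \<eta> f" by (simp add: L2_norm_def)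

lemma L2_zero: "(\<lambda>_. 0) \<in> L2 \<eta>" by (simp add: L2_def)

lemma L2_norm_ratio_le:
  assumes "L2_norm \<eta> (adj f) \<le> c * L2_norm \<eta> f" "0 \<le> c"
  shows "L2_norm \<eta> (adj f) / L2_norm \<eta> f \<le> c"
  using assms L2_norm_nonneg[of f] by (cases "L2_norm \<eta> f = 0") (auto simp: field_simps)

lemma L2_norm_ratio_bdd: "bdd_above ((\<lambda>f. L2_norm \<eta> (adj f) / L2_norm \<eta> f) ` L2 \<eta>)"
  by (rule bdd_aboveI2[of _ _ "real d"]) (intro L2_norm_ratio_le L2_norm_adj_le_degree; simp)

lemma onorm_nonneg: "0 \<le> \<rho>"
proof -
  have "L2_norm \<eta> (adj (\<lambda>_. 0)) / L2_norm \<eta> (\<lambda>_. 0) \<le> \<rho>"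
    unfolding \<rho>_def L2_onorm_def by (rule cSUP_upper[OF L2_zero L2_norm_ratio_bdd])
  thus ?thesis by (simp add: L2_norm_def)
qed

lemma L2_norm_adj_le:
  assumes f: "f \<in> L2 \<eta>"
  shows "L2_norm \<eta> (adj f) \<le> \<rho> * L2_norm \<eta> f"
proof (cases "L2_norm \<eta> f = 0")
  case True
  thus ?thesis using L2_norm_adj_le_degree[OF f] by simp
next
  case False
  have "L2_norm \<eta> (adj f) / L2_norm \<eta> f \<le> \<rho>"
    unfolding \<rho>_def L2_onorm_def by (rule cSUP_upper[OF f L2_norm_ratio_bdd])
  thus ?thesis using False L2_norm_nonneg[of f] by (simp add: field_simps)
qed

text \<open>
  Since \<open>\<bar>A f\<bar> \<le> A \<bar>f\<bar>\<close>, the norm is determined by nonnegative functions.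
\<close>

lemma onorm_le:
  assumes "0 \<le> c" and le: "\<And>f. sqint f \<Longrightarrow> nonneg_meas d f \<Longrightarrow> (\<integral>x. (adj f x)\<^sup>2 \<partial>\<eta>) \<le> c\<^sup>2 * (\<integral>x. (f x)\<^sup>2 \<partial>\<eta>)"
  shows "\<rho> \<le> c"
  unfolding \<rho>_def L2_onorm_def
proof (rule cSUP_least)
  show "L2 \<eta> \<noteq> {}" using L2_zero by blast
  fix f assume f: "f \<in> L2 \<eta>"
  have "(\<integral>x. (cmod (adj f x))\<^sup>2 \<partial>\<eta>) \<le> c\<^sup>2 * (\<integral>x. (cmod (f x))\<^sup>2 \<partial>\<eta>)"
    using L2_norm_adj_square_le[OF f] le[of "\<lambda>x. cmod (f x)"] f by (auto simp: L2_iff nonneg_meas_def)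
  hence "sqrt (\<integral>x. (cmod (adj f x))\<^sup>2 \<partial>\<eta>) \<le> sqrt (c\<^sup>2 * (\<integral>x. (cmod (f x))\<^sup>2 \<partial>\<eta>))" by simp
  hence "L2_norm \<eta> (adj f) \<le> c * L2_norm \<eta> f" using assms(1) by (simp add: L2_norm_def real_sqrt_mult)
  thus "L2_norm \<eta> (adj f) / L2_norm \<eta> f \<le> c" using assms(1) by (rule L2_norm_ratio_le)
qed

lemma integral_adj_square_le_onorm:
  assumes "sqint f"
  shows "(\<integral>x. (adj f x)\<^sup>2 \<partial>\<eta>) \<le> \<rho>\<^sup>2 * (\<integral>x. (f x)\<^sup>2 \<partial>\<eta>)"
proof -
  let ?F = "\<lambda>x. complex_of_real (f x)"
  have "sqint (\<lambda>x. \<bar>f x\<bar>)" using sqintD(1)[OF assms] by (intro sqint_mono[OF assms]) auto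
  hence F: "?F \<in> L2 \<eta>" using sqintD(1)[OF assms] by (simp add: L2_iff)
  have aF: "adj ?F = (\<lambda>x. complex_of_real (adj f x))" by (simp add: of_real_adj fun_eq_iff)
  have "(L2_norm \<eta> (adj ?F))\<^sup>2 \<le> (\<rho> * L2_norm \<eta> ?F)\<^sup>2"
    using L2_norm_adj_le[OF F] L2_norm_nonneg by (intro power_mono) auto
  thus ?thesis unfolding aF by (simp add: L2_norm_def power_mult_distrib)
qed


section \<open>Walk growth and the operator norm\<close>

lemma sqint_wcount: "sqint (wcount n)"
  by (rule sqint_bounded[OF nonneg_meas_wcount wcount_le])

lemma integral_wcount_square_le: "(\<integral>x. (wcount n x)\<^sup>2 \<partial>\<eta>) \<le> \<rho> ^ (2 * n)"
proof (induction n)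
  case 0
  show ?case using prob_space by simp
next
  case (Suc n)
  have "(\<integral>x. (wcount (Suc n) x)\<^sup>2 \<partial>\<eta>) \<le> \<rho>\<^sup>2 * (\<integral>x. (wcount n x)\<^sup>2 \<partial>\<eta>)"
    unfolding wcount_Suc by (rule integral_adj_square_le_onorm[OF sqint_wcount])
  also have "\<dots> \<le> \<rho>\<^sup>2 * \<rho> ^ (2 * n)" using Suc by (intro mult_left_mono) auto
  finally show ?case by (simp add: power_add[symmetric])
qed

lemma AE_wcount_upper:
  assumes "0 < \<rho>"
  shows "AE x in \<eta>. \<exists>C. \<forall>n. (wcount n x)\<^sup>2 \<le> C * (real n + 1) ^ 2 * \<rho> ^ (2 * n)"
proof -
  have "AE x in \<eta>. \<exists>C::real. \<forall>n. ennreal ((wcount n x)\<^sup>2) \<le> ennreal (C * (real n + 1) ^ 2 * \<rho> ^ (2 * n))"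
  proof (rule AE_quadratic_bound)
    fix n
    show "(\<lambda>x. ennreal ((wcount n x)\<^sup>2)) \<in> borel_measurable \<eta>"
      using sqintD(1)[OF sqint_wcount, of n] by (simp add: borel_eq)
    show "0 < \<rho> ^ (2 * n)" using assms by simp
    have "(\<integral>\<^sup>+x. ennreal ((wcount n x)\<^sup>2) \<partial>\<eta>) = ennreal (\<integral>x. (wcount n x)\<^sup>2 \<partial>\<eta>)"
      by (intro nn_integral_eq_integral sqintD(2)[OF sqint_wcount]) auto
    thus "(\<integral>\<^sup>+x. ennreal ((wcount n x)\<^sup>2) \<partial>\<eta>) \<le> ennreal (\<rho> ^ (2 * n))"
      using integral_wcount_square_le by (simp add: ennreal_leI)
  qed
  thus ?thesis
  proof eventually_elim
    case (elim x)
    then obtain C :: real where C: "\<And>n. ennreal ((wcount n x)\<^sup>2) \<le> ennreal (C * (real n + 1) ^ 2 * \<rho> ^ (2 * n))"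
      by blast
    have "(wcount n x)\<^sup>2 \<le> max C 0 * (real n + 1) ^ 2 * \<rho> ^ (2 * n)" for n
    proof -
      have "ennreal ((wcount n x)\<^sup>2) \<le> ennreal (max C 0 * (real n + 1) ^ 2 * \<rho> ^ (2 * n))"
        by (rule order_trans[OF C]) (use assms in \<open>auto intro!: ennreal_leI mult_right_mono\<close>)
      thus ?thesis using assms by (subst (asm) ennreal_le_iff) auto
    qed
    thus ?case by blast
  qed
qed

lemma AE_wcount_zero:
  assumes "\<rho> = 0"
  shows "AE x in \<eta>. \<forall>n. wcount (Suc n) x = 0"
  unfolding AE_all_countable
proof
  fix n
  have "(\<integral>x. (wcount (Suc n) x)\<^sup>2 \<partial>\<eta>) \<le> 0"
    using integral_wcount_square_le[of "Suc n"] assms by simp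
  moreover have "0 \<le> (\<integral>x. (wcount (Suc n) x)\<^sup>2 \<partial>\<eta>)" by simp
  ultimately have "(\<integral>x. (wcount (Suc n) x)\<^sup>2 \<partial>\<eta>) = 0" by linarith
  hence "AE x in \<eta>. (wcount (Suc n) x)\<^sup>2 = 0"
    using sqintD(2)[OF sqint_wcount, of "Suc n"] by (subst (asm) integral_nonneg_eq_0_iff_AE) auto
  thus "AE x in \<eta>. wcount (Suc n) x = 0" by simp
qed

text \<open>
  For bounded \<open>g\<close> supported where walks grow at most like \<open>c ^ n\<close>, the squared norms \<open>b n\<close> of \<open>A\<^sup>n g\<close>
  grow at most like \<open>c ^ (2 * n)\<close>.  As \<open>b\<close> is log-convex, its first ratio \<open>b 1 / b 0\<close> is at most its
  exponential growth rate.
\<close>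

lemma adj_square_integral_le_localized:
  assumes g: "nonneg_meas d g" "\<And>x. x \<in> Mspace d \<Longrightarrow> g x \<le> K" and "0 \<le> K" "0 < c" "0 \<le> C"
    and growth: "\<And>x n. x \<in> Mspace d \<Longrightarrow> g x \<noteq> 0 \<Longrightarrow> wcount n x \<le> C * c ^ n"
  shows "(\<integral>x. (adj g x)\<^sup>2 \<partial>\<eta>) \<le> c\<^sup>2 * (\<integral>x. (g x)\<^sup>2 \<partial>\<eta>)"
proof (rule ccontr)
  assume contr: "\<not> ?thesis"
  define h where "h n = (adj ^^ n) g" for n
  define b where "b n = (\<integral>x. (h n x)\<^sup>2 \<partial>\<eta>)" for n
  have nn: "nonneg_meas d (h n)" for n unfolding h_def by (rule nonneg_meas_adj_pow[OF g(1)])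
  have hle: "h n x \<le> real d ^ n * K" if "x \<in> Mspace d" for n x
    unfolding h_def by (rule adj_pow_le[OF g(2) assms(3) that])
  have sq: "sqint (h n)" for n by (rule sqint_bounded[OF nn hle])
  have hSuc: "h (Suc n) = adj (h n)" for n by (simp add: h_def)
  have b0: "0 \<le> b n" for n by (simp add: b_def)
  \<comment> \<open>\<open>b n\<close> is the expectation of \<open>g\<close> times \<open>(adj ^^ (2 * n)) g\<close>\<close>
  have upper: "b n \<le> K * K * C * (c\<^sup>2) ^ n" for n
  proof -
    have "b n = (\<integral>x. (adj ^^ n) g x * h n x \<partial>\<eta>)" by (simp add: b_def h_def power2_eq_square)
    also have "\<dots> = (\<integral>x. g x * (adj ^^ n) (h n) x \<partial>\<eta>)"
      by (rule transport_pow_integral[OF g(1) nn, symmetric])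
    also have "(adj ^^ n) (h n) = h (2 * n)" by (simp add: h_def funpow_add mult_2)
    also have "(\<integral>x. g x * h (2 * n) x \<partial>\<eta>) \<le> K * K * C * (c\<^sup>2) ^ n"
    proof (rule integral_le_const)
      show "integrable \<eta> (\<lambda>x. g x * h (2 * n) x)"
        using sqint_mult_integrable[OF sq[of 0] sq] by (simp add: h_def)
      show "AE x in \<eta>. g x * h (2 * n) x \<le> K * K * C * (c\<^sup>2) ^ n"
        using AE_Mspace
      proof eventually_elim
        case (elim x)
        have g0: "0 \<le> g x" by (rule nonneg_measD(2)[OF g(1) elim])
        show ?case
        proof (cases "g x = 0")
          case False
          have "h (2 * n) x \<le> (adj ^^ (2 * n)) (\<lambda>_. K * 1) x"
            unfolding h_def using g(2) by (intro adj_pow_mono[OF _ elim]) auto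
          also have "\<dots> = K * wcount (2 * n) x" unfolding adj_pow_cmult wcount_def ..
          also have "\<dots> \<le> K * (C * c ^ (2 * n))" using growth[OF elim False] assms(3) by (rule mult_left_mono)
          finally have "g x * h (2 * n) x \<le> K * (K * (C * c ^ (2 * n)))"
            using g(2)[OF elim] g0 nonneg_measD(2)[OF nn elim] assms(3) by (intro mult_mono) auto
          thus ?thesis by (simp add: power_mult mult.assoc)
        qed (use assms in simp)
      qed
    qed
    finally show ?thesis .
  qed
  have convex: "0 \<le> b (Suc (Suc n)) - 2 * t * b (Suc n) + t\<^sup>2 * b n" for n t
  proof -
    have mid: "(\<integral>x. h (Suc (Suc n)) x * h n x \<partial>\<eta>) = b (Suc n)"
      unfolding b_def hSuc[of "Suc n"] selfadjoint_real[OF sq sq] hSuc[of n, symmetric]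
      by (simp add: power2_eq_square)
    have "0 \<le> (\<integral>x. (h (Suc (Suc n)) x - t * h n x)\<^sup>2 \<partial>\<eta>)" by simp
    also have "\<dots> = (\<integral>x. (h (Suc (Suc n)) x)\<^sup>2 - 2 * t * (h (Suc (Suc n)) x * h n x) + t\<^sup>2 * (h n x)\<^sup>2 \<partial>\<eta>)"
      by (simp add: power2_diff power_mult_distrib algebra_simps)
    also have "\<dots> = b (Suc (Suc n)) - 2 * t * b (Suc n) + t\<^sup>2 * b n"
      using sqintD(2)[OF sq] sqint_mult_integrable[OF sq sq] mid by (simp add: b_def)
    finally show ?thesis .
  qed
  have b1: "c\<^sup>2 * b 0 < b 1" using contr by (simp add: b_def h_def)
  have "0 < b 0"
  proof (rule ccontr)
    assume "\<not> 0 < b 0"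
    hence "b 0 = 0" using b0[of 0] by simp
    thus False using b1 integral_adj_square_le[OF sq[of 0]] by (simp add: b_def h_def)
  qed
  define t where "t = b 1 / b 0"
  have t1: "c\<^sup>2 < t" using b1 \<open>0 < b 0\<close> by (simp add: t_def pos_less_divide_eq)
  moreover have "0 < c\<^sup>2" using assms(4) by simp
  ultimately have t: "c\<^sup>2 < t" "0 < t" by linarith+
  \<comment> \<open>log-convexity in the form needed: the ratios of successive terms stay at least \<open>t\<close>\<close>
  have step: "t * b n \<le> b (Suc n)" for n
  proof (induction n)
    case 0 show ?case using \<open>0 < b 0\<close> by (simp add: t_def)
  next
    case (Suc n)
    have "t\<^sup>2 * b n \<le> t * b (Suc n)"
      using mult_left_mono[OF Suc, of t] t(2) by (simp add: power2_eq_square mult.assoc)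
    thus ?case using convex[of n t] by linarith
  qed
  have lower: "t ^ n * b 0 \<le> b n" for n
  proof (induction n)
    case (Suc n)
    have "t ^ Suc n * b 0 \<le> t * b n" using mult_left_mono[OF Suc, of t] t(2) by (simp add: mult.assoc)
    thus ?case using step[of n] by linarith
  qed simp
  have "1 < t / c\<^sup>2" using t(1) assms(4) by simp
  then obtain n where n: "K * K * C / b 0 < (t / c\<^sup>2) ^ n" using real_arch_pow by blast
  have "K * K * C * (c\<^sup>2) ^ n < t ^ n * b 0"
    using n \<open>0 < b 0\<close> assms(4) by (simp add: power_divide field_simps)
  thus False using lower[of n] upper[of n] by linarith
qed

text \<open>
  The number of walks is at most of order \<open>c ^ n\<close>.  The constant is a natural number to make the
  event a countable union.
\<close>

definition growth_le :: "real \<Rightarrow> rgraph set \<Rightarrow> bool" where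
  "growth_le c x \<longleftrightarrow> (\<exists>k::nat. \<forall>n. wcount n x \<le> real k * c ^ n)"

lemma growth_leI:
  assumes "\<And>n. wcount n x \<le> C * c ^ n" "0 < c"
  shows "growth_le c x"
proof -
  have "wcount n x \<le> real (nat \<lceil>C\<rceil>) * c ^ n" for n
    by (rule order_trans[OF assms(1)]) (use assms(2) in \<open>auto intro!: mult_right_mono real_nat_ceiling_ge\<close>)
  thus ?thesis unfolding growth_le_def by blast
qed

lemma sets_wcount_le: "{x \<in> Mspace d. \<forall>n. wcount n x \<le> real k * c ^ n} \<in> sets (Mborel d)"
proof -
  have [measurable]: "wcount n \<in> borel_measurable (Mborel d)" for n by (rule sqintD(1)[OF sqint_wcount])
  have "{x \<in> space (Mborel d). \<forall>n. wcount n x \<le> real k * c ^ n} \<in> sets (Mborel d)" by measurable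
  thus ?thesis by simp
qed

lemma sets_growth_le: "{x \<in> Mspace d. growth_le c x} \<in> sets (Mborel d)"
proof -
  have "{x \<in> Mspace d. growth_le c x} = (\<Union>k. {x \<in> Mspace d. \<forall>n. wcount n x \<le> real k * c ^ n})"
    by (auto simp: growth_le_def)
  thus ?thesis using sets_wcount_le by auto
qed

text \<open>
  If almost surely walks grow at most like \<open>c ^ n\<close>, then every square integrable function is
  approximated by bounded ones with localized support, and Fatou's lemma gives the bound on the norm.
\<close>

lemma onorm_le_growth:
  assumes c: "0 < c" and growth: "AE x in \<eta>. growth_le c x"
  shows "\<rho> \<le> c"
proof (rule onorm_le)
  show "0 \<le> c" using c by simp
  fix f assume f: "sqint f" "nonneg_meas d f"
  define S where "S k = {x \<in> Mspace d. \<forall>n. wcount n x \<le> real k * c ^ n}" for k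
  define g where "g k x = (if x \<in> S k then min (f x) (real k) else 0)" for k x
  have S: "S k \<in> sets (Mborel d)" for k unfolding S_def by (rule sets_wcount_le)
  have fm: "f \<in> borel_measurable (Mborel d)" by (rule sqintD(1)[OF f(1)])
  have g: "nonneg_meas d (g k)" for k
  proof -
    have "g k \<in> borel_measurable (Mborel d)" unfolding g_def[abs_def] using S fm by measurable
    thus ?thesis using nonneg_measD(2)[OF f(2)] by (auto simp: nonneg_meas_def g_def)
  qed
  have gk: "g k x \<le> real k" if "x \<in> Mspace d" for k x by (simp add: g_def)
  have gf: "g k x \<le> f x" if "x \<in> Mspace d" for k x using nonneg_measD(2)[OF f(2) that] by (simp add: g_def)
  have sq: "sqint (g k)" for k by (rule sqint_bounded[OF g gk])
  have int_f: "(\<integral>\<^sup>+x. ennreal ((f x)\<^sup>2) \<partial>\<eta>) = ennreal (\<integral>x. (f x)\<^sup>2 \<partial>\<eta>)"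
    using sqintD(2)[OF f(1)] by (intro nn_integral_eq_integral) auto
  have bound: "(\<integral>\<^sup>+x. ennreal ((adj (g k) x)\<^sup>2) \<partial>\<eta>) \<le> ennreal (c\<^sup>2 * (\<integral>x. (f x)\<^sup>2 \<partial>\<eta>))" for k
  proof -
    have "(\<integral>x. (adj (g k) x)\<^sup>2 \<partial>\<eta>) \<le> c\<^sup>2 * (\<integral>x. (g k x)\<^sup>2 \<partial>\<eta>)"
    proof (rule adj_square_integral_le_localized[where K="real k" and C="real k"])
      show "nonneg_meas d (g k)" by (rule g)
      show "wcount n x \<le> real k * c ^ n" if "x \<in> Mspace d" "g k x \<noteq> 0" for x n
        using that by (auto simp: g_def S_def split: if_splits)
    qed (use c gk in auto)
    also have "\<dots> \<le> c\<^sup>2 * (\<integral>x. (f x)\<^sup>2 \<partial>\<eta>)"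
      using gf nonneg_measD(2)[OF g]
      by (intro mult_left_mono integral_mono sqintD(2)[OF sq] sqintD(2)[OF f(1)] power_mono) (auto simp: space_eq)
    finally have "ennreal (\<integral>x. (adj (g k) x)\<^sup>2 \<partial>\<eta>) \<le> ennreal (c\<^sup>2 * (\<integral>x. (f x)\<^sup>2 \<partial>\<eta>))" by (rule ennreal_leI)
    moreover have "(\<integral>\<^sup>+x. ennreal ((adj (g k) x)\<^sup>2) \<partial>\<eta>) = ennreal (\<integral>x. (adj (g k) x)\<^sup>2 \<partial>\<eta>)"
      using sqintD(2)[OF sqint_adj[OF sq]] by (intro nn_integral_eq_integral) auto
    ultimately show ?thesis by simp
  qed
  have compl: "{x \<in> Mspace d. \<not> growth_le c x} = space (Mborel d) - {x \<in> Mspace d. growth_le c x}" by auto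
  have meas: "{x \<in> Mspace d. \<not> growth_le c x} \<in> sets (Mborel d)"
    unfolding compl by (rule sets.compl_sets[OF sets_growth_le])
  from AE_neighbours[OF growth meas] AE_Mspace
  have "AE x in \<eta>. ennreal ((adj f x)\<^sup>2) \<le> liminf (\<lambda>k. ennreal ((adj (g k) x)\<^sup>2))"
  proof eventually_elim
    case (elim x)
    let ?N = "neighbours (rep_graph x) (rep_root x)" and ?c = "rclass (rep_graph x)"
    have "eventually (\<lambda>k. \<forall>w\<in>?N. g k (?c w) = f (?c w)) sequentially"
    proof (intro eventually_ball_finite ballI)
      show "finite ?N" using finite_rep_neighbours elim(2) by blast
      fix w assume w: "w \<in> ?N"
      have y: "?c w \<in> Mspace d" using rep_neighbour_in_Mspace[OF elim(2) w] .
      obtain k0 where k0: "\<And>n. wcount n (?c w) \<le> real k0 * c ^ n" using elim(1) w by (auto simp: growth_le_def)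
      show "eventually (\<lambda>k. g k (?c w) = f (?c w)) sequentially"
        using eventually_ge_at_top[of "max k0 (nat \<lceil>f (?c w)\<rceil>)"]
      proof eventually_elim
        case (elim k)
        have "wcount n (?c w) \<le> real k * c ^ n" for n
          by (rule order_trans[OF k0]) (use elim c in \<open>auto intro!: mult_right_mono\<close>)
        moreover have "f (?c w) \<le> real k" using elim by linarith
        ultimately show ?case using y by (simp add: g_def S_def)
      qed
    qed
    hence "eventually (\<lambda>k. ennreal ((adj (g k) x)\<^sup>2) = ennreal ((adj f x)\<^sup>2)) sequentially"
      by eventually_elim (simp add: adj_def)
    hence "(\<lambda>k. ennreal ((adj (g k) x)\<^sup>2)) \<longlonglongrightarrow> ennreal ((adj f x)\<^sup>2)" by (rule tendsto_eventually)
    from lim_imp_Liminf[OF sequentially_bot this] show ?case by simp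
  qed
  hence "(\<integral>\<^sup>+x. ennreal ((adj f x)\<^sup>2) \<partial>\<eta>) \<le> (\<integral>\<^sup>+x. liminf (\<lambda>k. ennreal ((adj (g k) x)\<^sup>2)) \<partial>\<eta>)"
    by (rule nn_integral_mono_AE)
  also have "\<dots> \<le> liminf (\<lambda>k. \<integral>\<^sup>+x. ennreal ((adj (g k) x)\<^sup>2) \<partial>\<eta>)"
    using sqintD(1)[OF sqint_adj[OF sq]] by (intro nn_integral_liminf) (simp add: borel_eq)
  also have "\<dots> \<le> ennreal (c\<^sup>2 * (\<integral>x. (f x)\<^sup>2 \<partial>\<eta>))"
  proof -
    let ?C = "ennreal (c\<^sup>2 * (\<integral>x. (f x)\<^sup>2 \<partial>\<eta>))"
    have "liminf (\<lambda>k. \<integral>\<^sup>+x. ennreal ((adj (g k) x)\<^sup>2) \<partial>\<eta>) \<le> liminf (\<lambda>k. ?C)"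
      by (rule Liminf_mono[OF always_eventually]) (simp add: bound)
    thus ?thesis by (simp add: Liminf_const)
  qed
  also have "(\<integral>\<^sup>+x. ennreal ((adj f x)\<^sup>2) \<partial>\<eta>) = ennreal (\<integral>x. (adj f x)\<^sup>2 \<partial>\<eta>)"
    using sqintD(2)[OF sqint_adj[OF f(1)]] by (intro nn_integral_eq_integral) auto
  finally show "(\<integral>x. (adj f x)\<^sup>2 \<partial>\<eta>) \<le> c\<^sup>2 * (\<integral>x. (f x)\<^sup>2 \<partial>\<eta>)"
    by (subst (asm) ennreal_le_iff) auto
qed

text \<open>
  A walk from \<open>v\<close> extends to a walk from its neighbour \<open>u\<close> that is longer by one step, so the growth of
  walks is the same at all vertices of a connected graph.
\<close>

lemma growth_le_edge:
  assumes G: "good_graph d G" "(u, v) \<in> edges G" and "growth_le c (rclass G u)" "0 < c"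
  shows "growth_le c (rclass G v)"
proof -
  note sG = good_graphD(1)[OF G(1)]
  have uv: "u \<in> verts G" "v \<in> neighbours G u" using simple_graph_vertsD[OF sG G(2)] G(2) by (auto simp: neighbours_def)
  obtain k where k: "\<And>n. wcount n (rclass G u) \<le> real k * c ^ n" using assms(3) by (auto simp: growth_le_def)
  have "wcount n (rclass G v) \<le> (real k * c) * c ^ n" for n
  proof -
    have "wcount n (rclass G v) \<le> (\<Sum>w\<in>neighbours G u. wcount n (rclass G w))"
      using uv wcount_nonneg[OF neighbour_in_Mspace[OF G(1)]] finite_neighbours[OF G(1) uv(1)]
      by (intro member_le_sum) auto
    also have "\<dots> = wcount (Suc n) (rclass G u)" by (simp add: wcount_Suc adj_rclass[OF G(1) uv(1)])
    also have "\<dots> \<le> real k * c ^ Suc n" by (rule k)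
    finally show ?thesis by simp
  qed
  thus ?thesis using assms(4) by (rule growth_leI)
qed

lemma growth_le_rerooting:
  assumes "x \<in> Mspace d" "y \<in> Mspace d" "rerooting x y" "growth_le c x" "0 < c"
  shows "growth_le c y"
proof -
  obtain G r H s \<phi> where *: "(G, r) \<in> x" "(H, s) \<in> y" "graph_isom \<phi> G H"
    using assms(3) unfolding rerooting_def by blast
  note G = Mspace_memD[OF assms(1) *(1)] and H = Mspace_memD[OF assms(2) *(2)]
  note sG = good_graphD(1)[OF G(1)] and sH = good_graphD(1)[OF H(1)]
  define t where "t = inv_into (verts G) \<phi> s"
  have t: "t \<in> verts G" unfolding t_def by (rule graph_isom_verts[OF graph_isom_inv[OF *(3)] H(2)])
  have y: "y = rclass G t" unfolding H(3) t_def
    by (rule rclass_isom[OF sH sG graph_isom_inv[OF *(3)] H(2), symmetric])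
  have "(r, t) \<in> (edges G)\<^sup>*" using G t by (auto simp: good_graph_def connected_graph_def)
  hence "growth_le c (rclass G t)"
  proof induction
    case base thus ?case using assms(4) G(3) by simp
  next
    case (step u v) thus ?case using growth_le_edge[OF G(1)] assms(5) by blast
  qed
  thus ?thesis by (simp add: y)
qed

text \<open>
  By ergodicity the event that walks grow at most like \<open>c ^ n\<close> has probability 0 or 1, and probability
  1 would bound the norm by \<open>c\<close>.
\<close>

lemma ergodic_AE_growth:
  assumes erg: "ergodic d \<eta>" and c: "0 < c" "c < \<rho>"
  shows "AE x in \<eta>. \<not> growth_le c x"
proof -
  let ?S = "{x \<in> Mspace d. growth_le c x}"
  have inv: "\<forall>x\<in>?S. \<forall>y\<in>Mspace d. rerooting x y \<longrightarrow> y \<in> ?S"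
    using growth_le_rerooting[OF _ _ _ _ c(1)] by auto
  have "measure \<eta> ?S = 0 \<or> measure \<eta> ?S = 1"
    by (rule erg[unfolded ergodic_def, rule_format, OF sets_growth_le]) (use inv in blast)
  moreover have "measure \<eta> ?S \<noteq> 1"
  proof
    assume "measure \<eta> ?S = 1"
    from AE_prob_1[OF this] have "AE x in \<eta>. growth_le c x" by eventually_elim simp
    thus False using onorm_le_growth[OF c(1)] c(2) by simp
  qed
  ultimately have "?S \<in> null_sets \<eta>"
    using sets_growth_le[of c] by (auto simp: null_sets_def sets_eq emeasure_eq_measure)
  from AE_not_in[OF this] AE_Mspace show ?thesis by eventually_elim auto
qed

lemma walk_rate_nonisolated:
  assumes "x \<in> Mspace d" "nonisolated x"
  shows "walk_rate x n = ereal (ln (wcount n x) / real n)"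
  using walk_count_eq[OF assms(1), of n] wcount_ge_1[OF assms, of n]
  by (simp add: walk_rate_def elog_def wcount_def)

lemma walk_rate_zero:
  assumes "x \<in> Mspace d" "\<And>n. wcount (Suc n) x = 0"
  shows "walk_rate x \<longlonglongrightarrow> - \<infinity>"
proof (rule tendsto_eventually)
  show "eventually (\<lambda>n. walk_rate x n = - \<infinity>) sequentially"
    using eventually_ge_at_top[of 1]
  proof eventually_elim
    case (elim n)
    then obtain m where "n = Suc m" by (cases n) auto
    thus ?case using walk_count_eq[OF assms(1), of n] assms(2)[of m]
      by (simp add: walk_rate_def elog_def wcount_def)
  qed
qed

theorem AE_walk_rate_converges: "AE x in \<eta>. \<exists>L::ereal. L \<noteq> \<infinity> \<and> walk_rate x \<longlonglongrightarrow> L"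
  using AE_growth_rate AE_Mspace
proof eventually_elim
  case (elim x)
  show ?case
  proof (cases "nonisolated x")
    case True
    then obtain L where "(\<lambda>n. ln (wcount n x) / real n) \<longlonglongrightarrow> L" using elim by blast
    moreover have "walk_rate x = (\<lambda>n. ereal (ln (wcount n x) / real n))"
      using walk_rate_nonisolated[OF elim(2) True] by (simp add: fun_eq_iff)
    ultimately have "walk_rate x \<longlonglongrightarrow> ereal L" by simp
    thus ?thesis by (intro exI[of _ "ereal L"]) auto
  next
    case False
    hence "walk_rate x \<longlonglongrightarrow> - \<infinity>" using elim wcount_isolated by (intro walk_rate_zero) auto
    thus ?thesis by (intro exI[of _ "- \<infinity>"]) auto
  qed
qed

theorem ergodic_AE_walk_rate:
  assumes erg: "ergodic d \<eta>"
  shows "AE x in \<eta>. walk_rate x \<longlonglongrightarrow> elog \<rho>"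
proof (cases "\<rho> = 0")
  case True
  from AE_wcount_zero[OF True] AE_Mspace show ?thesis
    by eventually_elim (use True walk_rate_zero in \<open>auto simp: elog_def\<close>)
next
  case False
  hence \<rho>: "0 < \<rho>" using onorm_nonneg by simp
  \<comment> \<open>rates increasing to \<open>\<rho>\<close>; the shift by 2 keeps them positive\<close>
  define c where "c k = \<rho> * (1 - 1 / (real k + 2))" for k :: nat
  have c: "0 < c k" "c k < \<rho>" for k
    unfolding c_def using \<rho> by (auto simp: zero_less_mult_iff mult_less_cancel_left1)
  have "AE x in \<eta>. \<forall>k. \<not> growth_le (c k) x"
    unfolding AE_all_countable using ergodic_AE_growth[OF erg c] by blast
  with AE_wcount_upper[OF \<rho>] AE_growth_rate AE_Mspace show ?thesis
  proof eventually_elim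
    case (elim x)
    note x = \<open>x \<in> Mspace d\<close>
    have ni: "nonisolated x"
    proof (rule ccontr)
      assume "\<not> nonisolated x"
      hence "wcount n x \<le> 1 * c 0 ^ n" for n using wcount_isolated c(1)[of 0] by (cases n) auto
      hence "growth_le (c 0) x" using c(1) by (rule growth_leI)
      thus False using elim by blast
    qed
    obtain L where L: "(\<lambda>n. ln (wcount n x) / real n) \<longlonglongrightarrow> L" using elim ni by blast
    obtain C where C: "\<And>n. (wcount n x)\<^sup>2 \<le> C * (real n + 1) ^ 2 * \<rho> ^ (2 * n)" using elim by blast
    have "L = ln \<rho>"
    proof (rule growth_rate_eq[OF wcount_ge_1[OF x ni] L \<rho> C])
      fix k D
      show "\<exists>n. D * (\<rho> * (1 - 1 / (real k + 2))) ^ n < wcount n x"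
      proof (rule ccontr)
        assume "\<not> ?thesis"
        hence "growth_le (c k) x" using c(1) by (intro growth_leI[of _ D]) (auto simp: not_less c_def)
        thus False using elim by blast
      qed
    qed
    moreover have "walk_rate x = (\<lambda>n. ereal (ln (wcount n x) / real n))"
      using walk_rate_nonisolated[OF x ni] by (simp add: fun_eq_iff)
    ultimately show ?case using L \<rho> by (simp add: elog_def)
  qed
qed

end

section \<open>Walk growth of unimodular random graphs\<close>

theorem theorem1p4:
  fixes d :: nat
    and P :: "'p measure"
    and X :: "'p \<Rightarrow> rgraph set"
    and \<eta> :: "rgraph set measure"
  assumes "prob_space P"
    and "X \<in> measurable P (Mborel d)"
    and "unimodular d P X"
    and "\<eta> = distr P (Mborel d) X"
  shows "(AE \<omega> in P. \<exists>L::ereal. L \<noteq> \<infinity> \<and> walk_rate (X \<omega>) \<longlonglongrightarrow> L) \<and>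
    (ergodic d \<eta> \<longrightarrow>
       L2_bounded_operator \<eta> adjacency_op \<and>
       L2_selfadjoint \<eta> adjacency_op \<and>
       (AE \<omega> in P. walk_rate (X \<omega>) \<longlonglongrightarrow> elog (L2_onorm \<eta> adjacency_op)))"
proof -
  interpret P: prob_space P by fact
  interpret eta: prob_space \<eta> unfolding assms(4) by (rule P.prob_space_distr[OF assms(2)])
  interpret reversible_law \<eta> d
  proof
    show "sets \<eta> = sets (Mborel d)" by (simp add: assms(4))
    fix f g :: "rgraph set \<Rightarrow> ennreal"
    assume f: "f \<in> borel_measurable (Mborel d)" and g: "g \<in> borel_measurable (Mborel d)"
    have "(\<lambda>x. f x * adj g x) \<in> borel_measurable (Mborel d)" "(\<lambda>x. adj f x * g x) \<in> borel_measurable (Mborel d)"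
      using f g measurable_adj_ennreal by auto
    thus "(\<integral>\<^sup>+x. f x * adj g x \<partial>\<eta>) = (\<integral>\<^sup>+x. adj f x * g x \<partial>\<eta>)"
      using unimodular_adj[OF assms(3,2) f g] by (simp add: assms(4) nn_integral_distr[OF assms(2)])
  qed
  have transfer: "AE \<omega> in P. Q (X \<omega>)" if "AE x in \<eta>. Q x" for Q
    using AE_distrD[OF assms(2)] that unfolding assms(4) .
  show ?thesis
    unfolding adjacency_op_eq_adj
    using transfer[OF AE_walk_rate_converges] adj_bounded_operator adj_selfadjoint
      transfer[OF ergodic_AE_walk_rate] unfolding \<rho>_def by blast
qed

end
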